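(* Let $h,\lambda\in(0,\frac12]$ and $m\in[1,\infty)$. Then $$\min\left\{\max\{h\lambda^{3/2},(h\lambda)^{12/11}\},\ \lambda^2\right\}\ \lesssim_m\ \min_{A^{NL}_{\lambda,1,m}}E^{NL}_h-\mathcal{E}^{NL}_b(1,h)\ \lesssim\ \min\{\lambda h,\lambda^2\}.$$
   Context: Let $I_\theta=[0,2\pi]$, $I_z=[-\frac12,\frac12]$, $\Omega=I_\theta\times I_z$ with coordinates $(\theta,z)$; $|\Omega|=2\pi$. $H^k_{\mathrm{per}}(\Omega)$ is the space of ($\Omega$-)periodic $L^2$-based Sobolev functions of order $k$. A deformation $\Phi:\Omega\to\mathbb{R}^3$ is given in cylindrical coordinates by $(\Phi_\rho,\Phi_\theta,\Phi_z)$, i.e. as a map into Cartesian $\mathbb{R}^3$ it is $(\Phi_\rho\cos\Phi_\theta,\Phi_\rho\sin\Phi_\theta,\Phi_z)$; $D\Phi$ and $D^2\Phi$ denote the first and second derivatives in $(\theta,z)$ of this $\mathbb{R}^3$-valued map. The energy is $E^{NL}_h(\Phi)=\int_\Omega|D\Phi^TD\Phi-\mathrm{id}|^2+h^2|D^2\Phi|^2\,d\theta\,dz$ (Euclidean norms, so $|D^2\Phi|^2=|\partial_\theta^2\Phi|^2+2|\partial_{\theta z}\Phi|^2+|\partial_z^2\Phi|^2$). The admissible set $A^{NL}_{\lambda,\varrho,m}$ consists of all $\Phi$ with $\Phi_\rho\in H^2_{\mathrm{per}}(\Omega)$, $\Phi_\theta-\theta\in H^2_{\mathrm{per}}(\Omega)$,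 $\Phi_z-(1-\lambda)z\in H^2_{\mathrm{per}}(\Omega)$, $\Phi_\rho\ge\varrho$, $\max_{i\in\{\theta,z\},\,j\in\{\rho,\theta,z\}}\|\partial_i\Phi_j\|_{L^\infty(\Omega)}\le m$ (derivatives of the scalar cylindrical components), and $\partial_z\Phi_z\ge0$ a.e.; here $\varrho=1$. The bulk energy is $\mathcal{E}^{NL}_b(\varrho,h)=|\Omega|(\varrho^2-1)^2+|\Omega|\varrho^2h^2$, so $\mathcal{E}^{NL}_b(1,h)=|\Omega|h^2$. $\min_A E$ denotes the minimum energy value, i.e. the infimum of $E$ over $A$. $X\lesssim Y$ (resp. $X\lesssim_a Y$) means $X\le CY$ with $C>0$ a numerical constant (resp. depending only on $a$). *)

theory Defs
  imports "HOL-Analysis.Analysis" "HOL-Probability.Essential_Supremum"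
begin

section \<open>Domain and test functions\<close>

definition Omega :: "(real \<times> real) set" where
  "Omega = {0..2 * pi} \<times> {-1/2..1/2}"

abbreviation leb_Omega :: "(real \<times> real) measure" where
  "leb_Omega \<equiv> lebesgue_on Omega"

text \<open>The two coordinate directions; together they form \<^term>\<open>Basis :: (real \<times> real) set\<close>.\<close>

definition e_theta :: "real \<times> real" where "e_theta = (1, 0)"
definition e_z :: "real \<times> real" where "e_z = (0, 1)"

primrec C_diff :: "nat \<Rightarrow> ('a::euclidean_space \<Rightarrow> real) \<Rightarrow> bool" where
  "C_diff 0 f \<longleftrightarrow> continuous_on UNIV f"
| "C_diff (Suc k) f \<longleftrightarrow> (\<forall>x. f differentiable at x) \<and>
     (\<forall>i\<in>Basis. C_diff k (\<lambda>x. frechet_derivative f (at x) i))"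

definition smooth :: "('a::euclidean_space \<Rightarrow> real) \<Rightarrow> bool" where
  "smooth f \<longleftrightarrow> (\<forall>k. C_diff k f)"

definition test_fun :: "(real \<times> real \<Rightarrow> real) set" where
  "test_fun = {\<phi>. smooth \<phi> \<and> compact (closure {x. \<phi> x \<noteq> 0}) \<and>
                  closure {x. \<phi> x \<noteq> 0} \<subseteq> interior Omega}"

definition per_test_fun :: "(real \<times> real \<Rightarrow> real) set" where
  "per_test_fun = {\<phi>. smooth \<phi> \<and> (\<forall>x. \<phi> (x + (2 * pi, 0)) = \<phi> x) \<and>
                      (\<forall>x. \<phi> (x + (0, 1)) = \<phi> x)}"

section \<open>Weak derivatives and periodic Sobolev spaces\<close>

text \<open>Functions on \<^term>\<open>Omega\<close> are represented by functions on the plane whose values outside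
  \<^term>\<open>Omega\<close> are irrelevant. Below, \<open>g\<close> is the weak derivative of \<open>u\<close> in direction \<open>i\<close>, tested
  with the functions in \<open>T\<close>. With \<open>T = test_fun\<close> this is the weak derivative in the interior
  of \<^term>\<open>Omega\<close>; with \<open>T = per_test_fun\<close> it is the one on the torus, so that a jump of the
  periodic extension of \<open>u\<close> across the boundary of \<^term>\<open>Omega\<close> is not allowed.\<close>

definition has_weak_deriv ::
  "(real \<times> real \<Rightarrow> real) set \<Rightarrow> real \<times> real \<Rightarrow>
   (real \<times> real \<Rightarrow> 'b::euclidean_space) \<Rightarrow> (real \<times> real \<Rightarrow> 'b) \<Rightarrow> bool" where
  "has_weak_deriv T i u g \<longleftrightarrow> integrable leb_Omega u \<and> integrable leb_Omega g \<and>
     (\<forall>\<phi>\<in>T. (\<integral>x. frechet_derivative \<phi> (at x) i *\<^sub>R u x \<partial>leb_Omega)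
             = - (\<integral>x. \<phi> x *\<^sub>R g x \<partial>leb_Omega))"

text \<open>The weak derivative in the interior of \<^term>\<open>Omega\<close>, where it exists. It is unique almost
  everywhere, so the choice does not influence integrals and essential suprema.\<close>

definition weak_deriv ::
  "real \<times> real \<Rightarrow> (real \<times> real \<Rightarrow> 'b::euclidean_space) \<Rightarrow> real \<times> real \<Rightarrow> 'b" where
  "weak_deriv i u = (SOME g. has_weak_deriv test_fun i u g)"

definition L2_Omega :: "(real \<times> real \<Rightarrow> real) set" where
  "L2_Omega = {u. u \<in> borel_measurable leb_Omega \<and> integrable leb_Omega (\<lambda>x. (u x)\<^sup>2)}"

primrec H_per :: "nat \<Rightarrow> (real \<times> real \<Rightarrow> real) set" where
  "H_per 0 = L2_Omega"
| "H_per (Suc k) = {u \<in> L2_Omega. \<forall>i\<in>Basis. \<exists>g\<in>H_per k. has_weak_deriv per_test_fun i u g}"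

definition Linf_norm :: "(real \<times> real \<Rightarrow> real) \<Rightarrow> ereal" where
  "Linf_norm u = esssup leb_Omega (\<lambda>x. ereal \<bar>u x\<bar>)"

section \<open>Deformations, admissible set and energy\<close>

text \<open>A deformation is given by its scalar cylindrical components.\<close>

record deformation =
  Phi_rho :: "real \<times> real \<Rightarrow> real"
  Phi_theta :: "real \<times> real \<Rightarrow> real"
  Phi_z :: "real \<times> real \<Rightarrow> real"

definition cartesian :: "deformation \<Rightarrow> real \<times> real \<Rightarrow> real \<times> real \<times> real" where
  "cartesian \<Phi> x = (Phi_rho \<Phi> x * cos (Phi_theta \<Phi> x),
                    Phi_rho \<Phi> x * sin (Phi_theta \<Phi> x),
                    Phi_z \<Phi> x)"

text \<open>The \<open>(i, j)\<close> entry of \<open>D\<Phi>\<^sup>T D\<Phi>\<close> is the inner product of the derivatives of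
  \<open>\<Phi>\<close> in directions \<open>i\<close> and \<open>j\<close>, and \<^term>\<open>i \<bullet> j\<close> is the entry of the identity.\<close>

definition energy_NL :: "real \<Rightarrow> deformation \<Rightarrow> ennreal" where
  "energy_NL h \<Phi> = (let X = cartesian \<Phi> in
     \<integral>\<^sup>+ x. ennreal
        ((\<Sum>i\<in>Basis. \<Sum>j\<in>Basis. (weak_deriv i X x \<bullet> weak_deriv j X x - i \<bullet> j)\<^sup>2)
         + h\<^sup>2 * (\<Sum>i\<in>Basis. \<Sum>j\<in>Basis. (norm (weak_deriv i (weak_deriv j X) x))\<^sup>2)) \<partial>leb_Omega)"

definition A_NL :: "real \<Rightarrow> real \<Rightarrow> real \<Rightarrow> deformation set" where
  "A_NL lam rho m = {\<Phi>.
     Phi_rho \<Phi> \<in> H_per 2 \<and>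
     (\<lambda>(\<theta>, z). Phi_theta \<Phi> (\<theta>, z) - \<theta>) \<in> H_per 2 \<and>
     (\<lambda>(\<theta>, z). Phi_z \<Phi> (\<theta>, z) - (1 - lam) * z) \<in> H_per 2 \<and>
     (AE x in leb_Omega. Phi_rho \<Phi> x \<ge> rho) \<and>
     (MAX (i, u) \<in> {e_theta, e_z} \<times> {Phi_rho \<Phi>, Phi_theta \<Phi>, Phi_z \<Phi>}.
        Linf_norm (weak_deriv i u)) \<le> ereal m \<and>
     (AE x in leb_Omega. weak_deriv e_z (Phi_z \<Phi>) x \<ge> 0)}"

text \<open>The minimum energy value, taken in the extended reals (infinite over an empty set).\<close>

definition min_energy_NL :: "real \<Rightarrow> real \<Rightarrow> real \<Rightarrow> real \<Rightarrow> ereal" where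
  "min_energy_NL lam rho m h = enn2ereal (INF \<Phi>\<in>A_NL lam rho m. energy_NL h \<Phi>)"

definition bulk_energy_NL :: "real \<Rightarrow> real \<Rightarrow> real" where
  "bulk_energy_NL rho h =
     measure lebesgue Omega * (rho\<^sup>2 - 1)\<^sup>2 + measure lebesgue Omega * rho\<^sup>2 * h\<^sup>2"

end

theory Submission
  imports Defs
begin

text \<open>
  Write \<open>f = Phi_rho - 1 \<ge> 0\<close> and let \<open>\<epsilon>\<close> be the excess of the energy over the bulk energy
  \<open>2 * pi * h\<^sup>2\<close>. Both bounds rest on the formula for the energy density in cylindrical components
  (\<open>energy_formula\<close>): the stretching is measured by
  \<open>gtt = (d_theta rho)\<^sup>2 + rho\<^sup>2 (d_theta theta)\<^sup>2 + (d_theta z)\<^sup>2 - 1\<close> and its companions \<open>gtz\<close>, \<open>gzz\<close>,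
  and the second derivatives split into a radial, an angular and an axial part.

  Lower bound. The radial part of the angular curvature alone costs at least the bulk bending energy,
  since the square lies above its tangent line and the tangent line has a fixed mean by periodicity
  (\<open>bulk_bending\<close>). Hence the squares of \<open>gtt\<close>, \<open>gtz\<close>, \<open>gzz\<close> and \<open>h\<^sup>2\<close> times the square of the
  radial axial curvature have integral at most \<open>\<epsilon>\<close> (\<open>excess_bounds\<close>). Because \<open>d_theta theta\<close>
  has mean one and \<open>rho \<ge> 1\<close>, every circle is at least as long as the unit circle, so the
  \<open>L\<^sup>1\<close> norm of \<open>gtt\<close>, which is of order \<open>\<surd>\<epsilon>\<close>, controls \<open>f\<close> in \<open>L\<^sup>1\<close> and the oscillations along
  circles in \<open>L\<^sup>2\<close> (\<open>theta_estimates\<close>). The imposed compression \<open>lam\<close> has to be absorbed by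
  \<open>d_z rho\<close>, up to an error of order \<open>\<surd>\<epsilon>\<close> (\<open>compression_estimate\<close>, \<open>twist_estimate\<close>). Finally
  \<open>d_z rho\<close> is interpolated between \<open>f\<close>, which is small, and \<open>d_z d_z rho\<close>, whose square has an
  integral of order \<open>\<epsilon> / h\<^sup>2 + \<surd>\<epsilon>\<close> (\<open>curvature_estimate\<close>), in two ways.
  \<^item> On strips of height \<open>1 / N\<close>, the sign of \<open>f\<close> and the Lipschitz bound give
    \<open>lam \<lesssim> N \<surd>\<epsilon> + \<epsilon> / (h\<^sup>2 N\<^sup>2)\<close> (\<open>z_estimate_strips\<close>); the optimal \<open>N\<close>, of order
    \<open>lam / \<surd>\<epsilon>\<close>, leads to \<open>\<epsilon> \<gtrsim> h lam powr (3/2)\<close>.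
  \<^item> Integration by parts bounds the square of \<open>d_z rho\<close> by the product of the \<open>L\<^sup>2\<close> norms of \<open>f\<close>
    and \<open>d_z d_z rho\<close> (\<open>z_estimate_product\<close>), and the \<open>L\<^sup>2\<close> norm of \<open>f\<close> is at most of order
    \<open>\<epsilon> powr (5/12)\<close>; hence \<open>lam \<lesssim> \<surd>\<epsilon> + \<epsilon> powr (11/12) / h\<close>, which leads to
    \<open>\<epsilon> \<gtrsim> (h lam) powr (12/11)\<close>.

  Both conclusions presuppose that \<open>lam\<close> is large compared with \<open>\<surd>\<epsilon>\<close>; if it is not, then \<open>\<epsilon> \<gtrsim> lam\<^sup>2\<close>, which
  is the other alternative of the minimum (\<open>scalar_lower_bound\<close>).

  Upper bound. Two axisymmetric deformations suffice. The homogeneously compressed cylinder has excess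
  of order \<open>lam\<^sup>2\<close> (\<open>flat_competitor\<close>). A profile with \<open>N\<close> wrinkles that is parametrised by arc length
  has no axial stretching; with \<open>N\<close> of order \<open>h powr (-1/2)\<close> its angular stretching and its
  bending balance at order \<open>lam h\<close> (\<open>wrinkled_competitor\<close>).

  The weak derivatives are handled on lines: a function has a weak derivative in a coordinate direction
  on the torus exactly if it is absolutely continuous on almost every line in that direction and the
  derivative has mean zero there (\<open>per_weak_imp_lines\<close>, \<open>WD_imp_weak_per\<close>). All estimates are then
  one-dimensional and are integrated by Fubini's theorem.
\<close>

section \<open>Absolutely continuous functions on an interval\<close>

text \<open>Absolute continuity in the form of the fundamental theorem: \<open>F\<close> is a primitive of the prescribed
  density \<open>f\<close>. Carrying the density along avoids almost everywhere differentiation.\<close>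

definition AC_on :: "real \<Rightarrow> real \<Rightarrow> (real \<Rightarrow> real) \<Rightarrow> (real \<Rightarrow> real) \<Rightarrow> bool" where
  "AC_on c d F f \<longleftrightarrow> f absolutely_integrable_on {c..d} \<and>
     (\<forall>x\<in>{c..d}. F x = F c + integral {c..x} f)"

lemma AC_on_diff:
  assumes "AC_on c d F f" "c \<le> x" "x \<le> y" "y \<le> d"
  shows "F y - F x = integral {x..y} f"
proof -
  have i: "f integrable_on {c..y}"
    using assms unfolding AC_on_def
    by (meson absolutely_integrable_on_def atLeastatMost_subset_iff integrable_on_subinterval order_refl)
  have "integral {c..x} f + integral {x..y} f = integral {c..y} f"
    by (rule Henstock_Kurzweil_Integration.integral_combine) (use assms i in auto)
  moreover have "F x = F c + integral {c..x} f" "F y = F c + integral {c..y} f"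
    using assms unfolding AC_on_def by (meson atLeastAtMost_iff order_trans)+
  ultimately show ?thesis by linarith
qed

lemma AC_on_abs_int: "AC_on c d F f \<Longrightarrow> c \<le> x \<Longrightarrow> y \<le> d \<Longrightarrow> f absolutely_integrable_on {x..y}"
  unfolding AC_on_def by (meson absolutely_integrable_on_subinterval atLeastatMost_subset_iff)

lemma AC_on_int: "AC_on c d F f \<Longrightarrow> c \<le> x \<Longrightarrow> y \<le> d \<Longrightarrow> f integrable_on {x..y}"
  using AC_on_abs_int set_lebesgue_integral_eq_integral(1) by blast

lemma AC_on_continuous:
  assumes "AC_on c d F f" shows "continuous_on {c..d} F"
proof -
  have "f integrable_on {c..d}" using AC_on_int[OF assms] by auto
  then have "continuous_on {c..d} (\<lambda>x. F c + integral {c..x} f)"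
    by (intro continuous_intros indefinite_integral_continuous_1)
  then show ?thesis by (rule continuous_on_eq) (use assms in \<open>unfold AC_on_def, metis\<close>)
qed

lemma AC_onI:
  assumes "f absolutely_integrable_on {c..d}"
    and "\<And>x y. c \<le> x \<Longrightarrow> x \<le> y \<Longrightarrow> y \<le> d \<Longrightarrow> F y - F x = integral {x..y} f"
  shows "AC_on c d F f"
  unfolding AC_on_def
proof (intro conjI ballI assms(1))
  fix x assume "x \<in> {c..d}"
  then show "F x = F c + integral {c..x} f" using assms(2)[of c x] by simp
qed

lemma AC_on_add: "AC_on c d F f \<Longrightarrow> AC_on c d G g \<Longrightarrow> AC_on c d (\<lambda>x. F x + G x) (\<lambda>x. f x + g x)"
  by (rule AC_onI) (auto intro!: set_integral_add(1) AC_on_abs_int[of c d] simp: AC_on_diff integral_add AC_on_int add_diff_add)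

lemma AC_on_const: "AC_on c d (\<lambda>x. k) (\<lambda>x. 0)"
  by (auto simp: AC_on_def)

lemma AC_on_C1:
  assumes "\<And>x. x \<in> {c..d} \<Longrightarrow> (F has_real_derivative f x) (at x within {c..d})" "continuous_on {c..d} f"
  shows "AC_on c d F f"
proof (rule AC_onI)
  show "f absolutely_integrable_on {c..d}"
    by (rule absolutely_integrable_continuous_real[OF assms(2)])
  fix x y assume xy: "c \<le> x" "x \<le> y" "y \<le> d"
  then have "(f has_integral F y - F x) {x..y}"
    by (intro fundamental_theorem_of_calculus)
       (auto simp: has_real_derivative_iff_has_vector_derivative[symmetric] intro!: DERIV_subset[OF assms(1)])
  then show "F y - F x = integral {x..y} f" by (simp add: integral_unique)
qed

text \<open>On a partition so fine that \<open>\<Gamma>\<close> grows by at most \<open>\<delta>\<close> on each cell, the increments of \<open>K\<close> add up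
  to at most \<open>C * \<delta>\<close> times the total growth of \<open>\<Gamma>\<close>, and \<open>\<delta>\<close> is arbitrary. This replaces the theorem
  that an absolutely continuous function with vanishing derivative is constant.\<close>

lemma constant_of_quadratic_increments:
  fixes K \<Gamma> :: "real \<Rightarrow> real"
  assumes K: "\<And>x y. c \<le> x \<Longrightarrow> x \<le> y \<Longrightarrow> y \<le> d \<Longrightarrow> \<bar>K y - K x\<bar> \<le> C * (\<Gamma> y - \<Gamma> x)\<^sup>2"
    and \<Gamma>: "continuous_on {c..d} \<Gamma>" "mono_on {c..d} \<Gamma>" and cd: "c \<le> d" and C: "C \<ge> 0"
  shows "K d = K c"
proof -
  have "\<bar>K d - K c\<bar> \<le> 0 + e" if e: "e > 0" for e
  proof -
    define T where "T = C * (\<Gamma> d - \<Gamma> c) + 1"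
    have gm: "\<Gamma> x \<le> \<Gamma> y" if "c \<le> x" "x \<le> y" "y \<le> d" for x y
      using \<Gamma>(2) that by (auto simp: mono_on_def)
    have T: "T > 0" unfolding T_def using C gm[of c d] cd by (simp add: add_nonneg_pos)
    have "uniformly_continuous_on {c..d} \<Gamma>" by (intro compact_uniformly_continuous \<Gamma>) auto
    then obtain \<delta> where \<delta>: "\<delta> > 0" "\<And>x y. x \<in> {c..d} \<Longrightarrow> y \<in> {c..d} \<Longrightarrow> dist y x < \<delta> \<Longrightarrow> dist (\<Gamma> y) (\<Gamma> x) < e / T"
      unfolding uniformly_continuous_on_def using e T by (metis divide_pos_pos)
    obtain N :: nat where N: "N > 0" "(d - c) / N < \<delta>"
      using \<delta>(1) cd by (metis reals_Archimedean3 divide_less_eq gr0I mult.commute of_nat_0_less_iff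
          of_nat_0 mult_zero_left diff_ge_0_iff_ge linorder_not_less)
    define p where "p i = c + real i * ((d - c) / N)" for i :: nat
    have p: "p 0 = c" "p N = d" using N by (auto simp: p_def)
    have pd: "p (Suc i) - p i = (d - c) / N" for i unfolding p_def of_nat_Suc distrib_right by simp
    have step: "p i \<le> p (Suc i)" for i using pd[of i] cd N by (smt (verit) divide_nonneg_nonneg of_nat_0_le_iff)
    have pm: "p i \<le> p j" if "i \<le> j" for i j using that by (rule lift_Suc_mono_le[of p, OF step])
    have "\<bar>K (p j) - K c\<bar> \<le> C * (e / T) * (\<Gamma> (p j) - \<Gamma> c)" if "j \<le> N" for j
      using that
    proof (induction j)
      case 0 then show ?case by (simp add: p)
    next
      case (Suc j)
      have r: "c \<le> p j" "p j \<le> p (Suc j)" "p (Suc j) \<le> d"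
        using pm[of 0 j] pm[of "Suc j" N] step p Suc by auto
      have "dist (\<Gamma> (p (Suc j))) (\<Gamma> (p j)) < e / T"
        by (rule \<delta>(2)) (use r pd[of j] N(2) in \<open>auto simp: dist_real_def\<close>)
      then have "\<Gamma> (p (Suc j)) - \<Gamma> (p j) \<le> e / T" by (simp add: dist_real_def)
      then have "C * (\<Gamma> (p (Suc j)) - \<Gamma> (p j))\<^sup>2 \<le> C * ((e / T) * (\<Gamma> (p (Suc j)) - \<Gamma> (p j)))"
        unfolding power2_eq_square using gm[of "p j" "p (Suc j)"] r C
        by (intro mult_left_mono mult_right_mono) auto
      with K[of "p j" "p (Suc j)"] r have "\<bar>K (p (Suc j)) - K (p j)\<bar> \<le> C * (e/T) * (\<Gamma> (p (Suc j)) - \<Gamma> (p j))"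
        by (simp add: mult.assoc)
      with Suc show ?case by (simp add: right_diff_distrib)
    qed
    from this[of N] have "\<bar>K d - K c\<bar> \<le> (C * (\<Gamma> d - \<Gamma> c)) * (e / T)" using p by (simp add: mult_ac)
    also have "\<dots> \<le> T * (e / T)" by (intro mult_right_mono) (use T e in \<open>auto simp: T_def\<close>)
    also have "\<dots> = e" using T by simp
    finally show ?thesis by simp
  qed
  then have "\<bar>K d - K c\<bar> \<le> 0" by (rule field_le_epsilon)
  then show ?thesis by simp
qed

text \<open>The common source of the product and the chain rule: it suffices that \<open>k\<close> predicts the increments
  of \<open>K\<close> up to an error that is quadratic in the integral of some \<open>g\<close>.\<close>

lemma AC_on_by_quadratic_increments:
  assumes k: "k absolutely_integrable_on {c..d}" and C: "C \<ge> 0"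
    and g: "g absolutely_integrable_on {c..d}" "\<And>x. x \<in> {c..d} \<Longrightarrow> 0 \<le> g x"
    and K: "\<And>x y. c \<le> x \<Longrightarrow> x \<le> y \<Longrightarrow> y \<le> d \<Longrightarrow> \<bar>K y - K x - integral {x..y} k\<bar> \<le> C * (integral {x..y} g)\<^sup>2"
  shows "AC_on c d K k"
proof (rule AC_onI[OF k])
  fix x y assume xy: "c \<le> x" "x \<le> y" "y \<le> d"
  have gi: "g integrable_on {u..v}" if "x \<le> u" "v \<le> y" for u v
    by (rule integrable_on_subinterval[of g "{c..d}"]) (use g that xy in \<open>auto simp: absolutely_integrable_on_def\<close>)
  have ki: "k integrable_on {u..v}" if "x \<le> u" "v \<le> y" for u v
    by (rule integrable_on_subinterval[of k "{c..d}"]) (use k that xy in \<open>auto simp: absolutely_integrable_on_def\<close>)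
  have gc: "integral {x..u} g + integral {u..v} g = integral {x..v} g" if "x \<le> u" "u \<le> v" "v \<le> y" for u v
    by (rule Henstock_Kurzweil_Integration.integral_combine) (use that gi in auto)
  have kc: "integral {x..u} k + integral {u..v} k = integral {x..v} k" if "x \<le> u" "u \<le> v" "v \<le> y" for u v
    by (rule Henstock_Kurzweil_Integration.integral_combine) (use that ki in auto)
  have "K y - integral {x..y} k = K x - integral {x..x} k"
  proof (rule constant_of_quadratic_increments[where K="\<lambda>u. K u - integral {x..u} k" and \<Gamma>="\<lambda>u. integral {x..u} g" and C=C])
    show "continuous_on {x..y} (\<lambda>u. integral {x..u} g)" by (intro indefinite_integral_continuous_1 gi) auto
    have gn: "integral {u..v} g \<ge> 0" if "x \<le> u" "v \<le> y" for u v
      by (rule integral_nonneg) (use gi g that xy in auto)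
    show "mono_on {x..y} (\<lambda>u. integral {x..u} g)"
    proof (rule mono_onI)
      fix u v assume "u \<in> {x..y}" "v \<in> {x..y}" "u \<le> v"
      then show "integral {x..u} g \<le> integral {x..v} g" using gc[of u v] gn[of u v] by simp
    qed
  next
    fix u v assume uv: "x \<le> u" "u \<le> v" "v \<le> y"
    have "K v - integral {x..v} k - (K u - integral {x..u} k) = K v - K u - integral {u..v} k"
      "integral {x..v} g - integral {x..u} g = integral {u..v} g"
      using gc[OF uv] kc[OF uv] by linarith+
    with K[of u v] uv xy
    show "\<bar>K v - integral {x..v} k - (K u - integral {x..u} k)\<bar> \<le> C * (integral {x..v} g - integral {x..u} g)\<^sup>2"
      by simp
  qed (use xy C in auto)
  then show "K y - K x = integral {x..y} k" by simp
qed

lemma abs_int_mult_continuous: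
  fixes f :: "real \<Rightarrow> real"
  assumes "f absolutely_integrable_on {c..d}" "continuous_on {c..d} h"
  shows "(\<lambda>x. h x * f x) absolutely_integrable_on {c..d}"
  using assms by (intro absolutely_integrable_bounded_measurable_product_real
      borel_measurable_continuous_onI compact_imp_bounded compact_continuous_image
      continuous_imp_measurable_on_sets_lebesgue) auto

lemma abs_integral_mult_bound:
  fixes f h :: "real \<Rightarrow> real"
  assumes "f absolutely_integrable_on {x..y}" "(\<lambda>t. h t * f t) integrable_on {x..y}"
    and "\<And>t. t \<in> {x..y} \<Longrightarrow> \<bar>h t\<bar> \<le> B"
  shows "\<bar>integral {x..y} (\<lambda>t. h t * f t)\<bar> \<le> B * integral {x..y} (\<lambda>t. \<bar>f t\<bar>)"
proof -
  have "(\<lambda>t. \<bar>f t\<bar>) integrable_on {x..y}" using assms(1) by (simp add: absolutely_integrable_on_def)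
  then have "norm (integral {x..y} (\<lambda>t. h t * f t)) \<le> integral {x..y} (\<lambda>t. B * \<bar>f t\<bar>)"
    by (intro integral_norm_bound_integral assms)
       (use assms(3) in \<open>auto simp: abs_mult intro!: mult_right_mono integrable_on_mult_right\<close>)
  then show ?thesis by simp
qed

lemma AC_on_mult:
  assumes F: "AC_on c d F f" and G: "AC_on c d G g"
  shows "AC_on c d (\<lambda>x. F x * G x) (\<lambda>x. G x * f x + F x * g x)"
proof (rule AC_on_by_quadratic_increments[where C=2 and g="\<lambda>x. \<bar>f x\<bar> + \<bar>g x\<bar>"])
  have fa: "f absolutely_integrable_on {x..y}" "g absolutely_integrable_on {x..y}" if "c \<le> x" "y \<le> d" for x y
    using F G that by (auto intro: AC_on_abs_int)
  have cont: "continuous_on {x..y} F" "continuous_on {x..y} G" if "c \<le> x" "y \<le> d" for x y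
    using continuous_on_subset[OF AC_on_continuous[OF F], of "{x..y}"] continuous_on_subset[OF AC_on_continuous[OF G], of "{x..y}"] that by auto
  show "(\<lambda>x. G x * f x + F x * g x) absolutely_integrable_on {c..d}"
    by (intro set_integral_add(1) abs_int_mult_continuous fa cont) auto
  show "(\<lambda>x. \<bar>f x\<bar> + \<bar>g x\<bar>) absolutely_integrable_on {c..d}"
    using fa[of c d] by (auto intro!: set_integral_add(1) set_integrable_abs)
  fix x y assume xy: "c \<le> x" "x \<le> y" "y \<le> d"
  define \<Gamma> where "\<Gamma> = integral {x..y} (\<lambda>x. \<bar>f x\<bar> + \<bar>g x\<bar>)"
  have ai: "(\<lambda>x. \<bar>f x\<bar>) integrable_on {u..v}" "(\<lambda>x. \<bar>g x\<bar>) integrable_on {u..v}" if "x \<le> u" "v \<le> y" for u v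
    using fa[of u v] that xy by (auto simp: absolutely_integrable_on_def)
  have \<Gamma>: "\<Gamma> = integral {x..y} (\<lambda>x. \<bar>f x\<bar>) + integral {x..y} (\<lambda>x. \<bar>g x\<bar>)"
    unfolding \<Gamma>_def using ai by (intro integral_add) auto
  have incr: "\<bar>F v - F u\<bar> \<le> \<Gamma>" "\<bar>G v - G u\<bar> \<le> \<Gamma>" if "x \<le> u" "u \<le> v" "v \<le> y" for u v
  proof -
    have *: "\<bar>integral {u..v} h\<bar> \<le> \<Gamma>" if h: "h = f \<or> h = g" for h
    proof -
      have hi: "h integrable_on {u..v}" using h fa[of u v] that \<open>x \<le> u\<close> \<open>v \<le> y\<close> xy
        by (auto simp: absolutely_integrable_on_def)
      have "norm (integral {u..v} h) \<le> integral {u..v} (\<lambda>x. \<bar>f x\<bar> + \<bar>g x\<bar>)"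
        by (rule integral_norm_bound_integral) (use hi ai[OF \<open>x \<le> u\<close> \<open>v \<le> y\<close>] h in \<open>auto intro: integrable_add\<close>)
      also have "\<dots> \<le> \<Gamma>" unfolding \<Gamma>_def
        by (rule integral_subset_le) (use ai[of u v] ai[of x y] \<open>x \<le> u\<close> \<open>v \<le> y\<close> in \<open>auto intro: integrable_add\<close>)
      finally show ?thesis by simp
    qed
    show "\<bar>F v - F u\<bar> \<le> \<Gamma>" "\<bar>G v - G u\<bar> \<le> \<Gamma>"
      using *[of f] *[of g] AC_on_diff[OF F, of u v] AC_on_diff[OF G, of u v] that xy by auto
  qed
  have Fl: "(\<lambda>t. h t * f t) integrable_on {x..y}" "(\<lambda>t. h t * g t) integrable_on {x..y}" if "continuous_on {x..y} h" for h
    using abs_int_mult_continuous[OF _ that] fa[of x y] xy by (auto simp: absolutely_integrable_on_def)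
  note c2 = cont[of x y]
  have I1: "integral {x..y} (\<lambda>t. G t * f t + F t * g t) = integral {x..y} (\<lambda>t. G t * f t) + integral {x..y} (\<lambda>t. F t * g t)"
    by (intro integral_add Fl c2) (use xy in auto)
  \<comment> \<open>The error of the product rule is a sum of two integrals in which the oscillation of one factor
    multiplies the density of the other, so it is quadratic.\<close>
  have I2: "integral {x..y} (\<lambda>t. (G y - G t) * f t) = G y * (F y - F x) - integral {x..y} (\<lambda>t. G t * f t)"
    using AC_on_diff[OF F, of x y] xy Fl(1)[OF c2(2)] Fl(1)[OF continuous_on_const[of _ "G y"]]
    by (simp add: left_diff_distrib integral_diff)
  have I3: "integral {x..y} (\<lambda>t. (F x - F t) * g t) = F x * (G y - G x) - integral {x..y} (\<lambda>t. F t * g t)"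
    using AC_on_diff[OF G, of x y] xy Fl(2)[OF c2(1)] Fl(2)[OF continuous_on_const[of _ "F x"]]
    by (simp add: left_diff_distrib integral_diff)
  have b1: "\<bar>integral {x..y} (\<lambda>t. (G y - G t) * f t)\<bar> \<le> \<Gamma> * integral {x..y} (\<lambda>t. \<bar>f t\<bar>)"
    by (rule abs_integral_mult_bound) (use fa xy c2 incr in \<open>auto intro!: Fl continuous_intros\<close>)
  have "\<bar>integral {x..y} (\<lambda>t. (F x - F t) * g t)\<bar> \<le> \<Gamma> * integral {x..y} (\<lambda>t. \<bar>g t\<bar>)"
  proof (rule abs_integral_mult_bound)
    fix t assume "t \<in> {x..y}" then show "\<bar>F x - F t\<bar> \<le> \<Gamma>" using incr(1)[of x t] by (auto simp: abs_minus_commute)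
  qed (use fa xy c2 in \<open>auto intro!: Fl continuous_intros\<close>)
  with b1 have "\<bar>integral {x..y} (\<lambda>t. (G y - G t) * f t) + integral {x..y} (\<lambda>t. (F x - F t) * g t)\<bar> \<le> \<Gamma> * \<Gamma>"
    by (simp add: \<Gamma> distrib_left)
  moreover have "F y * G y - F x * G x - integral {x..y} (\<lambda>x. G x * f x + F x * g x)
      = integral {x..y} (\<lambda>t. (G y - G t) * f t) + integral {x..y} (\<lambda>t. (F x - F t) * g t)"
    unfolding I1 I2 I3 by (simp add: algebra_simps)
  moreover have "\<Gamma> * \<Gamma> \<ge> 0" by simp
  ultimately show "\<bar>F y * G y - F x * G x - integral {x..y} (\<lambda>x. G x * f x + F x * g x)\<bar>
      \<le> 2 * (integral {x..y} (\<lambda>x. \<bar>f x\<bar> + \<bar>g x\<bar>))\<^sup>2"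
    unfolding \<Gamma>_def[symmetric] power2_eq_square by linarith
qed auto

text \<open>The hypotheses on \<open>\<phi>\<close> are those of a function whose second derivative is bounded by one; sine and
  cosine are the two instances.\<close>

lemma AC_on_compose:
  fixes \<phi> \<phi>' :: "real \<Rightarrow> real"
  assumes F: "AC_on c d F f"
    and t: "\<And>a b. \<bar>\<phi> b - \<phi> a - \<phi>' a * (b - a)\<bar> \<le> (b - a)\<^sup>2"
    and l: "\<And>a b. \<bar>\<phi>' b - \<phi>' a\<bar> \<le> \<bar>b - a\<bar>" and cp: "continuous_on UNIV \<phi>'"
  shows "AC_on c d (\<lambda>x. \<phi> (F x)) (\<lambda>x. \<phi>' (F x) * f x)"
proof (rule AC_on_by_quadratic_increments[where C=2 and g="\<lambda>x. \<bar>f x\<bar>"])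
  have fa: "f absolutely_integrable_on {x..y}" if "c \<le> x" "y \<le> d" for x y
    using F that by (auto intro: AC_on_abs_int)
  have cont: "continuous_on {x..y} F" if "c \<le> x" "y \<le> d" for x y
    using continuous_on_subset[OF AC_on_continuous[OF F], of "{x..y}"] that by auto
  have cc: "continuous_on {x..y} (\<lambda>x. \<phi>' (F x))" if "c \<le> x" "y \<le> d" for x y
    using continuous_on_compose2[OF cp cont[OF that]] by auto
  show "(\<lambda>x. \<phi>' (F x) * f x) absolutely_integrable_on {c..d}"
    by (intro abs_int_mult_continuous fa cc) auto
  show "(\<lambda>x. \<bar>f x\<bar>) absolutely_integrable_on {c..d}"
    using fa[of c d] by (auto intro!: set_integrable_abs)
  fix x y assume xy: "c \<le> x" "x \<le> y" "y \<le> d"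
  define \<Gamma> where "\<Gamma> = integral {x..y} (\<lambda>x. \<bar>f x\<bar>)"
  have ai: "(\<lambda>x. \<bar>f x\<bar>) integrable_on {u..v}" "f integrable_on {u..v}" if "x \<le> u" "v \<le> y" for u v
    using fa[of u v] that xy by (auto simp: absolutely_integrable_on_def)
  have incr: "\<bar>F v - F u\<bar> \<le> \<Gamma>" if "x \<le> u" "u \<le> v" "v \<le> y" for u v
  proof -
    have "norm (integral {u..v} f) \<le> integral {u..v} (\<lambda>x. \<bar>f x\<bar>)"
      by (rule integral_norm_bound_integral) (use ai that in auto)
    also have "\<dots> \<le> \<Gamma>" unfolding \<Gamma>_def
      by (rule integral_subset_le) (use ai[of u v] ai[of x y] that in auto)
    finally show ?thesis using AC_on_diff[OF F, of u v] that xy by auto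
  qed
  have Fl: "(\<lambda>t. h t * f t) integrable_on {x..y}" if "continuous_on {x..y} h" for h
    using abs_int_mult_continuous[OF _ that] fa[of x y] xy by (auto simp: absolutely_integrable_on_def)
  have I: "integral {x..y} (\<lambda>t. (\<phi>' (F t) - \<phi>' (F x)) * f t) = integral {x..y} (\<lambda>t. \<phi>' (F t) * f t) - \<phi>' (F x) * (F y - F x)"
    using AC_on_diff[OF F, of x y] xy Fl[OF cc[of x y]] Fl[OF continuous_on_const[of _ "\<phi>' (F x)"]]
    by (simp add: left_diff_distrib integral_diff)
  have "\<bar>integral {x..y} (\<lambda>t. (\<phi>' (F t) - \<phi>' (F x)) * f t)\<bar> \<le> \<Gamma> * integral {x..y} (\<lambda>t. \<bar>f t\<bar>)"
  proof (rule abs_integral_mult_bound)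
    fix t assume "t \<in> {x..y}" then show "\<bar>\<phi>' (F t) - \<phi>' (F x)\<bar> \<le> \<Gamma>" 
      using incr[of x t] l[of "F t" "F x"] by auto
  qed (use fa xy cc in \<open>auto intro!: Fl continuous_intros\<close>)
  moreover have "\<bar>\<phi> (F y) - \<phi> (F x) - \<phi>' (F x) * (F y - F x)\<bar> \<le> \<Gamma>\<^sup>2"
    using t[of "F y" "F x"] power_mono[OF incr[of x y], of 2] xy by auto
  ultimately show "\<bar>\<phi> (F y) - \<phi> (F x) - integral {x..y} (\<lambda>x. \<phi>' (F x) * f x)\<bar>
      \<le> 2 * (integral {x..y} (\<lambda>x. \<bar>f x\<bar>))\<^sup>2"
    unfolding \<Gamma>_def[symmetric] I power2_eq_square by (auto simp: \<Gamma>_def[symmetric])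
qed auto

lemma second_order_remainder:
  fixes \<phi> \<phi>' \<phi>'' :: "real \<Rightarrow> real"
  assumes "\<And>x. (\<phi> has_real_derivative \<phi>' x) (at x)" "\<And>x. (\<phi>' has_real_derivative \<phi>'' x) (at x)" "\<And>x. \<bar>\<phi>'' x\<bar> \<le> 1"
  shows "\<bar>\<phi> b - \<phi> a - \<phi>' a * (b - a)\<bar> \<le> (b - a)\<^sup>2" "\<bar>\<phi>' b - \<phi>' a\<bar> \<le> \<bar>b - a\<bar>"
proof -
  have l: "\<bar>\<phi>' b - \<phi>' a\<bar> \<le> \<bar>b - a\<bar>" for a b
    using field_differentiable_bound[of UNIV \<phi>' \<phi>'' 1 b a] assms(2,3) by auto
  then show "\<bar>\<phi>' b - \<phi>' a\<bar> \<le> \<bar>b - a\<bar>" .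
  have "norm ((\<phi> b - \<phi>' a * b) - (\<phi> a - \<phi>' a * a)) \<le> \<bar>b - a\<bar> * norm (b - a)"
  proof (rule field_differentiable_bound[of "closed_segment a b" "\<lambda>x. \<phi> x - \<phi>' a * x" "\<lambda>x. \<phi>' x - \<phi>' a"])
    fix z assume "z \<in> closed_segment a b"
    then have "\<bar>z - a\<bar> \<le> \<bar>b - a\<bar>" using segment_bound1[of z a b] by (simp add: abs_minus_commute)
    then show "norm (\<phi>' z - \<phi>' a) \<le> \<bar>b - a\<bar>" using l[of z a] by simp
    show "((\<lambda>x. \<phi> x - \<phi>' a * x) has_real_derivative \<phi>' z - \<phi>' a) (at z within closed_segment a b)"
      by (auto intro!: derivative_eq_intros DERIV_subset[OF assms(1)])
  qed auto
  then show "\<bar>\<phi> b - \<phi> a - \<phi>' a * (b - a)\<bar> \<le> (b - a)\<^sup>2" by (simp add: algebra_simps power2_eq_square)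
qed

lemma AC_on_sin: "AC_on c d F f \<Longrightarrow> AC_on c d (\<lambda>x. sin (F x)) (\<lambda>x. cos (F x) * f x)"
  using second_order_remainder[of sin cos "\<lambda>x. - sin x"]
  by (intro AC_on_compose) (auto intro!: derivative_eq_intros continuous_intros)

lemma AC_on_cos: "AC_on c d F f \<Longrightarrow> AC_on c d (\<lambda>x. cos (F x)) (\<lambda>x. - sin (F x) * f x)"
proof -
  have d: "((\<lambda>x. - sin x) has_real_derivative - cos x) (at x)" for x :: real
    by (auto intro!: derivative_eq_intros)
  show "AC_on c d F f \<Longrightarrow> ?thesis"
    using second_order_remainder[of cos "\<lambda>x. - sin x" "\<lambda>x. - cos x", OF DERIV_cos d]
    by (intro AC_on_compose[where \<phi>'="\<lambda>x. - sin x"]) (auto intro!: continuous_intros)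
qed

section \<open>Smooth test functions\<close>

text \<open>Smoothness in one variable, where the closure under products and compositions is an easy induction;
  smooth functions in the plane are obtained as products of these.\<close>

primrec Ck :: "nat \<Rightarrow> (real \<Rightarrow> real) \<Rightarrow> bool" where
  "Ck 0 f \<longleftrightarrow> continuous_on UNIV f"
| "Ck (Suc k) f \<longleftrightarrow> (\<exists>f'. (\<forall>x. (f has_real_derivative f' x) (at x)) \<and> Ck k f')"

definition smooth1 :: "(real \<Rightarrow> real) \<Rightarrow> bool" where "smooth1 f \<longleftrightarrow> (\<forall>k. Ck k f)"

lemma Ck_SucD: "Ck (Suc k) f \<Longrightarrow> Ck k f"
proof (induction k arbitrary: f)
  case 0
  then obtain f' where f': "\<forall>x. (f has_real_derivative f' x) (at x)" using Ck.simps(2)[of 0 f] by blast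
  then show ?case using DERIV_isCont continuous_at_imp_continuous_on by (simp, blast)
next
  case (Suc k)
  then obtain f' where f': "\<forall>x. (f has_real_derivative f' x) (at x)" "Ck (Suc k) f'"
    using Ck.simps(2)[of "Suc k" f] by blast
  from Suc.IH[OF f'(2)] f'(1) show ?case using Ck.simps(2)[of k f] by blast
qed

lemma Ck_const: "Ck k (\<lambda>x. c)"
  by (induction k arbitrary: c) (auto intro!: exI[of _ "\<lambda>x. 0"])

lemma Ck_linear: "Ck k (\<lambda>x. a * x + b)"
  by (cases k) (auto intro!: exI[of _ "\<lambda>x. a"] continuous_intros derivative_eq_intros Ck_const)

lemma Ck_add: "Ck k f \<Longrightarrow> Ck k g \<Longrightarrow> Ck k (\<lambda>x. f x + g x)"
proof (induction k arbitrary: f g)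
  case 0 then show ?case by (auto intro: continuous_on_add)
next
  case (Suc k)
  then obtain f' g' where "\<forall>x. (f has_real_derivative f' x) (at x)" "Ck k f'"
    "\<forall>x. (g has_real_derivative g' x) (at x)" "Ck k g'" by auto
  with Suc.IH[of f' g'] show ?case by (auto intro!: exI[of _ "\<lambda>x. f' x + g' x"] derivative_eq_intros)
qed

lemma Ck_mult: "Ck k f \<Longrightarrow> Ck k g \<Longrightarrow> Ck k (\<lambda>x. f x * g x)"
proof (induction k arbitrary: f g)
  case 0 then show ?case by (auto intro: continuous_on_mult)
next
  case (Suc k)
  then obtain f' g' where *: "\<forall>x. (f has_real_derivative f' x) (at x)" "Ck k f'"
    "\<forall>x. (g has_real_derivative g' x) (at x)" "Ck k g'" by auto
  have "Ck k (\<lambda>x. f' x * g x + f x * g' x)"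
    by (rule Ck_add[OF Suc.IH[OF *(2) Ck_SucD[OF Suc.prems(2)]] Suc.IH[OF Ck_SucD[OF Suc.prems(1)] *(4)]])
  moreover have "((\<lambda>x. f x * g x) has_real_derivative f' x * g x + f x * g' x) (at x)" for x
    using * by (auto intro!: derivative_eq_intros)
  ultimately show ?case unfolding Ck.simps by (intro exI[of _ "\<lambda>x. f' x * g x + f x * g' x"] conjI allI)
qed

lemma Ck_compose: "Ck k f \<Longrightarrow> Ck k g \<Longrightarrow> Ck k (\<lambda>x. f (g x))"
proof (induction k arbitrary: f g)
  case 0 then show ?case by (auto intro: continuous_on_compose2)
next
  case (Suc k)
  then obtain f' g' where *: "\<forall>x. (f has_real_derivative f' x) (at x)" "Ck k f'"
    "\<forall>x. (g has_real_derivative g' x) (at x)" "Ck k g'" by auto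
  have "Ck k (\<lambda>x. f' (g x) * g' x)"
    by (rule Ck_mult[OF Suc.IH[OF *(2) Ck_SucD[OF Suc.prems(2)]] *(4)])
  moreover have "((\<lambda>x. f (g x)) has_real_derivative f' (g x) * g' x) (at x)" for x
    using * by (intro DERIV_chain2[of f]) auto
  ultimately show ?case unfolding Ck.simps by (intro exI[of _ "\<lambda>x. f' (g x) * g' x"] conjI allI)
qed

lemma Ck_sin_cos: "Ck k (\<lambda>x. a * sin x + b * cos x)"
proof (induction k arbitrary: a b)
  case 0 then show ?case by (auto intro!: continuous_intros)
next
  case (Suc k)
  have "((\<lambda>x. a * sin x + b * cos x) has_real_derivative (- b) * sin x + a * cos x) (at x)" for x
    by (auto intro!: derivative_eq_intros)
  with Suc[of "-b" a] show ?case unfolding Ck.simps by (intro exI[of _ "\<lambda>x. (- b) * sin x + a * cos x"] conjI allI)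
qed

lemma Ck_cos: "Ck k cos" using Ck_sin_cos[of k 0 1] by simp

text \<open>The family \<open>p(1/x) exp(-1/x)\<close>, extended by zero to the left of the origin. With the polynomial
  \<open>p\<close> as a parameter it is closed under differentiation.\<close>

definition flat :: "real poly \<Rightarrow> real \<Rightarrow> real" where
  "flat p x = (if x > 0 then poly p (1/x) * exp (- 1/x) else 0)"

lemma poly_div_exp_tendsto_0: "((\<lambda>y. poly p y / exp y) \<longlongrightarrow> (0::real)) at_top"
proof -
  have "((\<lambda>y. \<Sum>i\<le>degree p. coeff p i * (y ^ i / exp y)) \<longlongrightarrow> (\<Sum>i\<le>degree p. coeff p i * 0)) at_top"
    by (intro tendsto_intros tendsto_power_div_exp_0)
  then show ?thesis by (simp add: poly_altdef sum_divide_distrib)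
qed

lemma flat_deriv: "(flat p has_real_derivative flat ([:0, 0, 1:] * (p - pderiv p)) x) (at x)"
proof -
  consider "x < 0" | "x > 0" | "x = 0" by linarith
  then show ?thesis
  proof cases
    case 1
    have "((\<lambda>x. 0) has_real_derivative 0) (at x)" by simp
    then show ?thesis
      by (rule has_field_derivative_transform_within_open[where S="{..<0}", THEN DERIV_cong]) (use 1 in \<open>auto simp: flat_def\<close>)
  next
    case 2
    have "((\<lambda>x. poly p (1/x) * exp (-1/x)) has_real_derivative flat ([:0, 0, 1:] * (p - pderiv p)) x) (at x)"
      using 2 by (auto intro!: derivative_eq_intros poly_DERIV[THEN DERIV_chain2] simp: flat_def field_simps power2_eq_square)
    then show ?thesis
      by (rule has_field_derivative_transform_within_open[where S="{0<..}"]) (use 2 in \<open>auto simp: flat_def\<close>)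
  next
    case 3
    have "((\<lambda>y. poly ([:0,1:] * p) y / exp y) \<longlongrightarrow> 0) at_top" by (rule poly_div_exp_tendsto_0)
    then have "((\<lambda>h. poly ([:0,1:] * p) (inverse h) / exp (inverse h)) \<longlongrightarrow> 0) (at_right 0)"
      by (rule filterlim_compose) (rule filterlim_inverse_at_top_right)
    then have "((\<lambda>h. flat p h / h) \<longlongrightarrow> 0) (at_right 0)"
      by (rule Lim_transform_eventually)
         (auto simp: eventually_at_right_field flat_def field_simps exp_minus intro!: exI[of _ 1])
    moreover have "((\<lambda>h. flat p h / h) \<longlongrightarrow> 0) (at_left 0)"
      by (rule Lim_transform_eventually[where f="\<lambda>x. 0"])
         (auto simp: eventually_at_left_field flat_def intro!: exI[of _ "-1"])
    ultimately have "((\<lambda>h. flat p h / h) \<longlongrightarrow> 0) (at 0)" by (rule filterlim_split_at[rotated])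
    with 3 show ?thesis by (simp add: has_field_derivative_iff flat_def)
  qed
qed

lemma Ck_flat: "Ck k (flat p)"
proof (induction k arbitrary: p)
  case 0
  then show ?case using DERIV_isCont[OF flat_deriv] by (simp add: continuous_at_imp_continuous_on)
next
  case (Suc k)
  show ?case using flat_deriv[of p] Suc unfolding Ck.simps by blast
qed

text \<open>A smooth function that is positive exactly to the right of the origin and tends to one at infinity,
  so that \<open>psi (n * y)\<close> approximates the indicator of \<open>y > 0\<close>.\<close>

definition psi :: "real \<Rightarrow> real" where "psi = flat 1"

lemma Ck_psi: "Ck k psi" by (simp add: psi_def Ck_flat)

lemma psi: "psi x \<ge> 0" "psi x \<le> 1" "x \<le> 0 \<Longrightarrow> psi x = 0" "psi x \<noteq> 0 \<Longrightarrow> x > 0"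
  by (auto simp: psi_def flat_def split: if_splits)

lemma psi_tendsto:
  assumes "filterlim f at_top F" shows "((\<lambda>n. psi (f n)) \<longlongrightarrow> 1) F"
proof -
  have "((\<lambda>n. exp (- 1 / f n)) \<longlongrightarrow> exp 0) F"
    by (intro tendsto_intros tendsto_divide_0[OF tendsto_const] filterlim_at_top_imp_at_infinity assms)
  then have "((\<lambda>n. exp (- 1 / f n)) \<longlongrightarrow> 1) F" by simp
  then show ?thesis
    by (rule Lim_transform_eventually)
       (use filterlim_at_top_dense[THEN iffD1, OF assms, rule_format, of 0] in \<open>auto simp: psi_def flat_def elim: eventually_mono\<close>)
qed

text \<open>The property of a class of test functions that is needed to test against all intervals: indicators
  of open subintervals are bounded pointwise limits.\<close>

definition approximating :: "(real \<Rightarrow> real) set \<Rightarrow> real \<Rightarrow> real \<Rightarrow> bool" where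
  "approximating T c d \<longleftrightarrow> (\<forall>p q. c \<le> p \<and> p < q \<and> q \<le> d \<longrightarrow>
     (\<exists>\<alpha>. (\<forall>n. \<alpha> n \<in> T) \<and> (\<forall>n x. \<bar>\<alpha> n x\<bar> \<le> 1) \<and>
        (\<forall>x\<in>{c..d}. (\<lambda>n::nat. \<alpha> n x) \<longlonglongrightarrow> indicator {p<..<q} x)))"

definition per_fun :: "real \<Rightarrow> real \<Rightarrow> (real \<Rightarrow> real) set" where
  "per_fun c d = {\<alpha>. smooth1 \<alpha> \<and> (\<forall>x. \<alpha> (x + (d - c)) = \<alpha> x)}"

definition cpt_fun :: "real \<Rightarrow> real \<Rightarrow> (real \<Rightarrow> real) set" where
  "cpt_fun c d = {\<alpha>. smooth1 \<alpha> \<and> (\<exists>p q. c < p \<and> q < d \<and> (\<forall>x. \<alpha> x \<noteq> 0 \<longrightarrow> x \<in> {p..q}))}"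

text \<open>The two factors switch on and off at distance \<open>\<delta> n\<close> inside the interval, which keeps the support
  compact; as \<open>n * \<delta> n\<close> stays bounded, the shift does not disturb the limit.\<close>

lemma approximating_cpt_fun: "approximating (cpt_fun c d) c d"
  unfolding approximating_def
proof (intro allI impI, elim conjE)
  fix p q assume pq: "c \<le> p" "p < q" "q \<le> d"
  define \<delta> where "\<delta> n = (q - p) / (real n + 3)" for n
  have \<delta>: "\<delta> n > 0" for n using pq by (auto simp: \<delta>_def)
  define \<alpha> where "\<alpha> n x = psi (real n * (x - (p + \<delta> n))) * psi (real n * ((q - \<delta> n) - x))" for n x
  have nd: "real n * \<delta> n \<le> q - p" for n
    using pq by (auto simp: \<delta>_def field_simps)
  have supp: "\<alpha> n x \<noteq> 0 \<Longrightarrow> x \<in> {p + \<delta> n .. q - \<delta> n}" for n x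
    unfolding \<alpha>_def using psi(4)[of "real n * (x - (p + \<delta> n))"] psi(4)[of "real n * ((q - \<delta> n) - x)"]
    by (auto simp: zero_less_mult_iff)
  show "\<exists>\<alpha>. (\<forall>n. \<alpha> n \<in> cpt_fun c d) \<and> (\<forall>n x. \<bar>\<alpha> n x\<bar> \<le> 1) \<and>
        (\<forall>x\<in>{c..d}. (\<lambda>n::nat. \<alpha> n x) \<longlonglongrightarrow> indicator {p<..<q} x)"
  proof (intro exI[of _ \<alpha>] conjI allI ballI)
    fix n
    have "Ck k (\<alpha> n)" for k
    proof -
      have "Ck k (\<lambda>x. psi (real n * x + (- real n * (p + \<delta> n))) * psi ((- real n) * x + (real n * (q - \<delta> n))))"
        by (rule Ck_mult[OF Ck_compose[OF Ck_psi Ck_linear] Ck_compose[OF Ck_psi Ck_linear]])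
      then show ?thesis unfolding \<alpha>_def by (simp add: algebra_simps)
    qed
    then show "\<alpha> n \<in> cpt_fun c d"
      using supp[of n] pq \<delta>[of n] unfolding cpt_fun_def smooth1_def
      by (intro CollectI conjI exI[of _ "p + \<delta> n"] exI[of _ "q - \<delta> n"]) auto
  next
    fix n x show "\<bar>\<alpha> n x\<bar> \<le> 1" unfolding \<alpha>_def by (auto simp: abs_mult psi intro!: mult_le_one)
  next
    fix x assume "x \<in> {c..d}"
    show "(\<lambda>n. \<alpha> n x) \<longlonglongrightarrow> indicator {p<..<q} x"
    proof (cases "x \<in> {p<..<q}")
      case True
      have lin: "filterlim (\<lambda>n. - (q - p) + s * real n) at_top sequentially" if "s > 0" for s
        by (rule filterlim_tendsto_add_at_top[OF tendsto_const filterlim_tendsto_pos_mult_at_top[OF tendsto_const that filterlim_real_sequentially]])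
      have "filterlim (\<lambda>n. real n * (x - (p + \<delta> n))) at_top sequentially"
        by (rule filterlim_at_top_mono[OF lin[of "x - p"]]) (use True nd in \<open>auto simp: algebra_simps\<close>)
      moreover have "filterlim (\<lambda>n. real n * ((q - \<delta> n) - x)) at_top sequentially"
        by (rule filterlim_at_top_mono[OF lin[of "q - x"]]) (use True nd in \<open>auto simp: algebra_simps\<close>)
      ultimately have "(\<lambda>n. \<alpha> n x) \<longlonglongrightarrow> 1 * 1" unfolding \<alpha>_def by (intro tendsto_mult psi_tendsto)
      then show ?thesis using True by simp
    next
      case False
      then have "\<alpha> n x = 0" for n using supp[of n x] \<delta>[of n] by (cases "\<alpha> n x = 0") auto
      then show ?thesis using False by simp
    qed
  qed
qed

text \<open>The interval is described by the periodic condition \<open>cos (\<omega> * (x - x0)) > cos r\<close>, where \<open>x0\<close> is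
  its centre and \<open>r\<close> half of its length in the rescaled variable.\<close>

lemma approximating_per_fun: 
  assumes "c < d" shows "approximating (per_fun c d) c d"
  unfolding approximating_def
proof (intro allI impI, elim conjE)
  fix p q assume pq: "c \<le> p" "p < q" "q \<le> d"
  define \<omega> where "\<omega> = 2 * pi / (d - c)"
  define x0 where "x0 = (p + q) / 2"
  define r where "r = \<omega> * ((q - p) / 2)"
  have \<omega>: "\<omega> > 0" "\<omega> * (d - c) = 2 * pi" using assms by (auto simp: \<omega>_def)
  have r: "0 < r" "r \<le> pi"
    using \<omega> pq mult_left_mono[of "q - p" "d - c" \<omega>] by (auto simp: r_def)
  define Y where "Y x = cos (\<omega> * (x - x0)) - cos r" for x
  define \<alpha> where "\<alpha> n x = psi (real n * Y x)" for n x
  have Ypos: "Y x > 0 \<longleftrightarrow> x \<in> {p<..<q}" if "x \<in> {c..d}" for x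
  proof -
    define y where "y = \<bar>\<omega> * (x - x0)\<bar>"
    have cy: "cos (\<omega> * (x - x0)) = cos y" by (simp add: y_def)
    have "y < r \<longleftrightarrow> \<bar>x - x0\<bar> < (q - p) / 2" using \<omega>(1) by (simp add: y_def r_def abs_mult)
    also have "\<dots> \<longleftrightarrow> x \<in> {p<..<q}" unfolding x0_def by (auto simp: abs_less_iff field_simps)
    finally have yr: "y < r \<longleftrightarrow> x \<in> {p<..<q}" .
    \<comment> \<open>The angle \<open>y\<close> cannot come so close to \<open>2 * pi\<close> that the cosine exceeds \<open>cos r\<close> again.\<close>
    have "\<bar>x - x0\<bar> \<le> (d - c) - (q - p)/2" using that pq by (auto simp: x0_def field_simps abs_le_iff)
    from mult_left_mono[OF this, of \<omega>] have "\<omega> * \<bar>x - x0\<bar> \<le> \<omega> * ((d - c) - (q - p)/2)" using \<omega> by simp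
    moreover have "y = \<omega> * \<bar>x - x0\<bar>" using \<omega> by (simp add: y_def abs_mult)
    moreover have "\<omega> * ((d - c) - (q - p)/2) = 2 * pi - r" using \<omega>(2) unfolding r_def right_diff_distrib[of \<omega> "d - c"] by simp
    ultimately have y2: "y \<le> 2 * pi - r" by simp
    show ?thesis
    proof (cases "y \<le> pi")
      case True
      then have "cos r < cos y \<longleftrightarrow> y < r" using r by (intro cos_mono_less_eq) (auto simp: y_def)
      then show ?thesis using yr by (simp add: Y_def cy)
    next
      case False
      have "cos (2 * pi - y) \<le> cos r" by (rule cos_monotone_0_pi_le) (use False y2 r in auto)
      then have "cos y \<le> cos r" by (simp add: cos_diff)
      then show ?thesis using yr False r by (simp add: Y_def cy)
    qed
  qed
  show "\<exists>\<alpha>. (\<forall>n. \<alpha> n \<in> per_fun c d) \<and> (\<forall>n x. \<bar>\<alpha> n x\<bar> \<le> 1) \<and>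
        (\<forall>x\<in>{c..d}. (\<lambda>n::nat. \<alpha> n x) \<longlonglongrightarrow> indicator {p<..<q} x)"
  proof (intro exI[of _ \<alpha>] conjI allI ballI)
    fix n
    have "Ck k (\<alpha> n)" for k
    proof -
      have "Ck k (\<lambda>x. psi (real n * cos (\<omega> * x + (- \<omega> * x0)) + (- real n * cos r)))"
        by (rule Ck_compose[OF Ck_psi Ck_add[OF Ck_mult[OF Ck_const Ck_compose[OF Ck_cos Ck_linear]] Ck_const]])
      then show ?thesis unfolding \<alpha>_def Y_def by (simp add: algebra_simps)
    qed
    moreover have "Y (x + (d - c)) = Y x" for x
    proof -
      have "\<omega> * (x + (d - c) - x0) = \<omega> * (x - x0) + 2 * pi" using \<omega>(2) by (simp add: algebra_simps)
      then show ?thesis unfolding Y_def by (metis cos_periodic)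
    qed
    ultimately show "\<alpha> n \<in> per_fun c d" unfolding per_fun_def smooth1_def by (simp add: \<alpha>_def)
  next
    fix n x show "\<bar>\<alpha> n x\<bar> \<le> 1" unfolding \<alpha>_def by (auto simp: psi)
  next
    fix x assume x: "x \<in> {c..d}"
    show "(\<lambda>n. \<alpha> n x) \<longlonglongrightarrow> indicator {p<..<q} x"
    proof (cases "x \<in> {p<..<q}")
      case True
      then have "filterlim (\<lambda>n. Y x * real n) at_top sequentially"
        using Ypos[OF x] by (intro filterlim_tendsto_pos_mult_at_top[OF tendsto_const _ filterlim_real_sequentially]) auto
      from psi_tendsto[OF this] show ?thesis unfolding \<alpha>_def using True by (simp add: mult.commute)
    next
      case False
      then have "\<alpha> n x = 0" for n using Ypos[OF x] psi(3)[of "real n * Y x"] by (auto simp: \<alpha>_def mult_nonneg_nonpos)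
      then show ?thesis using False by simp
    qed
  qed
qed

lemma has_derivative_tensor:
  assumes "(\<alpha> has_real_derivative \<alpha>') (at (fst x))" "(\<beta> has_real_derivative \<beta>') (at (snd x))"
  shows "((\<lambda>x. \<alpha> (fst x) * \<beta> (snd x)) has_derivative
           (\<lambda>v. \<alpha>' * \<beta> (snd x) * fst v + \<alpha> (fst x) * \<beta>' * snd v)) (at x)"
proof -
  have 1: "((\<lambda>x. \<alpha> (fst x)) has_derivative (\<lambda>v. \<alpha>' * fst v)) (at x)"
    using has_derivative_compose[OF has_derivative_fst[OF has_derivative_ident] assms(1)[THEN has_field_derivative_imp_has_derivative]] by simp
  have 2: "((\<lambda>x. \<beta> (snd x)) has_derivative (\<lambda>v. \<beta>' * snd v)) (at x)"
    using has_derivative_compose[OF has_derivative_snd[OF has_derivative_ident] assms(2)[THEN has_field_derivative_imp_has_derivative]] by simp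
  from has_derivative_mult[OF 1 2] show ?thesis by (simp add: algebra_simps)
qed

lemmas frechet_tensor = frechet_derivative_at[OF has_derivative_tensor, symmetric]

lemma C_diff_tensor: "Ck k \<alpha> \<Longrightarrow> Ck k \<beta> \<Longrightarrow> C_diff k (\<lambda>x. \<alpha> (fst x) * \<beta> (snd x) :: real)"
proof (induction k arbitrary: \<alpha> \<beta>)
  case 0
  then show ?case by (auto intro!: continuous_intros continuous_on_compose2[of UNIV \<alpha>] continuous_on_compose2[of UNIV \<beta>])
next
  case (Suc k)
  then obtain \<alpha>' \<beta>' where *: "\<And>x. (\<alpha> has_real_derivative \<alpha>' x) (at x)" "Ck k \<alpha>'"
    "\<And>x. (\<beta> has_real_derivative \<beta>' x) (at x)" "Ck k \<beta>'" by auto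
  note f = frechet_tensor[OF *(1,3)]
  have "(\<lambda>x. \<alpha> (fst x) * \<beta> (snd x)) differentiable at x" for x
    using has_derivative_tensor[OF *(1,3)] differentiableI by blast
  moreover have "C_diff k (\<lambda>x. \<alpha>' (fst x) * \<beta> (snd x))" "C_diff k (\<lambda>x. \<alpha> (fst x) * \<beta>' (snd x))"
    using Suc * by (auto intro!: Suc.IH Ck_SucD[of k \<alpha>] Ck_SucD[of k \<beta>] simp del: Ck.simps)
  ultimately show ?case by (auto simp: Basis_prod_def f)
qed

lemma smooth_tensor: "smooth1 \<alpha> \<Longrightarrow> smooth1 \<beta> \<Longrightarrow> smooth (\<lambda>x. \<alpha> (fst x) * \<beta> (snd x))"
  by (simp add: smooth_def smooth1_def C_diff_tensor)

lemma tensor_per_test_fun: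
  assumes "\<alpha> \<in> per_fun 0 (2*pi)" "\<beta> \<in> per_fun (-1/2) (1/2)"
  shows "(\<lambda>x. \<alpha> (fst x) * \<beta> (snd x)) \<in> per_test_fun"
  using assms by (auto simp: per_test_fun_def per_fun_def smooth_tensor)

lemma tensor_test_fun:
  assumes "\<alpha> \<in> cpt_fun 0 (2*pi)" "\<beta> \<in> cpt_fun (-1/2) (1/2)"
  shows "(\<lambda>x. \<alpha> (fst x) * \<beta> (snd x)) \<in> test_fun"
proof -
  obtain p q where pq1: "0 < p" "q < 2*pi" "\<And>x. \<alpha> x \<noteq> 0 \<Longrightarrow> x \<in> {p..q}"
    using assms(1) unfolding cpt_fun_def by blast
  obtain p' q' where pq2: "-1/2 < p'" "q' < 1/2" "\<And>x. \<beta> x \<noteq> 0 \<Longrightarrow> x \<in> {p'..q'}"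
    using assms(2) unfolding cpt_fun_def by blast
  define K where "K = {p..q} \<times> {p'..q'}"
  have K: "compact K" by (auto simp: K_def intro!: compact_Times)
  have s: "closure {x. \<alpha> (fst x) * \<beta> (snd x) \<noteq> 0} \<subseteq> K"
    by (rule closure_minimal) (use pq1(3) pq2(3) K in \<open>fastforce simp: K_def compact_imp_closed mem_Times_iff\<close>)+
  have "K \<subseteq> interior Omega"
    unfolding Omega_def K_def interior_Times interior_atLeastAtMost_real
    by (rule Sigma_mono) (use pq1(1,2) pq2(1,2) in auto)
  moreover have "compact (closure {x. \<alpha> (fst x) * \<beta> (snd x) \<noteq> 0})"
    using bounded_subset[OF compact_imp_bounded[OF K] s] by (simp add: compact_eq_bounded_closed)
  moreover have "smooth (\<lambda>x. \<alpha> (fst x) * \<beta> (snd x))"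
    using assms by (intro smooth_tensor) (auto simp: cpt_fun_def)
  ultimately show ?thesis using s unfolding test_fun_def by blast
qed

section \<open>The domain as a product of intervals\<close>

text \<open>Lebesgue measure on an interval, but with the Borel sets as measurable sets; the product \<open>Q\<close> below is
  then a genuine product measure, to which Fubini's theorem applies. It has the same null sets and
  the same integrals of Borel functions as \<^term>\<open>leb_Omega\<close>.\<close>

definition seg :: "real \<Rightarrow> real \<Rightarrow> real measure" where
  "seg a b = density lborel (\<lambda>x. ennreal (indicator {a..b} x))"

definition Q :: "(real \<times> real) measure" where
  "Q = seg 0 (2 * pi) \<Otimes>\<^sub>M seg (-1/2) (1/2)"

lemma sets_seg[simp, measurable_cong]: "sets (seg a b) = sets borel" by (simp add: seg_def)
lemma space_seg[simp]: "space (seg a b) = UNIV" by (simp add: seg_def)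

lemma emeasure_seg: "a \<le> b \<Longrightarrow> emeasure (seg a b) UNIV = ennreal (b - a)"
  by (simp add: seg_def emeasure_density ennreal_indicator)

lemma measure_seg: "a \<le> b \<Longrightarrow> measure (seg a b) UNIV = b - a"
  by (simp add: measure_def emeasure_seg)

lemma finite_measure_seg: "finite_measure (seg a b)"
proof
  show "emeasure (seg a b) (space (seg a b)) \<noteq> \<infinity>"
    by (simp add: seg_def emeasure_density ennreal_indicator emeasure_lborel_Icc_eq)
qed

lemma AE_seg: "(AE x in seg a b. P x) \<longleftrightarrow> (AE x in lborel. x \<in> {a..b} \<longrightarrow> P x)"
  unfolding seg_def by (subst AE_density) (auto simp: indicator_def intro!: AE_cong)

lemma AE_seg_in: "AE x in seg a b. x \<in> {a..b}" by (simp add: AE_seg)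
lemma AE_seg_in_open: "AE x in seg a b. x \<in> {a<..<b}"
proof -
  have "AE x in lborel. x \<noteq> a" "AE x in lborel. x \<noteq> b" by (rule AE_lborel_singleton)+
  then show ?thesis unfolding AE_seg by eventually_elim auto
qed

lemma integrable_seg:
  fixes f :: "real \<Rightarrow> real" assumes [measurable]: "f \<in> borel_measurable borel"
  shows "integrable (seg a b) f \<longleftrightarrow> f absolutely_integrable_on {a..b}"
  unfolding seg_def set_integrable_def by (subst integrable_density) (auto simp: integrable_completion)

lemma integral_seg:
  fixes f :: "real \<Rightarrow> real" assumes [measurable]: "f \<in> borel_measurable borel" and i: "integrable (seg a b) f"
  shows "integral\<^sup>L (seg a b) f = integral {a..b} f"
proof -
  have "integral\<^sup>L (seg a b) f = (LINT x:{a..b}|lebesgue. f x)"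
    unfolding seg_def set_lebesgue_integral_def by (subst integral_density) (auto simp: integral_completion)
  also have "\<dots> = integral {a..b} f"
    using i integrable_seg[of f] by (intro set_lebesgue_integral_eq_integral(2)) auto
  finally show ?thesis .
qed

lemma pair_sf_seg: "pair_sigma_finite (seg a b) (seg c d)"
  by (intro pair_sigma_finite.intro finite_measure.axioms finite_measure_seg)

lemma finite_measure_Q: "finite_measure Q"
  unfolding Q_def by (intro finite_measure_pair_measure finite_measure_seg)

interpretation Qf: finite_measure Q by (rule finite_measure_Q)
interpretation QP: pair_sigma_finite "seg 0 (2 * pi)" "seg (-1/2) (1/2)" by (rule pair_sf_seg)

lemma sets_Q[simp, measurable_cong]: "sets Q = sets borel"
  unfolding Q_def borel_prod[symmetric] by (rule sets_pair_measure_cong) simp_all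
lemma space_Q[simp]: "space Q = UNIV" by (simp add: Q_def space_pair_measure)

lemma fst_snd_measurable[measurable]: "fst \<in> borel_measurable (borel :: (real \<times> real) measure)"
    "snd \<in> borel_measurable (borel :: (real \<times> real) measure)"
  by (simp_all add: borel_prod[symmetric])

lemma Omega_borel[measurable]: "Omega \<in> sets borel" by (simp add: Omega_def borel_Times)

lemma Q_density: "Q = density lborel (\<lambda>x. ennreal (indicator Omega x))"
proof -
  have "Q = density (lborel \<Otimes>\<^sub>M lborel) (\<lambda>(x,y). ennreal (indicator {0..2 * pi} x) * ennreal (indicator {-1/2..1/2} y))"
    unfolding Q_def seg_def
    by (rule pair_measure_density)
       (use finite_measure_seg[of "-1/2" "1/2", unfolded seg_def] in \<open>auto intro: finite_measure.axioms lborel.sigma_finite_measure_axioms\<close>)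
  also have "\<dots> = density lborel (\<lambda>x. ennreal (indicator Omega x))"
    unfolding lborel_prod by (rule arg_cong[of _ _ "density lborel"]) (auto simp: Omega_def indicator_def fun_eq_iff)
  finally show ?thesis .
qed

lemma AE_Q_leb: "(AE x in leb_Omega. P x) \<longleftrightarrow> (AE x in Q. P x)"
  unfolding Q_density
  by (subst AE_density) (auto simp: AE_restrict_space_iff AE_completion_iff indicator_def intro!: AE_cong)

lemma AE_Q_Omega: "AE x in Q. x \<in> Omega"
  unfolding Q_density by (subst AE_density) (auto simp: indicator_def)

lemma meas_leb[measurable (raw)]: "f \<in> borel_measurable borel \<Longrightarrow> f \<in> borel_measurable leb_Omega"
  by (intro measurable_restrict_space1 measurable_completion) simp

lemma integrable_Q_leb:
  fixes f :: "_ \<Rightarrow> 'a::{banach, second_countable_topology}" assumes [measurable]: "f \<in> borel_measurable borel"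
  shows "integrable leb_Omega f \<longleftrightarrow> integrable Q f"
  unfolding Q_density
  by (subst integrable_density) (auto simp: integrable_restrict_space integrable_completion)

lemma integral_Q_leb:
  fixes f :: "_ \<Rightarrow> 'a::{banach, second_countable_topology}" assumes [measurable]: "f \<in> borel_measurable borel"
  shows "integral\<^sup>L leb_Omega f = integral\<^sup>L Q f"
  unfolding Q_density
  by (subst integral_density) (auto simp: integral_restrict_space integral_completion)

lemma nn_integral_Q_leb:
  assumes [measurable]: "f \<in> borel_measurable borel"
  shows "integral\<^sup>N leb_Omega f = integral\<^sup>N Q f"
proof -
  have "integral\<^sup>N leb_Omega f = integral\<^sup>N lborel (\<lambda>x. f x * indicator Omega x)"
    by (simp add: nn_integral_restrict_space nn_integral_completion)
  also have "\<dots> = integral\<^sup>N Q f"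
    unfolding Q_density by (subst nn_integral_density) (auto simp: ennreal_indicator mult.commute)
  finally show ?thesis .
qed

lemma measure_Q: "measure Q UNIV = 2 * pi"
proof -
  have "emeasure Q (UNIV \<times> UNIV) = ennreal (2 * pi) * ennreal 1"
    unfolding Q_def by (subst QP.M2.emeasure_pair_measure_Times) (use emeasure_seg[of 0 "2*pi"] emeasure_seg[of "-1/2" "1/2"] in auto)
  then show ?thesis by (simp add: measure_def)
qed

lemma measure_Omega: "measure lebesgue Omega = 2 * pi"
proof -
  have "emeasure lebesgue Omega = emeasure Q UNIV"
    by (simp add: Q_density emeasure_density ennreal_indicator)
  then show ?thesis using measure_Q by (simp add: measure_def)
qed

lemma bulk_one: "bulk_energy_NL 1 h = 2 * pi * h\<^sup>2"
  by (simp add: bulk_energy_NL_def measure_Omega)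

text \<open>Every function that is measurable for the completed measure is replaced by a Borel representative, so
  that all later arguments take place on \<^term>\<open>Q\<close>.\<close>

lemma leb_borel_rep:
  fixes f :: "real \<times> real \<Rightarrow> real" assumes "f \<in> borel_measurable leb_Omega"
  shows "\<exists>f'\<in>borel_measurable borel. AE x in leb_Omega. f x = f' x"
proof -
  have "(\<lambda>x. indicator Omega x *\<^sub>R f x) \<in> borel_measurable lebesgue"
    using assms by (subst (asm) borel_measurable_restrict_space_iff) auto
  from completion_ex_borel_measurable_real[OF this[simplified]]
  obtain f' where f': "f' \<in> borel_measurable borel" "AE x in lborel. indicator Omega x * f x = f' x" by auto
  have "AE x in leb_Omega. f x = f' x"
    unfolding AE_Q_leb Q_density using f'(2)
    by (subst AE_density) (auto simp: indicator_def split: if_splits elim: eventually_mono)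
  with f'(1) show ?thesis by blast
qed

text \<open>Both coordinate directions are treated at once. For the direction \<open>i\<close>, a line in direction \<open>i\<close> is
  parametrised by \<open>t\<close> between \<open>lo i\<close> and \<open>hi i\<close>, the lines are indexed by \<open>s\<close> between \<open>across_lo i\<close>
  and \<open>across_hi i\<close>, and \<open>pt i s t\<close> is the point with these two coordinates. Anything that is not
  \<^term>\<open>e_z\<close> counts as the angular direction.\<close>

definition "lo i = (if i = e_z then -1/2 else (0::real))"
definition "hi i = (if i = e_z then 1/2 else (2 * pi::real))"
definition "across_lo i = (if i = e_z then (0::real) else -1/2)"
definition "across_hi i = (if i = e_z then 2 * pi else (1/2::real))"
definition "line i = seg (lo i) (hi i)"
definition "across i = seg (across_lo i) (across_hi i)"
definition pt :: "real \<times> real \<Rightarrow> real \<Rightarrow> real \<Rightarrow> real \<times> real" where "pt i s t = (if i = e_z then (s, t) else (t, s))"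
definition across_coord :: "real \<times> real \<Rightarrow> real \<times> real \<Rightarrow> real" where "across_coord i x = (if i = e_z then fst x else snd x)"
definition line_coord :: "real \<times> real \<Rightarrow> real \<times> real \<Rightarrow> real" where "line_coord i x = (if i = e_z then snd x else fst x)"

lemmas dir_defs = lo_def hi_def across_lo_def across_hi_def line_def across_def pt_def across_coord_def line_coord_def

lemma Basis_dir: "Basis = {e_theta, e_z}" by (auto simp: Basis_prod_def e_theta_def e_z_def)
lemma dir_neq[simp]: "e_theta \<noteq> e_z" "e_z \<noteq> e_theta" by (auto simp: e_theta_def e_z_def)

lemma sum_dirs: "(\<Sum>i\<in>Basis. g i) = g e_theta + g e_z" for g :: "real \<times> real \<Rightarrow> real"
  by (simp add: Basis_dir)

lemma lo_hi[simp]: "lo i < hi i" "across_lo i < across_hi i" "lo i \<le> hi i" "across_lo i \<le> across_hi i" by (auto simp: dir_defs)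
lemma pt_coords[simp]: "pt i (across_coord i x) (line_coord i x) = x" "across_coord i (pt i s t) = s" "line_coord i (pt i s t) = t"
  by (auto simp: dir_defs)
lemma sets_line[simp, measurable_cong]: "sets (line i) = sets borel" "sets (across i) = sets borel"
  and space_line[simp]: "space (line i) = UNIV" "space (across i) = UNIV"
  by (auto simp: dir_defs)
lemma finite_measure_line: "finite_measure (line i)" "finite_measure (across i)"
  by (simp_all add: line_def across_def finite_measure_seg)

lemma pt_measurable[measurable]: "(\<lambda>x. pt i (fst x) (snd x)) \<in> borel_measurable borel"
  "pt i s \<in> borel_measurable borel" "(\<lambda>s. pt i s t) \<in> borel_measurable borel"
  unfolding pt_def by (cases "i = e_z"; simp add: borel_prod[symmetric])+
lemma coords_measurable[measurable]: "across_coord i \<in> borel_measurable borel" "line_coord i \<in> borel_measurable borel"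
  unfolding across_coord_def[abs_def] line_coord_def[abs_def] by (cases "i = e_z"; simp add: borel_prod[symmetric])+

lemma dir_z: "i = e_z \<Longrightarrow> across i = seg 0 (2*pi)" "i = e_z \<Longrightarrow> line i = seg (-1/2) (1/2)" "i = e_z \<Longrightarrow> pt i s t = (s, t)"
  and dir_th: "i \<noteq> e_z \<Longrightarrow> across i = seg (-1/2) (1/2)" "i \<noteq> e_z \<Longrightarrow> line i = seg 0 (2*pi)" "i \<noteq> e_z \<Longrightarrow> pt i s t = (t, s)"
  by (simp_all add: dir_defs)

lemma AE_lines:
  assumes "AE x in Q. P x" shows "AE s in across i. AE t in line i. P (pt i s t)"
proof (cases "i = e_z")
  case True
  show ?thesis unfolding dir_z[OF True] by (rule QP.AE_pair[OF assms[unfolded Q_def]])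
next
  case False
  from AE_E[OF assms] obtain N where N: "{x \<in> space Q. \<not> P x} \<subseteq> N" "emeasure Q N = 0" "N \<in> sets Q" .
  then have "AE x in Q. x \<notin> N" by (intro AE_not_in null_setsI)
  from QP.AE_pair[OF this[unfolded Q_def]]
  have "AE s in seg 0 (2*pi). AE t in seg (-1/2) (1/2). (s, t) \<notin> N" .
  then have "AE t in seg (-1/2) (1/2). AE s in seg 0 (2*pi). (s, t) \<notin> N"
  proof (subst (asm) QP.AE_commute)
    have "{x \<in> space Q. (fst x, snd x) \<notin> N} = space Q - N" by auto
    then show "{x \<in> space (seg 0 (2*pi) \<Otimes>\<^sub>M seg (-1/2) (1/2)). (fst x, snd x) \<notin> N} \<in> sets (seg 0 (2*pi) \<Otimes>\<^sub>M seg (-1/2) (1/2))"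
      unfolding Q_def[symmetric] using N(3) by (metis sets.compl_sets)
  qed
  then have "AE t in seg (-1/2) (1/2). AE s in seg 0 (2*pi). P (s, t)"
  proof (elim eventually_mono)
    fix s t assume "(s, t) \<notin> N" then show "P (s, t)" using N(1) by auto
  qed
  then show ?thesis unfolding dir_th[OF False] .
qed

lemma
  fixes f :: "real \<times> real \<Rightarrow> real" assumes f: "integrable Q f"
  shows AE_integrable_lines: "AE s in across i. integrable (line i) (\<lambda>t. f (pt i s t))"
    and integrable_lines: "integrable (across i) (\<lambda>s. \<integral>t. f (pt i s t) \<partial>line i)"
    and integral_lines: "(\<integral>s. \<integral>t. f (pt i s t) \<partial>line i \<partial>across i) = integral\<^sup>L Q f"
proof -
  have f': "integrable (seg 0 (2 * pi) \<Otimes>\<^sub>M seg (-1/2) (1/2)) (case_prod (\<lambda>x y. f (x, y)))" using f by (simp add: Q_def)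
  show "AE s in across i. integrable (line i) (\<lambda>t. f (pt i s t))" 
  proof (cases "i = e_z")
    case True show ?thesis using QP.AE_integrable_fst[OF f'] unfolding dir_z[OF True] .
  next
    case False show ?thesis using QP.AE_integrable_snd[OF f'] unfolding dir_th[OF False] .
  qed
  show "integrable (across i) (\<lambda>s. \<integral>t. f (pt i s t) \<partial>line i)"
    using QP.integrable_fst[OF f'] QP.integrable_snd[OF f'] by (auto simp: dir_defs)
  show "(\<integral>s. \<integral>t. f (pt i s t) \<partial>line i \<partial>across i) = integral\<^sup>L Q f"
    using QP.integral_fst[OF f'] QP.integral_snd[OF f'] by (auto simp: dir_defs Q_def)
qed

lemma AE_lines_conv:
  assumes "AE s in across i. AE t in line i. P (pt i s t)" "{x. P x} \<in> sets borel"
  shows "AE x in Q. P x"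
proof -
  have m: "{x \<in> space Q. P x} \<in> sets Q" using assms(2) by simp
  have "AE s in seg 0 (2*pi). AE t in seg (-1/2) (1/2). P (s, t)"
  proof (cases "i = e_z")
    case True show ?thesis using assms(1) unfolding dir_z[OF True] .
  next
    case False show ?thesis using assms(1) m unfolding dir_th[OF False]
      by (subst QP.AE_commute) (simp_all only: Q_def prod.collapse)
  qed
  then show ?thesis using m unfolding Q_def by (intro QP.AE_pair_measure)
qed

section \<open>The fundamental lemma of the calculus of variations\<close>

text \<open>The measures with densities \<open>f\<^sup>+\<close> and \<open>f\<^sup>-\<close> agree on boxes, which generate the Borel sets and are
  stable under intersection; hence the densities agree almost everywhere.\<close>

lemma AE_zero_if_box_integrals_zero:
  fixes f :: "real \<times> real \<Rightarrow> real"
  assumes f: "integrable Q f" and z: "\<And>a b. (\<integral>x. indicator (box a b) x * f x \<partial>Q) = 0"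
  shows "AE x in Q. f x = 0"
proof -
  have [measurable]: "f \<in> borel_measurable borel" using borel_measurable_integrable[OF f] by simp
  let ?p = "\<lambda>x. ennreal (f x)" and ?n = "\<lambda>x. ennreal (- f x)"
  have fin: "emeasure (density Q ?p) X \<noteq> \<infinity>" if [measurable]: "X \<in> sets borel" for X
  proof -
    have "emeasure (density Q ?p) X \<le> (\<integral>\<^sup>+ x. ennreal (norm (f x)) \<partial>Q)"
      by (subst emeasure_density) (auto intro!: nn_integral_mono simp: indicator_def intro: ennreal_leI)
    also have "\<dots> < \<infinity>" using f by (auto simp: integrable_iff_bounded)
    finally show ?thesis by simp
  qed
  have "density Q ?p = density Q ?n"
  proof (rule measure_eqI_generator_eq[where E="range (\<lambda>(a, b). box a b)" and \<Omega>=UNIV and A="\<lambda>n::nat. box (- (real n *\<^sub>R One)) (real n *\<^sub>R One)"])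
    show "Int_stable (range (\<lambda>(a, b). box a b :: (real\<times>real) set))"
      by (auto simp: Int_stable_def box_Int_box)
    show "sets (density Q ?p) = sigma_sets UNIV (range (\<lambda>(a, b). box a b))" "sets (density Q ?n) = sigma_sets UNIV (range (\<lambda>(a, b). box a b))"
      by (simp_all add: borel_eq_box)
    show "(\<Union>n::nat. box (- (real n *\<^sub>R One)) (real n *\<^sub>R One) :: (real\<times>real) set) = UNIV" by (rule UN_box_eq_UNIV)
  next
    fix X :: "(real\<times>real) set" assume "X \<in> range (\<lambda>(a, b). box a b)"
    then obtain a b where X: "X = box a b" by auto
    have e: "emeasure (density Q (\<lambda>x. ennreal (g x))) X = ennreal (\<integral>x. indicator X x * max 0 (g x) \<partial>Q)"
      if "integrable Q g" for g :: "_ \<Rightarrow> real"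
    proof -
      have [measurable]: "g \<in> borel_measurable borel" using borel_measurable_integrable[OF that] by simp
      have "emeasure (density Q (\<lambda>x. ennreal (g x))) X = (\<integral>\<^sup>+x. ennreal (indicator X x * max 0 (g x)) \<partial>Q)"
        by (subst emeasure_density) (auto simp: X ennreal_mult' ennreal_indicator max_def ennreal_neg mult.commute intro!: nn_integral_cong)
      also have "\<dots> = ennreal (\<integral>x. indicator X x * max 0 (g x) \<partial>Q)"
        by (intro nn_integral_eq_integral Bochner_Integration.integrable_bound[OF that]) (auto simp: X indicator_def)
      finally show ?thesis .
    qed
    have i: "integrable Q (\<lambda>x. indicator X x * max 0 (f x))" "integrable Q (\<lambda>x. indicator X x * max 0 (- f x))"
      by (rule Bochner_Integration.integrable_bound[OF f]; auto simp: X indicator_def)+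
    have "(\<integral>x. indicator X x * max 0 (f x) \<partial>Q) - (\<integral>x. indicator X x * max 0 (- f x) \<partial>Q) = (\<integral>x. indicator X x * f x \<partial>Q)"
      by (subst Bochner_Integration.integral_diff[symmetric, OF i]) (auto intro!: Bochner_Integration.integral_cong simp: max_def)
    with z[of a b] show "emeasure (density Q ?p) X = emeasure (density Q ?n) X"
      using f by (subst (1 2) e) (auto simp: X)
  qed (auto intro!: fin[simplified])
  then have "AE x in Q. ?p x = ?n x"
    by (subst (asm) finite_density_unique) (use fin[of UNIV] in \<open>auto simp: emeasure_density\<close>)
  then show ?thesis by eventually_elim (metis ennreal_eq_0_iff le_less_linear less_imp_le neg_le_0_iff_le order_antisym_conv)
qed

text \<open>Products of test functions converge boundedly to indicators of boxes, so the preceding lemma applies by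
  dominated convergence.\<close>

lemma fundamental_lemma:
  fixes f :: "real \<times> real \<Rightarrow> real"
  assumes f: "integrable Q f"
    and T: "approximating T1 0 (2 * pi)" "approximating T2 (-1/2) (1/2)" 
    and m: "\<And>\<alpha>. \<alpha> \<in> T1 \<union> T2 \<Longrightarrow> \<alpha> \<in> borel_measurable borel"
    and z: "\<And>\<alpha> \<beta>. \<alpha> \<in> T1 \<Longrightarrow> \<beta> \<in> T2 \<Longrightarrow> (\<integral>x. \<alpha> (fst x) * \<beta> (snd x) * f x \<partial>Q) = 0"
  shows "AE x in Q. f x = 0"
proof (rule AE_zero_if_box_integrals_zero[OF f])
  fix a b :: "real \<times> real"
  have fm[measurable]: "f \<in> borel_measurable borel" using borel_measurable_integrable[OF f] by simp
  have op: "AE x in Q. fst x \<in> {0<..<2*pi} \<and> snd x \<in> {-1/2<..<1/2}"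
    unfolding Q_def
  proof (rule QP.AE_pair_measure)
    show "AE x in seg 0 (2*pi). AE y in seg (-1/2) (1/2). fst (x,y) \<in> {0<..<2*pi} \<and> snd (x,y) \<in> {-1/2<..<1/2}"
      using AE_seg_in_open[of 0 "2*pi"]
    proof eventually_elim
      case (elim x)
      show ?case using AE_seg_in_open[of "-1/2" "1/2"] by eventually_elim (use elim in simp)
    qed
  qed measurable
  define p where "p = max (fst a) 0" define q where "q = min (fst b) (2 * pi)"
  define p' where "p' = max (snd a) (-1/2)" define q' where "q' = min (snd b) (1/2)"
  have box: "AE x in Q. indicator (box a b) x = (indicator {p<..<q} (fst x) * indicator {p'<..<q'} (snd x) :: real)"
    using op by eventually_elim (auto simp: p_def q_def p'_def q'_def indicator_def box_def Basis_prod_def inner_prod_def)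
  show "(\<integral>x. indicator (box a b) x * f x \<partial>Q) = 0"
  proof (cases "p < q \<and> p' < q'")
    case False
    then have "AE x in Q. indicator (box a b) x * f x = 0" using box by (auto elim: eventually_mono)
    then show ?thesis by (rule integral_eq_zero_AE)
  next
    case True
    then have pq: "0 \<le> p \<and> p < q \<and> q \<le> 2*pi" "-1/2 \<le> p' \<and> p' < q' \<and> q' \<le> 1/2"
      by (auto simp: p_def q_def p'_def q'_def)
    obtain \<alpha> where \<alpha>: "\<And>n. \<alpha> n \<in> T1" "\<And>n x. \<bar>\<alpha> n x\<bar> \<le> 1" "\<And>x. x \<in> {0..2*pi} \<Longrightarrow> (\<lambda>n::nat. \<alpha> n x) \<longlonglongrightarrow> indicator {p<..<q} x"
      using T(1)[unfolded approximating_def, rule_format, of p q, OF pq(1)] by blast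
    obtain \<beta> where \<beta>: "\<And>n. \<beta> n \<in> T2" "\<And>n x. \<bar>\<beta> n x\<bar> \<le> 1" "\<And>x. x \<in> {-1/2..1/2} \<Longrightarrow> (\<lambda>n::nat. \<beta> n x) \<longlonglongrightarrow> indicator {p'<..<q'} x"
      using T(2)[unfolded approximating_def, rule_format, of p' q', OF pq(2)] by blast
    have [measurable]: "\<alpha> n \<in> borel_measurable borel" "\<beta> n \<in> borel_measurable borel" for n using m \<alpha>(1) \<beta>(1) by auto
    have "(\<lambda>n. \<integral>x. \<alpha> n (fst x) * \<beta> n (snd x) * f x \<partial>Q) \<longlonglongrightarrow> (\<integral>x. indicator (box a b) x * f x \<partial>Q)"
    proof (rule integral_dominated_convergence[where w="\<lambda>x. \<bar>f x\<bar>"])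
      show "AE x in Q. (\<lambda>n. \<alpha> n (fst x) * \<beta> n (snd x) * f x) \<longlonglongrightarrow> indicator (box a b) x * f x"
        using op box by eventually_elim (auto intro!: tendsto_mult \<alpha>(3) \<beta>(3))
      show "AE x in Q. norm (\<alpha> n (fst x) * \<beta> n (snd x) * f x) \<le> \<bar>f x\<bar>" for n
        using \<alpha>(2) \<beta>(2) by (auto simp: abs_mult intro!: mult_left_le_one_le mult_le_one)
    qed (use f in auto)
    then have "(\<lambda>n::nat. 0::real) \<longlonglongrightarrow> (\<integral>x. indicator (box a b) x * f x \<partial>Q)" by (simp add: z[OF \<alpha>(1) \<beta>(1)])
    then show ?thesis by (simp add: LIMSEQ_const_iff)
  qed
qed

section \<open>Derivatives on almost every line\<close>

text \<open>\<open>u\<close> agrees on almost every line in direction \<open>i\<close> with an absolutely continuous function whose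
  density is \<open>g\<close>. In contrast to the weak derivative, this notion admits the pointwise calculus of
  products and compositions.\<close>

definition WD :: "real \<times> real \<Rightarrow> (real \<times> real \<Rightarrow> real) \<Rightarrow> (real \<times> real \<Rightarrow> real) \<Rightarrow> bool" where
  "WD i u g \<longleftrightarrow> u \<in> borel_measurable borel \<and> g \<in> borel_measurable borel \<and> integrable Q g \<and>
     (AE s in across i. \<exists>F. AC_on (lo i) (hi i) F (\<lambda>t. g (pt i s t)) \<and> (AE t in line i. u (pt i s t) = F t))"

text \<open>For a derivative \<open>g\<close> of \<open>u\<close> along lines this says that \<open>u\<close> takes the same value at both ends of
  almost every line, that is, that \<open>u\<close> is periodic.\<close>

definition zero_mean :: "real \<times> real \<Rightarrow> (real \<times> real \<Rightarrow> real) \<Rightarrow> bool" where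
  "zero_mean i g \<longleftrightarrow> (AE s in across i. (\<integral>t. g (pt i s t) \<partial>line i) = 0)"

lemma seg_AE_integral_cong:
  fixes f g :: "real \<Rightarrow> real"
  assumes "AE t in seg a b. f t = g t" shows "integral {a..b} f = integral {a..b} g"
proof -
  have "AE t in lebesgue. t \<in> {a..b} \<longrightarrow> f t = g t" using assms unfolding AE_seg by (rule AE_completion)
  then obtain N where "negligible N" "{t. \<not> (t \<in> {a..b} \<longrightarrow> f t = g t)} \<subseteq> N"
    unfolding eventually_ae_filter_negligible by auto
  then show ?thesis by (intro integral_spike[of N]) auto
qed

lemma bounded_on_Omega:
  fixes \<phi> :: "real \<times> real \<Rightarrow> real"
  assumes "continuous_on UNIV \<phi>" shows "\<exists>B\<ge>0. \<forall>x\<in>Omega. \<bar>\<phi> x\<bar> \<le> B"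
proof -
  have "compact Omega" by (auto simp: Omega_def intro!: compact_Times)
  then have "bounded (\<phi> ` Omega)" by (intro compact_imp_bounded compact_continuous_image continuous_on_subset[OF assms]) auto
  then show ?thesis by (auto simp: bounded_pos intro: less_imp_le)
qed

lemma integrable_mult_continuous_leb:
  fixes g :: "real \<times> real \<Rightarrow> 'b::euclidean_space"
  assumes g: "integrable leb_Omega g" and \<phi>: "continuous_on UNIV \<phi>"
  shows "integrable leb_Omega (\<lambda>x. \<phi> x *\<^sub>R g x)"
proof -
  obtain B where B: "B \<ge> 0" "\<And>x. x \<in> Omega \<Longrightarrow> \<bar>\<phi> x\<bar> \<le> B" using bounded_on_Omega[OF \<phi>] by blast
  have "\<phi> \<in> borel_measurable borel" using \<phi> by (rule borel_measurable_continuous_onI)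
  then have [measurable]: "\<phi> \<in> borel_measurable leb_Omega" by (rule meas_leb)
  have [measurable]: "g \<in> borel_measurable leb_Omega" using g by auto
  show ?thesis
  proof (rule Bochner_Integration.integrable_bound[where f="\<lambda>x. B *\<^sub>R g x"])
    show "AE x in leb_Omega. norm (\<phi> x *\<^sub>R g x) \<le> norm (B *\<^sub>R g x)"
      by (rule AE_I2) (use B in \<open>auto simp: space_restrict_space intro!: mult_right_mono order_trans[OF B(2)]\<close>)
  qed (use g in auto)
qed

lemma integrable_mult_continuous:
  fixes g :: "real \<times> real \<Rightarrow> real"
  assumes g: "integrable Q g" and \<phi>: "continuous_on UNIV \<phi>"
  shows "integrable Q (\<lambda>x. \<phi> x * g x)"
proof -
  have [measurable]: "g \<in> borel_measurable borel" using borel_measurable_integrable[OF g] by simp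
  have [measurable]: "\<phi> \<in> borel_measurable borel" using \<phi> by (rule borel_measurable_continuous_onI)
  show ?thesis using integrable_mult_continuous_leb[of g \<phi>] g \<phi> by (simp add: integrable_Q_leb)
qed

lemma continuous_pt: "continuous_on UNIV f \<Longrightarrow> continuous_on S (\<lambda>t. f (pt i s t))"
  unfolding pt_def by (cases "i = e_z") (auto intro!: continuous_intros continuous_on_compose2[of UNIV f])

text \<open>On each line the product of \<open>\<phi>\<close> with the absolutely continuous representative takes equal values at
  the two ends: either \<open>\<phi>\<close> vanishes there, or \<open>\<phi>\<close> and the representative are both periodic. The two
  alternatives serve the two classes of test functions.\<close>

lemma WD_by_parts:
  assumes W: "WD i u g" and u: "integrable Q u"
    and c: "continuous_on UNIV \<phi>" "continuous_on UNIV \<phi>'"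
    and d: "\<And>s t. ((\<lambda>t. \<phi> (pt i s t)) has_real_derivative \<phi>' (pt i s t)) (at t)"
    and b: "AE s in across i. (\<phi> (pt i s (hi i)) = 0 \<and> \<phi> (pt i s (lo i)) = 0) \<or>
         (\<phi> (pt i s (hi i)) = \<phi> (pt i s (lo i)) \<and> (\<integral>t. g (pt i s t) \<partial>line i) = 0)"
  shows "(\<integral>x. \<phi>' x * u x \<partial>Q) = - (\<integral>x. \<phi> x * g x \<partial>Q)"
proof -
  have [measurable]: "u \<in> borel_measurable borel" "g \<in> borel_measurable borel" and g: "integrable Q g"
    using W by (auto simp: WD_def)
  have [measurable]: "\<phi> \<in> borel_measurable borel" "\<phi>' \<in> borel_measurable borel" 
    using c by (auto intro: borel_measurable_continuous_onI)
  note i = integrable_mult_continuous[OF u c(2)] integrable_mult_continuous[OF g c(1)]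
  define h where "h x = \<phi> x * g x + \<phi>' x * u x" for x
  have [measurable]: "h \<in> borel_measurable borel" unfolding h_def by simp
  have h: "integrable Q h" unfolding h_def using i by auto
  have "AE s in across i. (\<integral>t. h (pt i s t) \<partial>line i) = 0"
    using W[unfolded WD_def, THEN conjunct2, THEN conjunct2, THEN conjunct2] b AE_integrable_lines[OF h, of i] AE_integrable_lines[OF g, of i]
  proof eventually_elim
    case (elim s)
    then obtain F where F: "AC_on (lo i) (hi i) F (\<lambda>t. g (pt i s t))" "AE t in line i. u (pt i s t) = F t" by auto
    have \<phi>l: "AC_on (lo i) (hi i) (\<lambda>t. \<phi> (pt i s t)) (\<lambda>t. \<phi>' (pt i s t))"
      by (rule AC_on_C1) (auto intro!: continuous_pt c DERIV_subset[OF d])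
    note P = AC_on_mult[OF F(1) \<phi>l]
    have "(\<integral>t. h (pt i s t) \<partial>line i) = integral {lo i..hi i} (\<lambda>t. h (pt i s t))"
      using elim(3) unfolding line_def by (intro integral_seg) auto
    also have "\<dots> = integral {lo i..hi i} (\<lambda>t. \<phi> (pt i s t) * g (pt i s t) + F t * \<phi>' (pt i s t))"
    proof (rule seg_AE_integral_cong)
      show "AE t in seg (lo i) (hi i). h (pt i s t) = \<phi> (pt i s t) * g (pt i s t) + F t * \<phi>' (pt i s t)"
        using F(2)[unfolded line_def] by eventually_elim (simp add: h_def)
    qed
    also have "\<dots> = F (hi i) * \<phi> (pt i s (hi i)) - F (lo i) * \<phi> (pt i s (lo i))"
      using AC_on_diff[OF P, of "lo i" "hi i"] by simp
    also have "\<dots> = 0"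
    proof -
      have "(\<integral>t. g (pt i s t) \<partial>line i) = integral {lo i..hi i} (\<lambda>t. g (pt i s t))"
        using elim(4) unfolding line_def by (intro integral_seg) auto
      then have "(\<integral>t. g (pt i s t) \<partial>line i) = F (hi i) - F (lo i)"
        using AC_on_diff[OF F(1), of "lo i" "hi i"] by simp
      then show ?thesis using elim(2) by auto
    qed
    finally show ?case .
  qed
  then have "(\<integral>s. \<integral>t. h (pt i s t) \<partial>line i \<partial>across i) = 0" by (rule integral_eq_zero_AE)
  then have "integral\<^sup>L Q h = 0" using integral_lines[OF h] by simp
  then show ?thesis unfolding h_def using i by simp
qed

lemma has_derivative_pt: "((\<lambda>t. pt i s t) has_derivative (\<lambda>h. h *\<^sub>R (if i = e_z then e_z else e_theta))) (at t)"
  unfolding pt_def e_z_def e_theta_def by (auto intro!: derivative_eq_intros simp: zero_prod_def)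

lemma smooth_line_deriv:
  assumes "smooth \<phi>" "i \<in> Basis"
  shows "((\<lambda>t. \<phi> (pt i s t)) has_real_derivative frechet_derivative \<phi> (at (pt i s t)) i) (at t)"
    and "continuous_on UNIV \<phi>" "continuous_on UNIV (\<lambda>x. frechet_derivative \<phi> (at x) i)"
proof -
  have C1: "C_diff (Suc 0) \<phi>" and "C_diff 0 \<phi>" using assms(1) unfolding smooth_def by blast+
  then show "continuous_on UNIV \<phi>" "continuous_on UNIV (\<lambda>x. frechet_derivative \<phi> (at x) i)" using assms(2) by auto
  have f: "(\<phi> has_derivative frechet_derivative \<phi> (at x)) (at x)" for x
    using C1 by (cases x) (auto simp: frechet_derivative_works[symmetric])
  then interpret L: bounded_linear "frechet_derivative \<phi> (at (pt i s t))" by (rule has_derivative_bounded_linear)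
  have ie: "(if i = e_z then e_z else e_theta) = i" using assms(2) unfolding Basis_dir by (cases "i = e_z") auto
  have "(\<lambda>h. frechet_derivative \<phi> (at (pt i s t)) (h *\<^sub>R (if i = e_z then e_z else e_theta)))
      = (*) (frechet_derivative \<phi> (at (pt i s t)) i)"
    unfolding ie by (simp add: fun_eq_iff L.scaleR mult.commute)
  with has_derivative_compose[OF has_derivative_pt[of i s t] f]
  show "((\<lambda>t. \<phi> (pt i s t)) has_real_derivative frechet_derivative \<phi> (at (pt i s t)) i) (at t)"
    by (simp add: has_field_derivative_def)
qed

lemma WD_imp_weak_test:
  assumes W: "WD i u g" and u: "integrable Q u" and i: "i \<in> Basis"
  shows "has_weak_deriv test_fun i u g"
  unfolding has_weak_deriv_def
proof (intro conjI ballI)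
  have m[measurable]: "u \<in> borel_measurable borel" "g \<in> borel_measurable borel" and g: "integrable Q g"
    using W by (auto simp: WD_def)
  show "integrable leb_Omega u" "integrable leb_Omega g" using u g by (simp_all add: integrable_Q_leb)
  fix \<phi> assume \<phi>: "\<phi> \<in> test_fun"
  then have sm: "smooth \<phi>" and s: "closure {x. \<phi> x \<noteq> 0} \<subseteq> interior Omega" by (auto simp: test_fun_def)
  note c = smooth_line_deriv[OF sm i]
  have [measurable]: "\<phi> \<in> borel_measurable borel" "(\<lambda>x. frechet_derivative \<phi> (at x) i) \<in> borel_measurable borel" 
    by (rule borel_measurable_continuous_onI[OF c(2)] borel_measurable_continuous_onI[OF c(3)])+
  have z: "\<phi> (pt i s (hi i)) = 0" "\<phi> (pt i s (lo i)) = 0" for s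
  proof -
    have "x \<in> interior Omega" if "\<phi> x \<noteq> 0" for x
      by (rule subsetD[OF s subsetD[OF closure_subset]]) (use that in simp)
    moreover have "pt i s (hi i) \<notin> interior Omega" "pt i s (lo i) \<notin> interior Omega"
      unfolding Omega_def interior_Times interior_atLeastAtMost_real by (simp_all add: dir_defs)
    ultimately show "\<phi> (pt i s (hi i)) = 0" "\<phi> (pt i s (lo i)) = 0" by metis+
  qed
  have "(\<integral>x. frechet_derivative \<phi> (at x) i * u x \<partial>Q) = - (\<integral>x. \<phi> x * g x \<partial>Q)"
    by (rule WD_by_parts[OF W u c(2,3,1)]) (simp add: z)
  then show "(\<integral>x. frechet_derivative \<phi> (at x) i *\<^sub>R u x \<partial>leb_Omega) = - (\<integral>x. \<phi> x *\<^sub>R g x \<partial>leb_Omega)"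
    by (simp add: integral_Q_leb)
qed

lemma WD_imp_weak_per:
  assumes W: "WD i u g" and u: "integrable Q u" and i: "i \<in> Basis" and zm: "zero_mean i g"
  shows "has_weak_deriv per_test_fun i u g"
  unfolding has_weak_deriv_def
proof (intro conjI ballI)
  have m[measurable]: "u \<in> borel_measurable borel" "g \<in> borel_measurable borel" and g: "integrable Q g"
    using W by (auto simp: WD_def)
  show "integrable leb_Omega u" "integrable leb_Omega g" using u g by (simp_all add: integrable_Q_leb)
  fix \<phi> assume \<phi>: "\<phi> \<in> per_test_fun"
  then have sm: "smooth \<phi>" and p: "\<And>x. \<phi> (x + (2 * pi, 0)) = \<phi> x" "\<And>x. \<phi> (x + (0, 1)) = \<phi> x" by (auto simp: per_test_fun_def)
  note c = smooth_line_deriv[OF sm i]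
  have [measurable]: "\<phi> \<in> borel_measurable borel" "(\<lambda>x. frechet_derivative \<phi> (at x) i) \<in> borel_measurable borel" 
    by (rule borel_measurable_continuous_onI[OF c(2)] borel_measurable_continuous_onI[OF c(3)])+
  have z: "\<phi> (pt i s (hi i)) = \<phi> (pt i s (lo i))" for s
    using p(1)[of "(0, s)"] p(2)[of "(s, -1/2)"] by (auto simp: dir_defs)
  have "(\<integral>x. frechet_derivative \<phi> (at x) i * u x \<partial>Q) = - (\<integral>x. \<phi> x * g x \<partial>Q)"
  proof (rule WD_by_parts[OF W u c(2,3,1)])
    show "AE s in across i. (\<phi> (pt i s (hi i)) = 0 \<and> \<phi> (pt i s (lo i)) = 0) \<or>
         (\<phi> (pt i s (hi i)) = \<phi> (pt i s (lo i)) \<and> (\<integral>t. g (pt i s t) \<partial>line i) = 0)"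
      using zm[unfolded zero_mean_def] by eventually_elim (simp add: z)
  qed
  then show "(\<integral>x. frechet_derivative \<phi> (at x) i *\<^sub>R u x \<partial>leb_Omega) = - (\<integral>x. \<phi> x *\<^sub>R g x \<partial>leb_Omega)"
    by (simp add: integral_Q_leb)
qed

lemma smooth1_measurable: "smooth1 \<alpha> \<Longrightarrow> \<alpha> \<in> borel_measurable borel"
  unfolding smooth1_def using Ck.simps(1) borel_measurable_continuous_onI by blast

text \<open>The fundamental lemma is applied to each component of the difference, with products of compactly
  supported functions of one variable.\<close>

lemma weak_deriv_unique:
  fixes u :: "real \<times> real \<Rightarrow> 'b::euclidean_space"
  assumes "has_weak_deriv test_fun i u g" "has_weak_deriv test_fun i u g'"
  shows "AE x in leb_Omega. g x = g' x"
proof -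
  have g: "integrable leb_Omega g" "integrable leb_Omega g'" using assms by (auto simp: has_weak_deriv_def)
  have "AE x in leb_Omega. (g x - g' x) \<bullet> b = 0" if b: "b \<in> Basis" for b
  proof -
    define f where "f x = (g x - g' x) \<bullet> b" for x
    have f: "integrable leb_Omega f" unfolding f_def using g by auto
    obtain f' where f'[measurable]: "f' \<in> borel_measurable borel" and ff': "AE x in leb_Omega. f x = f' x"
      using leb_borel_rep[of f] f by blast
    have if': "integrable Q f'"
    proof -
      have "integrable leb_Omega f'"
        using Bochner_Integration.integrable_cong_AE[of f leb_Omega f'] f ff' by (auto intro: meas_leb)
      then show ?thesis by (simp add: integrable_Q_leb)
    qed
    have "AE x in Q. f' x = 0"
    proof (rule fundamental_lemma[OF if' approximating_cpt_fun approximating_cpt_fun])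
      show "\<alpha> \<in> borel_measurable borel" if "\<alpha> \<in> cpt_fun 0 (2*pi) \<union> cpt_fun (-1/2) (1/2)" for \<alpha>
        using that smooth1_measurable by (auto simp: cpt_fun_def)
      fix \<alpha> \<beta> assume ab: "\<alpha> \<in> cpt_fun 0 (2*pi)" "\<beta> \<in> cpt_fun (-1/2) (1/2)"
      define \<phi> where "\<phi> x = \<alpha> (fst x) * \<beta> (snd x)" for x :: "real \<times> real"
      have \<phi>: "\<phi> \<in> test_fun" unfolding \<phi>_def using tensor_test_fun[OF ab] .
      then have cp: "continuous_on UNIV \<phi>" using smooth_line_deriv(2)[of \<phi> e_z] by (auto simp: test_fun_def Basis_dir)
      then have [measurable]: "\<phi> \<in> borel_measurable borel" by (rule borel_measurable_continuous_onI)
      note ig = integrable_mult_continuous_leb[OF g(1) cp] integrable_mult_continuous_leb[OF g(2) cp]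
      have "- (\<integral>x. \<phi> x *\<^sub>R g x \<partial>leb_Omega) = - (\<integral>x. \<phi> x *\<^sub>R g' x \<partial>leb_Omega)"
        using assms[unfolded has_weak_deriv_def, THEN conjunct2, THEN conjunct2, rule_format, OF \<phi>] by simp
      then have "0 = ((\<integral>x. \<phi> x *\<^sub>R g x \<partial>leb_Omega) - (\<integral>x. \<phi> x *\<^sub>R g' x \<partial>leb_Omega)) \<bullet> b" by simp
      also have "\<dots> = (\<integral>x. (\<phi> x *\<^sub>R g x - \<phi> x *\<^sub>R g' x) \<partial>leb_Omega) \<bullet> b" using ig by simp
      also have "\<dots> = (\<integral>x. (\<phi> x *\<^sub>R g x - \<phi> x *\<^sub>R g' x) \<bullet> b \<partial>leb_Omega)" using ig by (intro integral_inner_left[symmetric]) auto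
      also have "\<dots> = (\<integral>x. \<phi> x * f x \<partial>leb_Omega)" by (simp add: f_def inner_diff_left right_diff_distrib)
      also have "\<dots> = (\<integral>x. \<phi> x * f' x \<partial>leb_Omega)"
        using f ff' by (intro integral_cong_AE) (auto intro: meas_leb elim: eventually_mono)
      also have "\<dots> = (\<integral>x. \<phi> x * f' x \<partial>Q)" by (simp add: integral_Q_leb)
      finally show "(\<integral>x. \<alpha> (fst x) * \<beta> (snd x) * f' x \<partial>Q) = 0" by (simp add: \<phi>_def)
    qed
    then have "AE x in leb_Omega. f' x = 0" by (simp add: AE_Q_leb)
    with ff' show ?thesis by eventually_elim (simp add: f_def)
  qed
  then have "AE x in leb_Omega. \<forall>b\<in>Basis. (g x - g' x) \<bullet> b = 0" by (simp add: AE_finite_all)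
  then show ?thesis by eventually_elim (metis euclidean_all_zero_iff right_minus_eq)
qed

lemma weak_deriv_eq:
  assumes "has_weak_deriv test_fun i u g"
  shows "has_weak_deriv test_fun i u (weak_deriv i u)" "AE x in leb_Omega. weak_deriv i u x = g x"
proof -
  show 1: "has_weak_deriv test_fun i u (weak_deriv i u)"
    unfolding weak_deriv_def by (rule someI[of "has_weak_deriv test_fun i u", OF assms])
  show "AE x in leb_Omega. weak_deriv i u x = g x" by (rule weak_deriv_unique[OF 1 assms])
qed

lemma has_weak_deriv_cong:
  assumes h: "has_weak_deriv T i u g" and u': "u' \<in> borel_measurable leb_Omega" and e: "AE x in leb_Omega. u x = u' x"
    and T: "T = test_fun \<or> T = per_test_fun" and i: "i \<in> Basis"
  shows "has_weak_deriv T i u' g"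
  unfolding has_weak_deriv_def
proof (intro conjI ballI)
  have u: "integrable leb_Omega u" and "integrable leb_Omega g" using h by (auto simp: has_weak_deriv_def)
  then show "integrable leb_Omega g" by simp
  have [measurable]: "u \<in> borel_measurable leb_Omega" using u by auto
  show "integrable leb_Omega u'" by (rule integrable_cong_AE_imp[OF u u' e])
  fix \<phi> assume \<phi>: "\<phi> \<in> T"
  then have "smooth \<phi>" using T by (auto simp: test_fun_def per_test_fun_def)
  from smooth_line_deriv(3)[OF this i] have [measurable]: "(\<lambda>x. frechet_derivative \<phi> (at x) i) \<in> borel_measurable leb_Omega"
    by (intro meas_leb borel_measurable_continuous_onI)
  have "(\<integral>x. frechet_derivative \<phi> (at x) i *\<^sub>R u' x \<partial>leb_Omega) = (\<integral>x. frechet_derivative \<phi> (at x) i *\<^sub>R u x \<partial>leb_Omega)"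
    using e u' by (intro integral_cong_AE) (auto elim: eventually_mono)
  then show "(\<integral>x. frechet_derivative \<phi> (at x) i *\<^sub>R u' x \<partial>leb_Omega) = - (\<integral>x. \<phi> x *\<^sub>R g x \<partial>leb_Omega)"
    using h \<phi> by (auto simp: has_weak_deriv_def)
qed

lemma has_weak_deriv_cong_deriv:
  assumes h: "has_weak_deriv T i u g" and g': "g' \<in> borel_measurable leb_Omega" and e: "AE x in leb_Omega. g x = g' x"
    and T: "T = test_fun \<or> T = per_test_fun"
  shows "has_weak_deriv T i u g'"
  unfolding has_weak_deriv_def
proof (intro conjI ballI)
  have g: "integrable leb_Omega g" and "integrable leb_Omega u" using h by (auto simp: has_weak_deriv_def)
  then show "integrable leb_Omega u" by simp
  have [measurable]: "g \<in> borel_measurable leb_Omega" using g by auto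
  show "integrable leb_Omega g'" by (rule integrable_cong_AE_imp[OF g g' e])
  fix \<phi> assume \<phi>: "\<phi> \<in> T"
  then have "smooth \<phi>" using T by (auto simp: test_fun_def per_test_fun_def)
  from smooth_line_deriv(2)[OF this, of e_z] have [measurable]: "\<phi> \<in> borel_measurable leb_Omega"
    by (intro meas_leb borel_measurable_continuous_onI) (auto simp: Basis_dir)
  have "(\<integral>x. \<phi> x *\<^sub>R g x \<partial>leb_Omega) = (\<integral>x. \<phi> x *\<^sub>R g' x \<partial>leb_Omega)"
    using e g' by (intro integral_cong_AE) (auto elim: eventually_mono)
  then show "(\<integral>x. frechet_derivative \<phi> (at x) i *\<^sub>R u x \<partial>leb_Omega) = - (\<integral>x. \<phi> x *\<^sub>R g' x \<partial>leb_Omega)"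
    using h \<phi> by (auto simp: has_weak_deriv_def)
qed

section \<open>Periodic weak derivatives are derivatives on lines\<close>

lemma AE_line_const: "(AE t in line i. C) \<longleftrightarrow> C"
proof -
  have "emeasure (line i) (space (line i)) \<noteq> 0"
    using emeasure_seg[of "lo i" "hi i"] lo_hi(1)[of i] by (simp add: line_def del: lo_hi)
  then show ?thesis by (simp add: eventually_const_iff ae_filter_eq_bot_iff)
qed

text \<open>The product test function written in terms of the coordinates along and across the chosen direction.\<close>

lemma tensor_in_direction:
  assumes i: "i \<in> Basis" and a: "\<alpha> \<in> per_fun (across_lo i) (across_hi i)" and b: "\<beta> \<in> per_fun (lo i) (hi i)"
    and d: "\<And>t. (\<beta> has_real_derivative \<beta>' t) (at t)"
  shows "(\<lambda>x. \<alpha> (across_coord i x) * \<beta> (line_coord i x)) \<in> per_test_fun"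
    and "frechet_derivative (\<lambda>x. \<alpha> (across_coord i x) * \<beta> (line_coord i x)) (at x) i = \<alpha> (across_coord i x) * \<beta>' (line_coord i x)"
proof -
  have "Ck (Suc 0) \<alpha>" using a unfolding per_fun_def smooth1_def by blast
  then obtain \<alpha>' where d': "\<And>t. (\<alpha> has_real_derivative \<alpha>' t) (at t)" by auto
  have "(\<lambda>x. \<alpha> (across_coord i x) * \<beta> (line_coord i x)) \<in> per_test_fun \<and>
    frechet_derivative (\<lambda>x. \<alpha> (across_coord i x) * \<beta> (line_coord i x)) (at x) i = \<alpha> (across_coord i x) * \<beta>' (line_coord i x)"
  proof (cases "i = e_z")
    case True
    with a b have "\<alpha> \<in> per_fun 0 (2*pi)" "\<beta> \<in> per_fun (-1/2) (1/2)" by (auto simp: dir_defs)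
    then show ?thesis using True tensor_per_test_fun[of \<alpha> \<beta>] frechet_tensor[OF d' d, of x]
      by (simp add: across_coord_def line_coord_def) (simp add: e_z_def)
  next
    case False
    then have "i = e_theta" using i by (auto simp: Basis_dir)
    with a b have "\<beta> \<in> per_fun 0 (2*pi)" "\<alpha> \<in> per_fun (-1/2) (1/2)" by (auto simp: dir_defs)
    then show ?thesis using \<open>i = e_theta\<close> tensor_per_test_fun[of \<beta> \<alpha>] frechet_tensor[OF d d', of x]
      by (simp add: across_coord_def line_coord_def mult.commute) (simp add: e_theta_def)
  qed
  then show "(\<lambda>x. \<alpha> (across_coord i x) * \<beta> (line_coord i x)) \<in> per_test_fun"
    "frechet_derivative (\<lambda>x. \<alpha> (across_coord i x) * \<beta> (line_coord i x)) (at x) i = \<alpha> (across_coord i x) * \<beta>' (line_coord i x)" by auto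
qed

lemma fundamental_lemma_dir:
  fixes f :: "real \<times> real \<Rightarrow> real"
  assumes f: "integrable Q f"
    and z: "\<And>\<alpha> \<beta>. \<alpha> \<in> per_fun (across_lo i) (across_hi i) \<Longrightarrow> \<beta> \<in> per_fun (lo i) (hi i) \<Longrightarrow>
       (\<integral>x. \<alpha> (across_coord i x) * \<beta> (line_coord i x) * f x \<partial>Q) = 0"
  shows "AE x in Q. f x = 0"
proof (rule fundamental_lemma[OF f])
  show "approximating (per_fun 0 (2*pi)) 0 (2 * pi)" "approximating (per_fun (-1/2) (1/2)) (-1/2) (1/2)"
    by (rule approximating_per_fun; simp)+
  show "\<alpha> \<in> borel_measurable borel" if "\<alpha> \<in> per_fun 0 (2*pi) \<union> per_fun (-1/2) (1/2)" for \<alpha>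
    using that smooth1_measurable by (auto simp: per_fun_def)
  fix \<alpha> \<beta> assume "\<alpha> \<in> per_fun 0 (2*pi)" "\<beta> \<in> per_fun (-1/2) (1/2)"
  then show "(\<integral>x. \<alpha> (fst x) * \<beta> (snd x) * f x \<partial>Q) = 0"
    using z[of \<alpha> \<beta>] z[of \<beta> \<alpha>] by (cases "i = e_z") (auto simp: dir_defs mult.commute)
qed

lemma nn_integral_across_coord:
  assumes [measurable]: "a \<in> borel_measurable borel"
  shows "(\<integral>\<^sup>+x. a (across_coord i x) \<partial>Q) = ennreal (hi i - lo i) * (\<integral>\<^sup>+s. a s \<partial>across i)"
proof (cases "i = e_z")
  case True
  have "(\<integral>\<^sup>+x. a (fst x) \<partial>Q) = (\<integral>\<^sup>+s. \<integral>\<^sup>+t. a (fst (s, t)) \<partial>seg (-1/2) (1/2) \<partial>seg 0 (2*pi))"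
    unfolding Q_def by (rule QP.M2.nn_integral_fst[symmetric]) simp
  then show ?thesis using True emeasure_seg[of "-1/2" "1/2"] by (simp add: dir_defs)
next
  case False
  have "(\<integral>\<^sup>+x. a (snd x) \<partial>Q) = (\<integral>\<^sup>+t. \<integral>\<^sup>+s. a (snd (s, t)) \<partial>seg 0 (2*pi) \<partial>seg (-1/2) (1/2))"
    unfolding Q_def by (rule QP.nn_integral_snd[symmetric]) simp
  then show ?thesis using False emeasure_seg[of 0 "2*pi"] by (simp add: dir_defs nn_integral_multc) (simp add: mult.commute)
qed

lemma integrable_across_coord:
  fixes a :: "real \<Rightarrow> real"
  assumes "integrable (across i) a" shows "integrable Q (\<lambda>x. a (across_coord i x))"
proof -
  have [measurable]: "a \<in> borel_measurable borel" using borel_measurable_integrable[OF assms] by simp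
  show ?thesis using assms nn_integral_across_coord[of "\<lambda>s. ennreal (norm (a s))" i]
    by (auto simp: integrable_iff_bounded ennreal_mult_less_top)
qed

lemma primitive_exists:
  fixes f :: "real \<Rightarrow> real" assumes f: "continuous_on UNIV f"
  shows "\<exists>B. B c = 0 \<and> (\<forall>x. (B has_real_derivative f x) (at x))"
proof -
  define B :: "real \<Rightarrow> real" where "B x = (LBINT y=c..x. f y)" for x
  have "(B has_real_derivative f x) (at x)" for x
  proof -
    define a b where "a = min c x - 1" and "b = max c x + 1"
    have "((\<lambda>u. LBINT y=c..u. f y) has_vector_derivative f x) (at x within {a..b})"
      by (rule interval_integral_FTC2) (auto simp: a_def b_def intro!: continuous_on_subset[OF f])
    then have "((\<lambda>u. LBINT y=c..u. f y) has_vector_derivative f x) (at x)"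
      by (subst (asm) at_within_interior) (auto simp: a_def b_def interior_atLeastAtMost_real)
    then show ?thesis by (simp add: has_real_derivative_iff_has_vector_derivative B_def[abs_def])
  qed
  moreover have "B c = 0" by (simp add: B_def)
  ultimately show ?thesis by (intro exI[of _ B]) simp
qed

text \<open>The vanishing mean makes the primitive periodic, hence again a test function.\<close>

lemma per_fun_primitive:
  assumes b: "\<beta> \<in> per_fun c d" and cd: "c < d" and z: "integral {c..d} \<beta> = 0"
  shows "\<exists>B\<in>per_fun c d. B c = 0 \<and> B d = 0 \<and> (\<forall>x. (B has_real_derivative \<beta> x) (at x))"
proof -
  have ck: "Ck k \<beta>" and per: "\<beta> (x + (d - c)) = \<beta> x" for k x using b by (auto simp: per_fun_def smooth1_def)
  have cont: "continuous_on UNIV \<beta>" using ck[of 0] by simp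
  obtain B where B: "B c = 0" "\<And>x. (B has_real_derivative \<beta> x) (at x)" using primitive_exists[OF cont] by blast
  have "AC_on c d B \<beta>" by (rule AC_on_C1) (auto intro!: DERIV_subset[OF B(2)] continuous_on_subset[OF cont])
  then have Bd: "B d = 0" using AC_on_diff[of c d B \<beta> c d] cd z B(1) by simp
  have "((\<lambda>x. B (x + (d - c)) - B x) has_real_derivative 0) (at x)" for x
    using DERIV_diff[OF DERIV_shift[THEN iffD1, OF B(2)[of "x + (d-c)"]] B(2)[of x]] per[of x] by simp
  then have "B (x + (d - c)) - B x = B (c + (d - c)) - B c" for x
    by (intro DERIV_isconst_all) simp
  then have pB: "B (x + (d - c)) = B x" for x using B(1) Bd by simp
  have "Ck k B" for k
  proof (cases k)
    case 0 then show ?thesis using DERIV_isCont[OF B(2)] by (simp add: continuous_at_imp_continuous_on)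
  next
    case (Suc n) then show ?thesis using B(2) ck[of n] unfolding Suc Ck.simps by (intro exI[of _ \<beta>] conjI allI)
  qed
  then show ?thesis using B Bd pB by (auto simp: per_fun_def smooth1_def intro!: bexI[of _ B])
qed

lemma per_fun_diff_const: "\<beta> \<in> per_fun c d \<Longrightarrow> (\<lambda>t. \<beta> t - k) \<in> per_fun c d"
  using Ck_add[OF _ Ck_const[of _ "-k"]] by (auto simp: per_fun_def smooth1_def)

lemma per_fun_const: "(\<lambda>t. k) \<in> per_fun c d" by (simp add: per_fun_def smooth1_def Ck_const)

lemma continuous_coords: "continuous_on UNIV \<alpha> \<Longrightarrow> continuous_on UNIV (\<lambda>x. \<alpha> (across_coord i x))"
  "continuous_on UNIV \<alpha> \<Longrightarrow> continuous_on UNIV (\<lambda>x. \<alpha> (line_coord i x))"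
  unfolding across_coord_def line_coord_def by (cases "i = e_z"; auto intro!: continuous_intros continuous_on_compose2[of UNIV \<alpha>])+

text \<open>Testing with functions that do not depend on the coordinate along the line shows that \<open>g\<close> has mean zero on
  almost every line. Let \<open>G\<close> be the primitive of \<open>g\<close> along lines. The remainder \<open>R = u - G\<close> is
  orthogonal to every derivative in direction \<open>i\<close> of a product test function, that is, to
  \<open>\<alpha> (\<beta> - mean of \<beta>)\<close>; hence \<open>R\<close> equals its mean \<open>N\<close> along the lines, and \<open>N + G\<close> is the desired
  representative of \<open>u\<close>.\<close>

lemma per_weak_imp_lines:
  assumes um[measurable]: "u \<in> borel_measurable borel" and gm[measurable]: "g \<in> borel_measurable borel"
    and w: "has_weak_deriv per_test_fun i u g" and i: "i \<in> Basis"
  shows "WD i u g" "zero_mean i g"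
proof -
  have u: "integrable Q u" and g: "integrable Q g"
    using w by (auto simp: has_weak_deriv_def integrable_Q_leb)
  define L where "L = hi i - lo i"
  have L: "L > 0" by (simp add: L_def)
  let ?TA = "per_fun (across_lo i) (across_hi i)" and ?TB = "per_fun (lo i) (hi i)"
  have cpf: "continuous_on UNIV \<alpha>" if "\<alpha> \<in> per_fun c d" for \<alpha> c d
    using that Ck.simps(1)[of \<alpha>] unfolding per_fun_def smooth1_def by blast
  have mpf: "\<alpha> \<in> borel_measurable borel" if "\<alpha> \<in> per_fun c d" for \<alpha> c d
    using cpf[OF that] by (rule borel_measurable_continuous_onI)
  have weak: "(\<integral>x. \<alpha> (across_coord i x) * \<beta>' (line_coord i x) * u x \<partial>Q) = - (\<integral>x. \<alpha> (across_coord i x) * \<beta> (line_coord i x) * g x \<partial>Q)"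
    if a: "\<alpha> \<in> ?TA" and b: "\<beta> \<in> ?TB" and d: "\<And>t. (\<beta> has_real_derivative \<beta>' t) (at t)" and cb: "continuous_on UNIV \<beta>'" for \<alpha> \<beta> \<beta>'
  proof -
    note t = tensor_in_direction[OF i a b d]
    have [measurable]: "\<alpha> \<in> borel_measurable borel" "\<beta> \<in> borel_measurable borel" "\<beta>' \<in> borel_measurable borel"
      using a b cb mpf borel_measurable_continuous_onI by blast+
    have "(\<integral>x. (\<alpha> (across_coord i x) * \<beta>' (line_coord i x)) * u x \<partial>leb_Omega) = - (\<integral>x. (\<alpha> (across_coord i x) * \<beta> (line_coord i x)) * g x \<partial>leb_Omega)"
      using w[unfolded has_weak_deriv_def, THEN conjunct2, THEN conjunct2, rule_format, OF t(1)] unfolding t(2) by simp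
    then show ?thesis by (simp add: integral_Q_leb)
  qed
  have lines_prod: "(\<integral>x. \<alpha> (across_coord i x) * \<beta> (line_coord i x) * c (across_coord i x) \<partial>Q) = (\<integral>t. \<beta> t \<partial>line i) * (\<integral>s. \<alpha> s * c s \<partial>across i)"
    if a: "\<alpha> \<in> ?TA" and b: "\<beta> \<in> ?TB" and c: "integrable (across i) c" for \<alpha> \<beta> c
  proof -
    have "integrable Q (\<lambda>x. (\<alpha> (across_coord i x) * \<beta> (line_coord i x)) * c (across_coord i x))"
      by (intro integrable_mult_continuous integrable_across_coord c continuous_on_mult continuous_coords cpf[OF a] cpf[OF b])
    from integral_lines[OF this, of i, symmetric]
    have "(\<integral>x. \<alpha> (across_coord i x) * \<beta> (line_coord i x) * c (across_coord i x) \<partial>Q) = (\<integral>s. \<integral>t. \<beta> t * (\<alpha> s * c s) \<partial>line i \<partial>across i)"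
      by (simp add: mult_ac del: integral_mult_left_zero integral_mult_right_zero)
    then show ?thesis by simp
  qed
  have lines_int: "(\<integral>x. \<alpha> (across_coord i x) * f x \<partial>Q) = (\<integral>s. \<alpha> s * (\<integral>t. f (pt i s t) \<partial>line i) \<partial>across i)"
    if a: "\<alpha> \<in> ?TA" and f: "integrable Q f" for \<alpha> f
  proof -
    have "integrable Q (\<lambda>x. \<alpha> (across_coord i x) * f x)"
      by (intro integrable_mult_continuous f continuous_coords cpf[OF a])
    from integral_lines[OF this, of i, symmetric] show ?thesis by simp
  qed
  define \<gamma> where "\<gamma> s = (\<integral>t. g (pt i s t) \<partial>line i)" for s
  have \<gamma>: "integrable (across i) \<gamma>" unfolding \<gamma>_def using integrable_lines[OF g] .
  have "AE x in Q. \<gamma> (across_coord i x) = 0"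
  proof (rule fundamental_lemma_dir[OF integrable_across_coord[OF \<gamma>]])
    fix \<alpha> \<beta> assume a: "\<alpha> \<in> ?TA" and b: "\<beta> \<in> ?TB"
    have "(\<integral>x. \<alpha> (across_coord i x) * g x \<partial>Q) = 0"
      using weak[OF a per_fun_const[of 1], of "\<lambda>x. 0"] by (simp add: DERIV_const)
    then have "(\<integral>s. \<alpha> s * \<gamma> s \<partial>across i) = 0" using lines_int[OF a g] by (simp add: \<gamma>_def)
    then show "(\<integral>x. \<alpha> (across_coord i x) * \<beta> (line_coord i x) * \<gamma> (across_coord i x) \<partial>Q) = 0" using lines_prod[OF a b \<gamma>] by simp
  qed
  then have "AE s in across i. AE t in line i. \<gamma> s = 0" using AE_lines[of "\<lambda>x. \<gamma> (across_coord i x) = 0" i] by simp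
  then show zm: "zero_mean i g" by (simp add: zero_mean_def AE_line_const \<gamma>_def)

  interpret LM: finite_measure "line i" by (rule finite_measure_line)
  \<comment> \<open>The primitive is written as an integral with respect to a fixed measure, so that it is jointly measurable.\<close>
  define G where "G x = (\<integral>\<tau>. indicator {\<tau>. lo i \<le> \<tau> \<and> \<tau> \<le> line_coord i x} \<tau> * g (pt i (across_coord i x) \<tau>) \<partial>line i)" for x
  have gp: "(\<lambda>(x, \<tau>). g (pt i (across_coord i x) \<tau>)) \<in> borel_measurable (borel \<Otimes>\<^sub>M line i)"
  proof -
    have A: "(\<lambda>y. (across_coord i (fst y), snd y)) \<in> borel \<Otimes>\<^sub>M line i \<rightarrow>\<^sub>M borel \<Otimes>\<^sub>M borel"
    proof (rule measurable_Pair)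
      show "(\<lambda>y. across_coord i (fst y)) \<in> borel \<Otimes>\<^sub>M line i \<rightarrow>\<^sub>M borel"
        by (rule measurable_compose[OF measurable_fst coords_measurable(1)])
      show "snd \<in> borel \<Otimes>\<^sub>M line i \<rightarrow>\<^sub>M borel"
        by (subst measurable_cong_sets[OF refl sets_line(1)[symmetric, of i]]) (rule measurable_snd)
    qed
    have B: "(\<lambda>y. g (pt i (fst y) (snd y))) \<in> borel_measurable (borel \<Otimes>\<^sub>M borel)"
      unfolding borel_prod by (rule measurable_compose[OF pt_measurable(1) gm])
    from measurable_comp[OF A B] show ?thesis by (simp add: comp_def case_prod_unfold)
  qed
  have [measurable]: "G \<in> borel_measurable borel"
    unfolding G_def
    by (rule LM.borel_measurable_lebesgue_integral) (use gp in \<open>simp add: case_prod_unfold\<close>)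
  define \<gamma>' where "\<gamma>' s = (\<integral>t. \<bar>g (pt i s t)\<bar> \<partial>line i)" for s
  have \<gamma>': "integrable (across i) \<gamma>'" unfolding \<gamma>'_def using integrable_lines[of "\<lambda>x. \<bar>g x\<bar>"] g by simp
  have G_le: "AE s in across i. \<forall>t. \<bar>G (pt i s t)\<bar> \<le> \<gamma>' s"
    using AE_integrable_lines[OF g, of i]
  proof eventually_elim
    case (elim s)
    show ?case
    proof
      fix t
      have "\<bar>G (pt i s t)\<bar> \<le> (\<integral>\<tau>. \<bar>indicator {\<tau>. lo i \<le> \<tau> \<and> \<tau> \<le> t} \<tau> * g (pt i s \<tau>)\<bar> \<partial>line i)"
        unfolding G_def pt_coords by (rule integral_abs_bound)
      also have "\<dots> \<le> \<gamma>' s" unfolding \<gamma>'_def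
      proof (rule integral_mono)
        show "integrable (line i) (\<lambda>\<tau>. \<bar>indicator {\<tau>. lo i \<le> \<tau> \<and> \<tau> \<le> t} \<tau> * g (pt i s \<tau>)\<bar>)"
          by (rule Bochner_Integration.integrable_bound[OF elim]) (auto simp: indicator_def)
      qed (use elim in \<open>auto simp: indicator_def\<close>)
      finally show "\<bar>G (pt i s t)\<bar> \<le> \<gamma>' s" .
    qed
  qed
  have G: "integrable Q G"
  proof (rule Bochner_Integration.integrable_bound[OF integrable_across_coord[OF \<gamma>']])
    have "\<gamma>' \<in> borel_measurable borel" using borel_measurable_integrable[OF \<gamma>'] by simp
    then have [measurable]: "(\<lambda>x. \<gamma>' (across_coord i x)) \<in> borel_measurable borel" by simp
    show "AE x in Q. norm (G x) \<le> norm (\<gamma>' (across_coord i x))"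
    proof (rule AE_lines_conv[where i=i])
      show "AE s in across i. AE t in line i. norm (G (pt i s t)) \<le> norm (\<gamma>' (across_coord i (pt i s t)))"
        using G_le
      proof eventually_elim
        case (elim s)
        then show ?case by (intro AE_I2) (auto intro: order_trans[OF _ abs_ge_self])
      qed
    qed measurable
  qed simp
  have G_AC: "AE s in across i. AC_on (lo i) (hi i) (\<lambda>t. G (pt i s t)) (\<lambda>t. g (pt i s t))"
    using AE_integrable_lines[OF g, of i]
  proof eventually_elim
    case (elim s)
    have ab: "(\<lambda>t. g (pt i s t)) absolutely_integrable_on {lo i..hi i}"
      using elim unfolding line_def by (subst (asm) integrable_seg) auto
    have "G (pt i s t) = integral {lo i..t} (\<lambda>t. g (pt i s t))" if t: "t \<in> {lo i..hi i}" for t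
    proof -
      have ind: "integrable (line i) (\<lambda>\<tau>. indicator {\<tau>. lo i \<le> \<tau> \<and> \<tau> \<le> t} \<tau> * g (pt i s \<tau>))"
        by (rule Bochner_Integration.integrable_bound[OF elim]) (auto simp: indicator_def)
      have "G (pt i s t) = integral {lo i..hi i} (\<lambda>\<tau>. indicator {\<tau>. lo i \<le> \<tau> \<and> \<tau> \<le> t} \<tau> * g (pt i s \<tau>))"
        using ind unfolding G_def pt_coords line_def by (intro integral_seg) auto
      also have "\<dots> = integral {lo i..hi i} (\<lambda>\<tau>. if \<tau> \<in> {lo i..t} then g (pt i s \<tau>) else 0)"
        by (rule integral_cong) (auto simp: indicator_def)
      also have "\<dots> = integral {lo i..t} (\<lambda>t. g (pt i s t))"
        using t unfolding Henstock_Kurzweil_Integration.integral_restrict_Int by (intro arg_cong2[where f=integral]) auto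
      finally show ?thesis .
    qed
    then show ?case using ab unfolding AC_on_def by simp
  qed
  have WG: "WD i G g"
    unfolding WD_def using G_AC g by (auto elim!: eventually_mono)
  define R where "R x = u x - G x" for x
  have R: "integrable Q R" unfolding R_def using u G by auto
  define N where "N s = (\<integral>t. R (pt i s t) \<partial>line i) / L" for s
  have N: "integrable (across i) N" unfolding N_def using integrable_lines[OF R, of i] by simp
  have "AE x in Q. R x - N (across_coord i x) = 0"
  proof (rule fundamental_lemma_dir)
    show "integrable Q (\<lambda>x. R x - N (across_coord i x))" using R integrable_across_coord[OF N] by simp
    fix \<alpha> \<beta> assume a: "\<alpha> \<in> ?TA" and b: "\<beta> \<in> ?TB"
    \<comment> \<open>Only \<open>\<beta> - m\<close>, with \<open>m\<close> the mean of \<open>\<beta>\<close>, is the derivative of a periodic function.\<close>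
    define m where "m = (\<integral>t. \<beta> t \<partial>line i) / L"
    have \<beta>i: "\<beta> integrable_on {lo i..hi i}" by (intro integrable_continuous_real continuous_on_subset[OF cpf[OF b]]) auto
    have \<beta>ai: "integrable (line i) \<beta>"
      unfolding line_def by (subst integrable_seg) (auto intro!: mpf[OF b] absolutely_integrable_continuous_real continuous_on_subset[OF cpf[OF b]])
    have "integral {lo i..hi i} (\<lambda>t. \<beta> t - m) = integral {lo i..hi i} \<beta> - m * L"
      using integral_diff[OF \<beta>i integrable_const_ivl[of m]] by (simp add: L_def mult.commute)
    also have "integral {lo i..hi i} \<beta> = (\<integral>t. \<beta> t \<partial>line i)"
      using \<beta>ai unfolding line_def by (intro integral_seg[symmetric] mpf[OF b])
    finally have "integral {lo i..hi i} (\<lambda>t. \<beta> t - m) = 0" using L by (simp add: m_def)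
    from per_fun_primitive[OF per_fun_diff_const[OF b] lo_hi(1) this]
    obtain B where B: "B \<in> ?TB" "B (lo i) = 0" "B (hi i) = 0" "\<And>x. (B has_real_derivative \<beta> x - m) (at x)" by blast
    have cb: "continuous_on UNIV (\<lambda>t. \<beta> t - m)" by (intro continuous_intros cpf[OF b])
    have 1: "(\<integral>x. \<alpha> (across_coord i x) * (\<beta> (line_coord i x) - m) * u x \<partial>Q) = - (\<integral>x. \<alpha> (across_coord i x) * B (line_coord i x) * g x \<partial>Q)"
      by (rule weak[OF a B(1,4) cb])
    have 2: "(\<integral>x. \<alpha> (across_coord i x) * (\<beta> (line_coord i x) - m) * G x \<partial>Q) = - (\<integral>x. \<alpha> (across_coord i x) * B (line_coord i x) * g x \<partial>Q)"
    proof (rule WD_by_parts[OF WG G])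
      show "continuous_on UNIV (\<lambda>x. \<alpha> (across_coord i x) * B (line_coord i x))" "continuous_on UNIV (\<lambda>x. \<alpha> (across_coord i x) * (\<beta> (line_coord i x) - m))"
        by (intro continuous_on_mult continuous_coords cpf[OF a] cpf[OF B(1)] continuous_on_diff continuous_on_const cpf[OF b])+
      show "((\<lambda>t. \<alpha> (across_coord i (pt i s t)) * B (line_coord i (pt i s t))) has_real_derivative \<alpha> (across_coord i (pt i s t)) * (\<beta> (line_coord i (pt i s t)) - m)) (at t)" for s t
        by (auto intro!: DERIV_cmult B(4))
    qed (simp add: B)
    have i1: "integrable Q (\<lambda>x. (\<alpha> (across_coord i x) * (\<beta> (line_coord i x) - m)) * f x)" "integrable Q (\<lambda>x. (\<alpha> (across_coord i x) * \<beta> (line_coord i x)) * f x)" 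
      "integrable Q (\<lambda>x. \<alpha> (across_coord i x) * f x)" if "integrable Q f" for f
      by (intro integrable_mult_continuous that continuous_on_mult continuous_coords cpf[OF a] continuous_on_diff continuous_on_const cpf[OF b])+
    have "0 = (\<integral>x. \<alpha> (across_coord i x) * (\<beta> (line_coord i x) - m) * R x \<partial>Q)"
      unfolding R_def right_diff_distrib[where b="u _"] using 1 2 i1(1)[OF u] i1(1)[OF G] by simp
    also have "\<dots> = (\<integral>x. \<alpha> (across_coord i x) * \<beta> (line_coord i x) * R x - m * (\<alpha> (across_coord i x) * R x) \<partial>Q)"
      by (simp add: algebra_simps)
    also have "\<dots> = (\<integral>x. \<alpha> (across_coord i x) * \<beta> (line_coord i x) * R x \<partial>Q) - m * (\<integral>x. \<alpha> (across_coord i x) * R x \<partial>Q)"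
      using i1(2,3)[OF R] by simp
    also have "m * (\<integral>x. \<alpha> (across_coord i x) * R x \<partial>Q) = (\<integral>x. \<alpha> (across_coord i x) * \<beta> (line_coord i x) * N (across_coord i x) \<partial>Q)"
    proof -
      have "(\<integral>x. \<alpha> (across_coord i x) * R x \<partial>Q) = L * (\<integral>s. \<alpha> s * N s \<partial>across i)"
        unfolding lines_int[OF a R] N_def using L by simp
      then show ?thesis unfolding lines_prod[OF a b N] m_def using L by simp
    qed
    finally show "(\<integral>x. \<alpha> (across_coord i x) * \<beta> (line_coord i x) * (R x - N (across_coord i x)) \<partial>Q) = 0"
      unfolding right_diff_distrib[where b="R _"] using i1(2)[OF R] i1(2)[OF integrable_across_coord[OF N]] by simp
  qed
  from AE_lines[OF this, of i] have "AE s in across i. AE t in line i. u (pt i s t) = N s + G (pt i s t)"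
    by (simp add: R_def algebra_simps)
  with G_AC have "AE s in across i. \<exists>F. AC_on (lo i) (hi i) F (\<lambda>t. g (pt i s t)) \<and> (AE t in line i. u (pt i s t) = F t)"
  proof eventually_elim
    case (elim s)
    from AC_on_add[OF AC_on_const elim(1)] elim(2) show ?case by (intro exI[of _ "\<lambda>t. N s + G (pt i s t)"]) simp
  qed
  then show "WD i u g" unfolding WD_def using g by simp
qed

section \<open>Calculus of derivatives on lines\<close>

lemma AC_on_cong_AE:
  assumes A: "AC_on c d F f" and e: "AE t in seg c d. g t = f t"
  shows "AC_on c d F g"
proof -
  have "AE t in lebesgue. t \<in> {c..d} \<longrightarrow> g t = f t" using e unfolding AE_seg by (rule AE_completion)
  then obtain N where N: "negligible N" "{t. \<not> (t \<in> {c..d} \<longrightarrow> g t = f t)} \<subseteq> N"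
    unfolding eventually_ae_filter_negligible by auto
  have "g absolutely_integrable_on {c..d}"
    by (rule absolutely_integrable_spike[OF AC_on_abs_int[OF A order_refl order_refl] N(1)]) (use N(2) in auto)
  moreover have "integral {c..x} f = integral {c..x} g" if "x \<in> {c..d}" for x
    by (rule integral_spike[OF N(1)]) (use N(2) that in auto)
  ultimately show ?thesis using A unfolding AC_on_def by metis
qed

lemma WD_measurable[measurable_dest]: "WD i u g \<Longrightarrow> u \<in> borel_measurable borel" "WD i u g \<Longrightarrow> g \<in> borel_measurable borel"
  by (auto simp: WD_def)

lemma WD_lines: "WD i u g \<Longrightarrow>
  (AE s in across i. \<exists>F. AC_on (lo i) (hi i) F (\<lambda>t. g (pt i s t)) \<and> (AE t in line i. u (pt i s t) = F t))"
  by (simp add: WD_def)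

lemma WD_add: assumes "WD i u g" "WD i v k" shows "WD i (\<lambda>x. u x + v x) (\<lambda>x. g x + k x)"
  unfolding WD_def
proof (intro conjI)
  show "(\<lambda>x. u x + v x) \<in> borel_measurable borel" "(\<lambda>x. g x + k x) \<in> borel_measurable borel"
    using assms by (auto simp: WD_def)
  show "integrable Q (\<lambda>x. g x + k x)" using assms by (auto simp: WD_def)
  show "AE s in across i. \<exists>F. AC_on (lo i) (hi i) F (\<lambda>t. g (pt i s t) + k (pt i s t)) \<and>
        (AE t in line i. u (pt i s t) + v (pt i s t) = F t)"
    using WD_lines[OF assms(1)] WD_lines[OF assms(2)]
  proof eventually_elim
    case (elim s)
    then obtain F G where F: "AC_on (lo i) (hi i) F (\<lambda>t. g (pt i s t))" "AE t in line i. u (pt i s t) = F t"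
      and G: "AC_on (lo i) (hi i) G (\<lambda>t. k (pt i s t))" "AE t in line i. v (pt i s t) = G t" by blast
    show ?case using AC_on_add[OF F(1) G(1)] F(2) G(2) by (intro exI[of _ "\<lambda>t. F t + G t"]) auto
  qed
qed

lemma WD_mult: assumes "WD i u g" "WD i v k" and int: "integrable Q (\<lambda>x. v x * g x + u x * k x)"
  shows "WD i (\<lambda>x. u x * v x) (\<lambda>x. v x * g x + u x * k x)"
  unfolding WD_def
proof (intro conjI)
  show "(\<lambda>x. u x * v x) \<in> borel_measurable borel" "(\<lambda>x. v x * g x + u x * k x) \<in> borel_measurable borel"
    using assms by (auto simp: WD_def)
  show "integrable Q (\<lambda>x. v x * g x + u x * k x)" by (rule int)
  show "AE s in across i. \<exists>F. AC_on (lo i) (hi i) F (\<lambda>t. v (pt i s t) * g (pt i s t) + u (pt i s t) * k (pt i s t)) \<and>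
        (AE t in line i. u (pt i s t) * v (pt i s t) = F t)"
    using WD_lines[OF assms(1)] WD_lines[OF assms(2)]
  proof eventually_elim
    case (elim s)
    then obtain F G where F: "AC_on (lo i) (hi i) F (\<lambda>t. g (pt i s t))" "AE t in line i. u (pt i s t) = F t"
      and G: "AC_on (lo i) (hi i) G (\<lambda>t. k (pt i s t))" "AE t in line i. v (pt i s t) = G t" by blast
    have "AE t in seg (lo i) (hi i). v (pt i s t) * g (pt i s t) + u (pt i s t) * k (pt i s t) = G t * g (pt i s t) + F t * k (pt i s t)"
      using F(2)[unfolded line_def] G(2)[unfolded line_def] by eventually_elim simp
    from AC_on_cong_AE[OF AC_on_mult[OF F(1) G(1)] this]
    show ?case using F(2) G(2) by (intro exI[of _ "\<lambda>t. F t * G t"]) auto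
  qed
qed

text \<open>The chain rule for absolutely continuous functions is a hypothesis, so that the lemma covers any
  \<open>\<phi>\<close> for which it is known; it is used for sine and cosine.\<close>

lemma WD_compose:
  assumes W: "WD i u g"
    and AC: "\<And>c d F f. AC_on c d F f \<Longrightarrow> AC_on c d (\<lambda>x. \<phi> (F x)) (\<lambda>x. \<phi>' (F x) * f x)"
    and c: "continuous_on UNIV \<phi>" "continuous_on UNIV \<phi>'" and b: "\<And>x. \<bar>\<phi>' x\<bar> \<le> 1"
  shows "WD i (\<lambda>x. \<phi> (u x)) (\<lambda>x. \<phi>' (u x) * g x)"
  unfolding WD_def
proof (intro conjI)
  have [measurable]: "\<phi> \<in> borel_measurable borel" "\<phi>' \<in> borel_measurable borel" 
    by (rule borel_measurable_continuous_onI[OF c(1)] borel_measurable_continuous_onI[OF c(2)])+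
  have [measurable]: "u \<in> borel_measurable borel" "g \<in> borel_measurable borel" and g: "integrable Q g"
    using W by (auto simp: WD_def)
  show "(\<lambda>x. \<phi> (u x)) \<in> borel_measurable borel" "(\<lambda>x. \<phi>' (u x) * g x) \<in> borel_measurable borel" by measurable
  show "integrable Q (\<lambda>x. \<phi>' (u x) * g x)"
    by (rule Bochner_Integration.integrable_bound[OF g]) (auto simp: abs_mult intro!: mult_left_le_one_le b)
  show "AE s in across i. \<exists>F. AC_on (lo i) (hi i) F (\<lambda>t. \<phi>' (u (pt i s t)) * g (pt i s t)) \<and>
        (AE t in line i. \<phi> (u (pt i s t)) = F t)"
    using WD_lines[OF W]
  proof eventually_elim
    case (elim s)
    then obtain F where F: "AC_on (lo i) (hi i) F (\<lambda>t. g (pt i s t))" "AE t in line i. u (pt i s t) = F t" by blast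
    have "AE t in seg (lo i) (hi i). \<phi>' (u (pt i s t)) * g (pt i s t) = \<phi>' (F t) * g (pt i s t)"
      using F(2)[unfolded line_def] by eventually_elim simp
    from AC_on_cong_AE[OF AC[OF F(1)] this]
    show ?case using F(2) by (intro exI[of _ "\<lambda>t. \<phi> (F t)"]) auto
  qed
qed

lemma WD_cos: "WD i u g \<Longrightarrow> WD i (\<lambda>x. cos (u x)) (\<lambda>x. - sin (u x) * g x)"
  by (rule WD_compose[where \<phi>'="\<lambda>x. - sin x", OF _ AC_on_cos]) (auto intro!: continuous_intros)

lemma WD_sin: "WD i u g \<Longrightarrow> WD i (\<lambda>x. sin (u x)) (\<lambda>x. cos (u x) * g x)"
  by (rule WD_compose) (auto intro!: AC_on_sin continuous_intros)

lemma WD_C1: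
  assumes c: "continuous_on UNIV u" "continuous_on UNIV g"
    and d: "\<And>s t. ((\<lambda>t. u (pt i s t)) has_real_derivative g (pt i s t)) (at t)"
  shows "WD i u g"
  unfolding WD_def
proof (intro conjI AE_I2)
  show [measurable]: "u \<in> borel_measurable borel" "g \<in> borel_measurable borel"
    by (rule borel_measurable_continuous_onI[OF c(1)] borel_measurable_continuous_onI[OF c(2)])+
  show "integrable Q g" using integrable_mult_continuous[OF Qf.integrable_const c(2), of 1] by simp
  fix s
  have "AC_on (lo i) (hi i) (\<lambda>t. u (pt i s t)) (\<lambda>t. g (pt i s t))"
    by (rule AC_on_C1) (auto intro!: continuous_pt c DERIV_subset[OF d])
  then show "\<exists>F. AC_on (lo i) (hi i) F (\<lambda>t. g (pt i s t)) \<and> (AE t in line i. u (pt i s t) = F t)" by auto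
qed

definition square_integrable :: "(real \<times> real \<Rightarrow> real) \<Rightarrow> bool" where
  "square_integrable u \<longleftrightarrow> u \<in> borel_measurable borel \<and> integrable Q (\<lambda>x. (u x)\<^sup>2)"

lemma sq_measurable[measurable_dest]: "square_integrable u \<Longrightarrow> u \<in> borel_measurable borel" by (simp add: square_integrable_def)

text \<open>Each term in the derivatives of the Cartesian map contains at most two factors that are merely square
  integrable; the remaining factors are bounded.\<close>

lemma integrable_mult3:
  assumes a: "square_integrable a" and b: "square_integrable b" and c[measurable]: "c \<in> borel_measurable borel" and k: "AE x in Q. \<bar>c x\<bar> \<le> K"
  shows "integrable Q (\<lambda>x. a x * b x * c x)"
proof (rule Bochner_Integration.integrable_bound[where f="\<lambda>x. K * ((a x)\<^sup>2 + (b x)\<^sup>2)"])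
  show "integrable Q (\<lambda>x. K * ((a x)\<^sup>2 + (b x)\<^sup>2))" using a b by (auto simp: square_integrable_def)
  show "(\<lambda>x. a x * b x * c x) \<in> borel_measurable Q" using a b by (auto simp: square_integrable_def)
  show "AE x in Q. norm (a x * b x * c x) \<le> norm (K * ((a x)\<^sup>2 + (b x)\<^sup>2))"
    using k
  proof eventually_elim
    case (elim x)
    have "\<bar>a x * b x\<bar> \<le> (a x)\<^sup>2 + (b x)\<^sup>2"
      using sum_squares_bound[of "\<bar>a x\<bar>" "\<bar>b x\<bar>"] mult_nonneg_nonneg[of "\<bar>a x\<bar>" "\<bar>b x\<bar>"]
      unfolding abs_mult power2_abs mult.assoc by linarith
    then have "\<bar>c x\<bar> * \<bar>a x * b x\<bar> \<le> K * ((a x)\<^sup>2 + (b x)\<^sup>2)" using elim by (intro mult_mono) auto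
    moreover have "K \<ge> 0" using order_trans[OF abs_ge_zero elim] .
    ultimately show ?case by (simp add: abs_mult mult_ac)
  qed
qed

lemma sq_const: "square_integrable (\<lambda>x. k)" by (simp add: square_integrable_def)

lemma integrable_sq: assumes "square_integrable a" shows "integrable Q a"
  using integrable_mult3[OF assms sq_const[of 1], of "\<lambda>x. 1" 1] by simp

lemma sq_bounded: 
  assumes [measurable]: "a \<in> borel_measurable borel" and b: "AE x in Q. \<bar>a x\<bar> \<le> K"
  shows "square_integrable a"
  unfolding square_integrable_def
proof
  have "AE x in Q. norm ((a x)\<^sup>2) \<le> K\<^sup>2"
    using b
  proof eventually_elim
    case (elim x)
    show ?case using power_mono[OF elim abs_ge_zero, of 2] by simp
  qed
  then show "integrable Q (\<lambda>x. (a x)\<^sup>2)" by (rule Qf.integrable_const_bound) measurable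
qed simp

lemma sq_add: assumes "square_integrable a" "square_integrable b" shows "square_integrable (\<lambda>x. a x + b x)"
proof -
  have [measurable]: "a \<in> borel_measurable borel" "b \<in> borel_measurable borel" using assms by (auto simp: square_integrable_def)
  have "integrable Q (\<lambda>x. 2 * (a x)\<^sup>2 + 2 * (b x)\<^sup>2)" using assms by (auto simp: square_integrable_def)
  then have "integrable Q (\<lambda>x. (a x + b x)\<^sup>2)"
  proof (rule Bochner_Integration.integrable_bound)
    show "AE x in Q. norm ((a x + b x)\<^sup>2) \<le> norm (2 * (a x)\<^sup>2 + 2 * (b x)\<^sup>2)"
    proof (rule AE_I2)
      fix x
      show "norm ((a x + b x)\<^sup>2) \<le> norm (2 * (a x)\<^sup>2 + 2 * (b x)\<^sup>2)"
        using zero_le_power2[of "a x - b x"] by (simp add: power2_sum power2_diff abs_of_nonneg[OF zero_le_power2, of "a x + b x", unfolded power2_sum])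
    qed
  qed measurable
  then show ?thesis by (simp add: square_integrable_def)
qed

text \<open>Two derivatives in the sense of lines, all of them square integrable: \<open>g i\<close> is the derivative in
  direction \<open>i\<close>, and \<open>h i j\<close> is the derivative of \<open>g i\<close> in direction \<open>j\<close>.\<close>

definition twice_diff :: "(real \<times> real \<Rightarrow> real) \<Rightarrow> (real \<times> real \<Rightarrow> real \<times> real \<Rightarrow> real) \<Rightarrow>
    (real \<times> real \<Rightarrow> real \<times> real \<Rightarrow> real \<times> real \<Rightarrow> real) \<Rightarrow> bool" where
  "twice_diff u g h \<longleftrightarrow> square_integrable u \<and> (\<forall>i\<in>Basis. square_integrable (g i) \<and> WD i u (g i) \<and> (\<forall>j\<in>Basis. square_integrable (h i j) \<and> WD j (g i) (h i j)))"

section \<open>The energy in cylindrical components\<close>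

lemma integrable_Pair_integral:
  fixes f :: "_ \<Rightarrow> 'a::euclidean_space" and g :: "_ \<Rightarrow> 'b::euclidean_space"
  assumes "integrable M f" "integrable M g"
  shows "integrable M (\<lambda>x. (f x, g x))" "(\<integral>x. (f x, g x) \<partial>M) = (\<integral>x. f x \<partial>M, \<integral>x. g x \<partial>M)"
proof -
  have bl: "bounded_linear (\<lambda>a::'a. (a, 0::'b))" "bounded_linear (\<lambda>b::'b. (0::'a, b))"
    by (auto intro: bounded_linear_Pair bounded_linear_ident bounded_linear_zero)
  have 1: "integrable M (\<lambda>x. (f x, 0::'b))" "integrable M (\<lambda>x. (0::'a, g x))"
    using integrable_bounded_linear[OF bl(1) assms(1)] integrable_bounded_linear[OF bl(2) assms(2)] by simp_all
  have e: "(\<lambda>x. (f x, g x)) = (\<lambda>x. (f x, 0) + (0, g x))" by simp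
  show "integrable M (\<lambda>x. (f x, g x))" unfolding e using 1 by (rule Bochner_Integration.integrable_add)
  show "(\<integral>x. (f x, g x) \<partial>M) = (\<integral>x. f x \<partial>M, \<integral>x. g x \<partial>M)"
  proof -
    have "(\<integral>x. (f x, g x) \<partial>M) = (\<integral>x. (f x, 0) \<partial>M) + (\<integral>x. (0, g x) \<partial>M)"
      by (subst Bochner_Integration.integral_add[OF 1, symmetric]) simp
    then show ?thesis using integral_bounded_linear[OF bl(1) assms(1)] integral_bounded_linear[OF bl(2) assms(2)] by simp
  qed
qed

lemma has_weak_deriv_Pair:
  fixes u g :: "_ \<Rightarrow> 'a::euclidean_space" and v k :: "_ \<Rightarrow> 'b::euclidean_space"
  assumes u: "has_weak_deriv test_fun i u g" and v: "has_weak_deriv test_fun i v k" and i: "i \<in> Basis"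
  shows "has_weak_deriv test_fun i (\<lambda>x. (u x, v x)) (\<lambda>x. (g x, k x))"
proof -
  have I: "integrable leb_Omega u" "integrable leb_Omega g" "integrable leb_Omega v" "integrable leb_Omega k"
    using u v by (auto simp: has_weak_deriv_def)
  show ?thesis unfolding has_weak_deriv_def
  proof (intro conjI ballI)
    show "integrable leb_Omega (\<lambda>x. (u x, v x))" "integrable leb_Omega (\<lambda>x. (g x, k x))"
      by (intro integrable_Pair_integral I)+
    fix \<phi> assume \<phi>: "\<phi> \<in> test_fun"
    then have sm: "smooth \<phi>" by (simp add: test_fun_def)
    note c = smooth_line_deriv(2,3)[OF sm i]
    have "(\<integral>x. frechet_derivative \<phi> (at x) i *\<^sub>R u x \<partial>leb_Omega) = - (\<integral>x. \<phi> x *\<^sub>R g x \<partial>leb_Omega)"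
      "(\<integral>x. frechet_derivative \<phi> (at x) i *\<^sub>R v x \<partial>leb_Omega) = - (\<integral>x. \<phi> x *\<^sub>R k x \<partial>leb_Omega)"
      using u v \<phi> unfolding has_weak_deriv_def by blast+
    then show "(\<integral>x. frechet_derivative \<phi> (at x) i *\<^sub>R (u x, v x) \<partial>leb_Omega) = - (\<integral>x. \<phi> x *\<^sub>R (g x, k x) \<partial>leb_Omega)"
      unfolding scaleR_Pair
      by (subst (1 2) integrable_Pair_integral(2)) (auto intro!: integrable_mult_continuous_leb I c)
  qed
qed

text \<open>The cylindrical components \<open>\<rho>\<close>, \<open>T\<close>, \<open>Z\<close> with their first and second derivatives.\<close>

locale cylindrical =
  fixes \<rho> T Z :: "real \<times> real \<Rightarrow> real" and \<rho>1 T1 Z1 :: "real \<times> real \<Rightarrow> real \<times> real \<Rightarrow> real"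
    and \<rho>2 T2 Z2 :: "real \<times> real \<Rightarrow> real \<times> real \<Rightarrow> real \<times> real \<Rightarrow> real" and m :: real
  assumes \<rho>: "twice_diff \<rho> \<rho>1 \<rho>2" and T: "twice_diff T T1 T2" and Z: "twice_diff Z Z1 Z2"
    and bounds: "\<And>i. i \<in> Basis \<Longrightarrow> AE x in Q. \<bar>\<rho>1 i x\<bar> \<le> m \<and> \<bar>T1 i x\<bar> \<le> m \<and> \<bar>Z1 i x\<bar> \<le> m"
begin

text \<open>\<open>D\<close> and \<open>DD\<close> are the first and second derivatives of the Cartesian map \<open>X\<close>. In the rotating frame
  of the radial, angular and axial unit vectors at the angle \<open>T\<close>, the second derivative has the components
  \<open>A\<close>, \<open>B\<close> and \<open>Z2\<close>; the term \<open>- \<rho> T1 T1\<close> in \<open>A\<close> is the curvature of circles.\<close>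

definition "X x = (\<rho> x * cos (T x), \<rho> x * sin (T x), Z x)"
definition "D i x = (\<rho>1 i x * cos (T x) - \<rho> x * T1 i x * sin (T x), \<rho>1 i x * sin (T x) + \<rho> x * T1 i x * cos (T x), Z1 i x)"
definition "A j i x = \<rho>2 j i x - \<rho> x * T1 j x * T1 i x"
definition "B j i x = \<rho> x * T2 j i x + \<rho>1 j x * T1 i x + \<rho>1 i x * T1 j x"
definition "DD j i x = (A j i x * cos (T x) - B j i x * sin (T x), A j i x * sin (T x) + B j i x * cos (T x), Z2 j i x)"

lemma square_integrable_components: "square_integrable \<rho>" "square_integrable T" "square_integrable Z" 
  "i \<in> Basis \<Longrightarrow> square_integrable (\<rho>1 i)" "i \<in> Basis \<Longrightarrow> square_integrable (T1 i)" "i \<in> Basis \<Longrightarrow> square_integrable (Z1 i)"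
  "i \<in> Basis \<Longrightarrow> j \<in> Basis \<Longrightarrow> square_integrable (\<rho>2 i j)" "i \<in> Basis \<Longrightarrow> j \<in> Basis \<Longrightarrow> square_integrable (T2 i j)" "i \<in> Basis \<Longrightarrow> j \<in> Basis \<Longrightarrow> square_integrable (Z2 i j)"
  using \<rho> T Z by (auto simp: twice_diff_def)

lemma WD_components: "i \<in> Basis \<Longrightarrow> WD i \<rho> (\<rho>1 i)" "i \<in> Basis \<Longrightarrow> WD i T (T1 i)" "i \<in> Basis \<Longrightarrow> WD i Z (Z1 i)"
  "i \<in> Basis \<Longrightarrow> j \<in> Basis \<Longrightarrow> WD j (\<rho>1 i) (\<rho>2 i j)" "i \<in> Basis \<Longrightarrow> j \<in> Basis \<Longrightarrow> WD j (T1 i) (T2 i j)" "i \<in> Basis \<Longrightarrow> j \<in> Basis \<Longrightarrow> WD j (Z1 i) (Z2 i j)"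
  using \<rho> T Z by (auto simp: twice_diff_def)

lemmas measurable_components = square_integrable_components[THEN sq_measurable]

lemma T1_bound: "i \<in> Basis \<Longrightarrow> AE x in Q. \<bar>T1 i x\<bar> \<le> m"
  using bounds[of i] by (auto elim: eventually_mono)

lemma integrable_terms:
  assumes i: "i \<in> Basis" and j: "j \<in> Basis" and c[measurable]: "c \<in> borel_measurable borel" and k: "\<And>x. \<bar>c x\<bar> \<le> 1"
  shows "integrable Q (\<lambda>x. \<rho> x * c x)"
    "integrable Q (\<lambda>x. \<rho>1 i x * c x)" "integrable Q (\<lambda>x. \<rho> x * T1 i x * c x)" "integrable Q (\<lambda>x. \<rho>2 j i x * c x)"
    "integrable Q (\<lambda>x. \<rho>1 j x * T1 i x * c x)" "integrable Q (\<lambda>x. \<rho> x * T2 j i x * c x)"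
    "integrable Q (\<lambda>x. \<rho> x * T1 j x * (T1 i x * c x))"
proof -
  have k': "AE x in Q. \<bar>c x\<bar> \<le> 1" using k by simp
  note [measurable] = measurable_components(5)[OF i]
  show "integrable Q (\<lambda>x. \<rho> x * c x)" "integrable Q (\<lambda>x. \<rho>1 i x * c x)" "integrable Q (\<lambda>x. \<rho>2 j i x * c x)"
    using integrable_mult3[OF square_integrable_components(1) sq_const[of 1] c k'] integrable_mult3[OF square_integrable_components(4)[OF i] sq_const[of 1] c k']
      integrable_mult3[OF square_integrable_components(7)[OF j i] sq_const[of 1] c k'] by simp_all
  show "integrable Q (\<lambda>x. \<rho> x * T1 i x * c x)" "integrable Q (\<lambda>x. \<rho>1 j x * T1 i x * c x)" "integrable Q (\<lambda>x. \<rho> x * T2 j i x * c x)"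
    by (rule integrable_mult3[OF _ _ c k']; intro square_integrable_components i j)+
  show "integrable Q (\<lambda>x. \<rho> x * T1 j x * (T1 i x * c x))"
  proof (rule integrable_mult3[OF square_integrable_components(1) square_integrable_components(5)[OF j], where K=m])
    show "AE x in Q. \<bar>T1 i x * c x\<bar> \<le> m" using T1_bound[OF i]
      by eventually_elim (use k in \<open>auto simp: abs_mult intro: order_trans[OF mult_left_le]\<close>)
  qed measurable
qed

lemma Tm[measurable]: "(\<lambda>x. sin (T x)) \<in> borel_measurable borel" "(\<lambda>x. cos (T x)) \<in> borel_measurable borel"
  using measurable_components(2) by auto

lemma WD_X:
  assumes i: "i \<in> Basis"
  shows "WD i (\<lambda>x. \<rho> x * cos (T x)) (\<lambda>x. \<rho>1 i x * cos (T x) - \<rho> x * T1 i x * sin (T x))"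
    "WD i (\<lambda>x. \<rho> x * sin (T x)) (\<lambda>x. \<rho>1 i x * sin (T x) + \<rho> x * T1 i x * cos (T x))"
proof -
  note I = integrable_terms[OF i i Tm(1)] integrable_terms[OF i i Tm(2)]
  have 1: "(\<lambda>x. cos (T x) * \<rho>1 i x + \<rho> x * (- sin (T x) * T1 i x)) = (\<lambda>x. \<rho>1 i x * cos (T x) - \<rho> x * T1 i x * sin (T x))"
    and 2: "(\<lambda>x. sin (T x) * \<rho>1 i x + \<rho> x * (cos (T x) * T1 i x)) = (\<lambda>x. \<rho>1 i x * sin (T x) + \<rho> x * T1 i x * cos (T x))"
    by (auto simp: fun_eq_iff)
  show "WD i (\<lambda>x. \<rho> x * cos (T x)) (\<lambda>x. \<rho>1 i x * cos (T x) - \<rho> x * T1 i x * sin (T x))"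
    using WD_mult[OF WD_components(1)[OF i] WD_cos[OF WD_components(2)[OF i]]] I unfolding 1 by auto
  show "WD i (\<lambda>x. \<rho> x * sin (T x)) (\<lambda>x. \<rho>1 i x * sin (T x) + \<rho> x * T1 i x * cos (T x))"
    using WD_mult[OF WD_components(1)[OF i] WD_sin[OF WD_components(2)[OF i]]] I unfolding 2 by auto
qed

text \<open>The product rule requires the derivative to be integrable; for the term \<open>\<rho> T1 T1\<close> in \<open>A\<close> this uses the
  bound on \<open>T1\<close>.\<close>

lemma WD_D:
  assumes i: "i \<in> Basis" and j: "j \<in> Basis"
  shows "WD i (\<lambda>x. \<rho>1 j x * cos (T x) - \<rho> x * T1 j x * sin (T x)) (\<lambda>x. A j i x * cos (T x) - B j i x * sin (T x))"
    "WD i (\<lambda>x. \<rho>1 j x * sin (T x) + \<rho> x * T1 j x * cos (T x)) (\<lambda>x. A j i x * sin (T x) + B j i x * cos (T x))"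
proof -
  have b: "\<bar>sin (T x)\<bar> \<le> 1" "\<bar>cos (T x)\<bar> \<le> 1" for x by auto
  note I = integrable_terms[OF i j Tm(1) b(1)] integrable_terms[OF i j Tm(2) b(2)]
    integrable_terms(5)[OF j i Tm(1) b(1)] integrable_terms(5)[OF j i Tm(2) b(2)]
  have "WD i (\<lambda>x. \<rho>1 j x * cos (T x)) (\<lambda>x. cos (T x) * \<rho>2 j i x + \<rho>1 j x * (- sin (T x) * T1 i x))"
    by (rule WD_mult[OF WD_components(4)[OF j i] WD_cos[OF WD_components(2)[OF i]]]) (use I in \<open>simp add: mult_ac\<close>)
  moreover have "WD i (\<lambda>x. (\<rho> x * (- sin (T x))) * T1 j x) (\<lambda>x. T1 j x * (- (\<rho>1 i x * sin (T x) + \<rho> x * T1 i x * cos (T x))) + (\<rho> x * (- sin (T x))) * T2 j i x)"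
  proof (rule WD_mult[OF _ WD_components(5)[OF j i]])
    have "WD i (\<lambda>x. -1) (\<lambda>x. 0)" by (rule WD_C1) (auto intro!: continuous_intros)
    from WD_mult[OF WD_X(2)[OF i] this] I
    show "WD i (\<lambda>x. \<rho> x * (- sin (T x))) (\<lambda>x. - (\<rho>1 i x * sin (T x) + \<rho> x * T1 i x * cos (T x)))" by simp
  qed (use I in \<open>simp add: algebra_simps\<close>)
  ultimately have "WD i (\<lambda>x. \<rho>1 j x * cos (T x) + (\<rho> x * (- sin (T x))) * T1 j x)
     (\<lambda>x. (cos (T x) * \<rho>2 j i x + \<rho>1 j x * (- sin (T x) * T1 i x)) + (T1 j x * (- (\<rho>1 i x * sin (T x) + \<rho> x * T1 i x * cos (T x))) + (\<rho> x * (- sin (T x))) * T2 j i x))"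
    by (rule WD_add)
  also have "(\<lambda>x. \<rho>1 j x * cos (T x) + (\<rho> x * (- sin (T x))) * T1 j x) = (\<lambda>x. \<rho>1 j x * cos (T x) - \<rho> x * T1 j x * sin (T x))" by (auto simp: fun_eq_iff)
  also have "(\<lambda>x. (cos (T x) * \<rho>2 j i x + \<rho>1 j x * (- sin (T x) * T1 i x)) + (T1 j x * (- (\<rho>1 i x * sin (T x) + \<rho> x * T1 i x * cos (T x))) + (\<rho> x * (- sin (T x))) * T2 j i x))
     = (\<lambda>x. A j i x * cos (T x) - B j i x * sin (T x))" by (auto simp: fun_eq_iff A_def B_def algebra_simps)
  finally show "WD i (\<lambda>x. \<rho>1 j x * cos (T x) - \<rho> x * T1 j x * sin (T x)) (\<lambda>x. A j i x * cos (T x) - B j i x * sin (T x))" .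
  have "WD i (\<lambda>x. \<rho>1 j x * sin (T x)) (\<lambda>x. sin (T x) * \<rho>2 j i x + \<rho>1 j x * (cos (T x) * T1 i x))"
    by (rule WD_mult[OF WD_components(4)[OF j i] WD_sin[OF WD_components(2)[OF i]]]) (use I in \<open>simp add: mult_ac\<close>)
  moreover have "WD i (\<lambda>x. (\<rho> x * cos (T x)) * T1 j x) (\<lambda>x. T1 j x * (\<rho>1 i x * cos (T x) - \<rho> x * T1 i x * sin (T x)) + (\<rho> x * cos (T x)) * T2 j i x)"
    by (rule WD_mult[OF WD_X(1)[OF i] WD_components(5)[OF j i]]) (use I in \<open>simp add: algebra_simps\<close>)
  ultimately have "WD i (\<lambda>x. \<rho>1 j x * sin (T x) + (\<rho> x * cos (T x)) * T1 j x)
     (\<lambda>x. (sin (T x) * \<rho>2 j i x + \<rho>1 j x * (cos (T x) * T1 i x)) + (T1 j x * (\<rho>1 i x * cos (T x) - \<rho> x * T1 i x * sin (T x)) + (\<rho> x * cos (T x)) * T2 j i x))"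
    by (rule WD_add)
  also have "(\<lambda>x. \<rho>1 j x * sin (T x) + (\<rho> x * cos (T x)) * T1 j x) = (\<lambda>x. \<rho>1 j x * sin (T x) + \<rho> x * T1 j x * cos (T x))" by (auto simp: fun_eq_iff)
  also have "(\<lambda>x. (sin (T x) * \<rho>2 j i x + \<rho>1 j x * (cos (T x) * T1 i x)) + (T1 j x * (\<rho>1 i x * cos (T x) - \<rho> x * T1 i x * sin (T x)) + (\<rho> x * cos (T x)) * T2 j i x))
     = (\<lambda>x. A j i x * sin (T x) + B j i x * cos (T x))" by (auto simp: fun_eq_iff A_def B_def algebra_simps)
  finally show "WD i (\<lambda>x. \<rho>1 j x * sin (T x) + \<rho> x * T1 j x * cos (T x)) (\<lambda>x. A j i x * sin (T x) + B j i x * cos (T x))" .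
qed

lemma weak_X: "i \<in> Basis \<Longrightarrow> has_weak_deriv test_fun i X (D i)"
  unfolding X_def[abs_def] D_def[abs_def]
  using integrable_terms(1)[of e_z e_z, OF _ _ Tm(1)] integrable_terms(1)[of e_z e_z, OF _ _ Tm(2)]
  by (intro has_weak_deriv_Pair WD_imp_weak_test WD_X WD_components) (auto simp: Basis_dir integrable_sq square_integrable_components)

lemma weak_D: "i \<in> Basis \<Longrightarrow> j \<in> Basis \<Longrightarrow> has_weak_deriv test_fun i (D j) (DD j i)"
  unfolding DD_def[abs_def] D_def[abs_def]
  using integrable_terms(2,3)[of j j, OF _ _ Tm(1)] integrable_terms(2,3)[of j j, OF _ _ Tm(2)]
  by (intro has_weak_deriv_Pair WD_imp_weak_test WD_D WD_components) (auto simp: integrable_sq square_integrable_components)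

lemma inner_D: "D i x \<bullet> D j x = \<rho>1 i x * \<rho>1 j x + (\<rho> x)\<^sup>2 * T1 i x * T1 j x + Z1 i x * Z1 j x"
proof -
  have s: "(sin (T x))\<^sup>2 = 1 - (cos (T x))\<^sup>2" by (simp add: sin_squared_eq)
  have "(p * c - q * s) * (p' * c - q' * s) + ((p * s + q * c) * (p' * s + q' * c) + z) = p * p' * (c\<^sup>2 + s\<^sup>2) + q * q' * (c\<^sup>2 + s\<^sup>2) + z"
    for p q p' q' c s z :: real by (simp add: algebra_simps power2_eq_square)
  from this[of "\<rho>1 i x" "cos (T x)" "\<rho> x * T1 i x" "sin (T x)" "\<rho>1 j x" "\<rho> x * T1 j x" "Z1 i x * Z1 j x"]
  show ?thesis by (simp add: D_def inner_prod_def power2_eq_square[of "\<rho> x"])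
qed

lemma norm_DD: "(norm (DD j i x))\<^sup>2 = (A j i x)\<^sup>2 + (B j i x)\<^sup>2 + (Z2 j i x)\<^sup>2"
proof -
  have "(p * c - q * s) * (p * c - q * s) + ((p * s + q * c) * (p * s + q * c) + z) = p * p * (c\<^sup>2 + s\<^sup>2) + q * q * (c\<^sup>2 + s\<^sup>2) + z"
    for p q c s z :: real by (simp add: algebra_simps power2_eq_square)
  from this[of "A j i x" "cos (T x)" "B j i x" "sin (T x)" "Z2 j i x * Z2 j i x"]
  show ?thesis unfolding power2_norm_eq_inner by (simp add: DD_def inner_prod_def power2_eq_square[of "A j i x"] power2_eq_square[of "B j i x"] power2_eq_square[of "Z2 j i x"])
qed

text \<open>The energy density. The rotation by the angle \<open>T\<close> drops out of all inner products and norms.\<close>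

definition "dens h x = (\<Sum>i\<in>Basis. \<Sum>j\<in>Basis. (\<rho>1 i x * \<rho>1 j x + (\<rho> x)\<^sup>2 * T1 i x * T1 j x + Z1 i x * Z1 j x - i \<bullet> j)\<^sup>2)
   + h\<^sup>2 * (\<Sum>i\<in>Basis. \<Sum>j\<in>Basis. (A j i x)\<^sup>2 + (B j i x)\<^sup>2 + (Z2 j i x)\<^sup>2)"

lemma dens_meas[measurable]: "dens h \<in> borel_measurable borel"
  unfolding dens_def[abs_def] A_def[abs_def] B_def[abs_def]
  by (intro borel_measurable_add borel_measurable_sum borel_measurable_power borel_measurable_diff borel_measurable_times borel_measurable_const measurable_components)

text \<open>The weak derivatives in the definition of the energy are chosen arbitrarily; by uniqueness they agree almost
  everywhere with \<open>D\<close> and \<open>DD\<close>.\<close>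

lemma energy_formula:
  assumes m: "Phi_rho \<Phi> \<in> borel_measurable leb_Omega" "Phi_theta \<Phi> \<in> borel_measurable leb_Omega" "Phi_z \<Phi> \<in> borel_measurable leb_Omega"
    and e: "AE x in leb_Omega. Phi_rho \<Phi> x = \<rho> x" "AE x in leb_Omega. Phi_theta \<Phi> x = T x" "AE x in leb_Omega. Phi_z \<Phi> x = Z x"
  shows "energy_NL h \<Phi> = (\<integral>\<^sup>+x. ennreal (dens h x) \<partial>Q)"
proof -
  note [measurable] = m
  have cm: "cartesian \<Phi> \<in> borel_measurable leb_Omega" unfolding cartesian_def[abs_def] by measurable
  have "AE x in leb_Omega. X x = cartesian \<Phi> x" using e by eventually_elim (simp add: X_def cartesian_def)
  then have w1: "has_weak_deriv test_fun i (cartesian \<Phi>) (D i)" if "i \<in> Basis" for i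
    using has_weak_deriv_cong[OF weak_X[OF that] cm] that by simp
  have e1: "AE x in leb_Omega. weak_deriv i (cartesian \<Phi>) x = D i x" if "i \<in> Basis" for i
    by (rule weak_deriv_eq[OF w1[OF that]])
  have m1: "weak_deriv i (cartesian \<Phi>) \<in> borel_measurable leb_Omega" if "i \<in> Basis" for i
    using weak_deriv_eq(1)[OF w1[OF that]] by (auto simp: has_weak_deriv_def)
  have w2: "has_weak_deriv test_fun i (weak_deriv j (cartesian \<Phi>)) (DD j i)" if "i \<in> Basis" "j \<in> Basis" for i j
    using has_weak_deriv_cong[OF weak_D[OF that] m1[OF that(2)]] e1[OF that(2)] that by (simp add: eq_commute)
  have e2: "AE x in leb_Omega. weak_deriv i (weak_deriv j (cartesian \<Phi>)) x = DD j i x" if "i \<in> Basis" "j \<in> Basis" for i j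
    by (rule weak_deriv_eq[OF w2[OF that]])
  have "AE x in leb_Omega. \<forall>i\<in>Basis. weak_deriv i (cartesian \<Phi>) x = D i x"
    "AE x in leb_Omega. \<forall>i\<in>Basis. \<forall>j\<in>Basis. weak_deriv i (weak_deriv j (cartesian \<Phi>)) x = DD j i x"
    using e1 e2 by (simp_all add: AE_finite_all)
  then have "energy_NL h \<Phi> = (\<integral>\<^sup>+x. ennreal (dens h x) \<partial>leb_Omega)"
    unfolding energy_NL_def Let_def
    by (intro nn_integral_cong_AE, eventually_elim) (simp add: dens_def inner_D norm_DD cong: sum.cong)
  also have "\<dots> = (\<integral>\<^sup>+x. ennreal (dens h x) \<partial>Q)"
  by (rule nn_integral_Q_leb) simp
  finally show ?thesis .
qed

end

section \<open>Admissible deformations\<close>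

lemma sq_cong_rep:
  assumes u: "u \<in> L2_Omega"
  shows "\<exists>u'. square_integrable u' \<and> (AE x in leb_Omega. u x = u' x)"
proof -
  have um: "u \<in> borel_measurable leb_Omega" and ui: "integrable leb_Omega (\<lambda>x. (u x)\<^sup>2)" using u by (auto simp: L2_Omega_def)
  obtain u' where u'[measurable]: "u' \<in> borel_measurable borel" and e: "AE x in leb_Omega. u x = u' x"
    using leb_borel_rep[OF um] by blast
  have "integrable leb_Omega (\<lambda>x. (u' x)\<^sup>2)"
    by (rule integrable_cong_AE_imp[OF ui]) (use e in \<open>auto intro!: meas_leb elim: eventually_mono\<close>)
  then show ?thesis using e u' by (intro exI[of _ u']) (simp add: square_integrable_def integrable_Q_leb)
qed

lemma per_weak_transfer:
  assumes w: "has_weak_deriv per_test_fun i u g" and i: "i \<in> Basis" and u': "square_integrable u'" and g': "square_integrable g'"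
    and eu: "AE x in leb_Omega. u x = u' x" and eg: "AE x in leb_Omega. g x = g' x"
  shows "WD i u' g'" "zero_mean i g'"
proof -
  have m: "u' \<in> borel_measurable borel" "g' \<in> borel_measurable borel" using u' g' by (auto simp: square_integrable_def)
  have "has_weak_deriv per_test_fun i u' g'"
    by (rule has_weak_deriv_cong_deriv[OF has_weak_deriv_cong[OF w meas_leb[OF m(1)] eu] meas_leb[OF m(2)] eg]) (use i in auto)
  from per_weak_imp_lines[OF m this i] show "WD i u' g'" "zero_mean i g'" .
qed

text \<open>Membership in the periodic Sobolev space, unfolded: Borel representatives of the function and of its
  derivatives that are absolutely continuous on lines, and periodicity as vanishing means.\<close>

lemma H_per_2_rep:
  assumes "u \<in> H_per 2"
  shows "\<exists>u' g h. twice_diff u' g h \<and> (AE x in leb_Omega. u x = u' x) \<and>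
    (\<forall>i\<in>Basis. zero_mean i (g i) \<and> (\<forall>j\<in>Basis. zero_mean j (h i j)))"
proof -
  have u: "u \<in> L2_Omega" and d: "\<forall>i\<in>Basis. \<exists>g. g \<in> H_per (Suc 0) \<and> has_weak_deriv per_test_fun i u g"
    using assms by (auto simp: numeral_2_eq_2)
  obtain u' where u': "square_integrable u'" "AE x in leb_Omega. u x = u' x" using sq_cong_rep[OF u] by blast
  have "\<exists>g' h'. square_integrable g' \<and> WD i u' g' \<and> zero_mean i g' \<and> (\<forall>j\<in>Basis. square_integrable (h' j) \<and> WD j g' (h' j) \<and> zero_mean j (h' j))"
    if i: "i \<in> Basis" for i
  proof -
    obtain g where g: "g \<in> H_per (Suc 0)" and w: "has_weak_deriv per_test_fun i u g" using d i by blast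
    have gL: "g \<in> L2_Omega" and gd: "\<forall>j\<in>Basis. \<exists>h. h \<in> L2_Omega \<and> has_weak_deriv per_test_fun j g h" using g by auto
    obtain g' where g': "square_integrable g'" "AE x in leb_Omega. g x = g' x" using sq_cong_rep[OF gL] by blast
    have "\<exists>h'. square_integrable h' \<and> WD j g' h' \<and> zero_mean j h'" if j: "j \<in> Basis" for j
    proof -
      obtain h where h: "h \<in> L2_Omega" "has_weak_deriv per_test_fun j g h" using gd j by blast
      obtain h' where h': "square_integrable h'" "AE x in leb_Omega. h x = h' x" using sq_cong_rep[OF h(1)] by blast
      show ?thesis using per_weak_transfer[OF h(2) j g'(1) h'(1) g'(2) h'(2)] h'(1) by blast
    qed
    then have "\<exists>h'. \<forall>j\<in>Basis. square_integrable (h' j) \<and> WD j g' (h' j) \<and> zero_mean j (h' j)" by (rule bchoice[OF ballI])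
    then show ?thesis using per_weak_transfer[OF w i u'(1) g'(1) u'(2) g'(2)] g'(1) by blast
  qed
  then have "\<forall>i\<in>Basis. \<exists>g'. \<exists>h'. square_integrable g' \<and> WD i u' g' \<and> zero_mean i g' \<and> (\<forall>j\<in>Basis. square_integrable (h' j) \<and> WD j g' (h' j) \<and> zero_mean j (h' j))"
    by (rule ballI)
  from bchoice[OF this] obtain g where
    "\<forall>i\<in>Basis. \<exists>h'. square_integrable (g i) \<and> WD i u' (g i) \<and> zero_mean i (g i) \<and> (\<forall>j\<in>Basis. square_integrable (h' j) \<and> WD j (g i) (h' j) \<and> zero_mean j (h' j))" ..
  from bchoice[OF this] obtain h where
    gh: "\<forall>i\<in>Basis. square_integrable (g i) \<and> WD i u' (g i) \<and> zero_mean i (g i) \<and> (\<forall>j\<in>Basis. square_integrable (h i j) \<and> WD j (g i) (h i j) \<and> zero_mean j (h i j))" ..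
  have "twice_diff u' g h" using gh u'(1) unfolding twice_diff_def by blast
  with gh u'(2) show ?thesis by (intro exI[of _ u'] exI[of _ g] exI[of _ h]) blast
qed

text \<open>The angle and the height are periodic only after subtraction of a linear function, which this lemma restores.\<close>

lemma twice_add_lin:
  assumes "twice_diff u g h"
  shows "twice_diff (\<lambda>x. u x + k * (x \<bullet> d)) (\<lambda>i x. g i x + k * (i \<bullet> d)) h"
proof -
  have lm: "continuous_on UNIV (\<lambda>x::real\<times>real. k * (x \<bullet> d))" by (intro continuous_intros)
  have lm': "(\<lambda>x::real\<times>real. k * (x \<bullet> d)) \<in> borel_measurable borel" by (rule borel_measurable_continuous_onI[OF lm])
  obtain B where B: "\<And>x. x \<in> Omega \<Longrightarrow> \<bar>k * (x \<bullet> d)\<bar> \<le> B" using bounded_on_Omega[OF lm] by blast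
  have sl: "square_integrable (\<lambda>x. k * (x \<bullet> d))"
    by (rule sq_bounded[OF lm', where K=B]) (use AE_Q_Omega B in \<open>auto elim: eventually_mono\<close>)
  have wl: "WD i (\<lambda>x. k * (x \<bullet> d)) (\<lambda>x. k * (i \<bullet> d))" if "i \<in> Basis" for i
  proof (rule WD_C1[OF lm])
    show "continuous_on UNIV (\<lambda>x::real\<times>real. k * (i \<bullet> d))" by (rule continuous_on_const)
    show "((\<lambda>t. k * (pt i s t \<bullet> d)) has_real_derivative k * (i \<bullet> d)) (at t)" for s t
    proof (cases "i = e_z")
      case True
      then show ?thesis by (auto simp: pt_def e_z_def inner_prod_def intro!: derivative_eq_intros)
    next
      case False
      then have "i = e_theta" using that by (simp add: Basis_dir)
      then show ?thesis by (auto simp: pt_def e_theta_def e_z_def inner_prod_def intro!: derivative_eq_intros)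
    qed
  qed
  have wc: "WD j (\<lambda>x. c) (\<lambda>x. 0)" for j c by (rule WD_C1) (auto intro!: continuous_intros)
  show ?thesis
    unfolding twice_diff_def
  proof (intro conjI ballI)
    show "square_integrable (\<lambda>x. u x + k * (x \<bullet> d))" using assms sl by (auto simp: twice_diff_def intro: sq_add)
    fix i assume i: "i \<in> (Basis :: (real\<times>real) set)"
    show "square_integrable (\<lambda>x. g i x + k * (i \<bullet> d))" using assms i by (auto simp: twice_diff_def intro!: sq_add sq_const)
    show "WD i (\<lambda>x. u x + k * (x \<bullet> d)) (\<lambda>x. g i x + k * (i \<bullet> d))" using assms i wl[OF i] by (auto simp: twice_diff_def intro!: WD_add)
    fix j assume j: "j \<in> (Basis :: (real\<times>real) set)"
    show "square_integrable (h i j)" using assms i j by (auto simp: twice_diff_def)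
    have "WD j (g i) (h i j)" using assms i j by (auto simp: twice_diff_def)
    from WD_add[OF this wc[of j "k * (i \<bullet> d)"]] show "WD j (\<lambda>x. g i x + k * (i \<bullet> d)) (h i j)" by simp
  qed
qed

lemma weak_deriv_of_twice:
  assumes t: "twice_diff u' g h" and e: "AE x in leb_Omega. u x = u' x" and m: "u \<in> borel_measurable leb_Omega" and i: "i \<in> Basis"
  shows "AE x in leb_Omega. weak_deriv i u x = g i x" "weak_deriv i u \<in> borel_measurable leb_Omega"
proof -
  have "has_weak_deriv test_fun i u' (g i)" using t i by (intro WD_imp_weak_test) (auto simp: twice_diff_def integrable_sq)
  then have w: "has_weak_deriv test_fun i u (g i)"
    by (rule has_weak_deriv_cong[OF _ m]) (use e i in \<open>auto simp: eq_commute\<close>)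
  show "AE x in leb_Omega. weak_deriv i u x = g i x" by (rule weak_deriv_eq(2)[OF w])
  show "weak_deriv i u \<in> borel_measurable leb_Omega" using weak_deriv_eq(1)[OF w] by (auto simp: has_weak_deriv_def)
qed

lemma Linf_norm_AE:
  assumes "Linf_norm u \<le> ereal m" shows "AE x in leb_Omega. \<bar>u x\<bar> \<le> m"
  using esssup_AE[of "\<lambda>x. ereal \<bar>u x\<bar>" leb_Omega] unfolding Linf_norm_def[symmetric]
proof eventually_elim
  case (elim x)
  then have "ereal \<bar>u x\<bar> \<le> ereal m" using assms by (rule order_trans)
  then show ?case by simp
qed

text \<open>The members of the admissible set for the radius bound one, in terms of representatives on lines. Periodicity
  is expressed by the means of derivatives: one for the angle, which winds once around the axis, and \<open>1 - lam\<close> for the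
  height.\<close>

locale admissible = cylindrical +
  fixes lam :: real
  assumes \<rho>_per: "i \<in> Basis \<Longrightarrow> zero_mean i (\<rho>1 i)" "i \<in> Basis \<Longrightarrow> j \<in> Basis \<Longrightarrow> zero_mean j (\<rho>2 i j)"
    and T_per: "zero_mean e_theta (\<lambda>x. T1 e_theta x - 1)"
    and Z_per: "zero_mean e_z (\<lambda>x. Z1 e_z x - (1 - lam))"
    and \<rho>_ge: "AE x in Q. \<rho> x \<ge> 1" and Z_mono: "AE x in Q. Z1 e_z x \<ge> 0"

lemma e_inner[simp]: "e_theta \<bullet> e_theta = 1" "e_z \<bullet> e_z = 1" "e_theta \<bullet> e_z = 0" "e_z \<bullet> e_theta = 0"
  by (auto simp: e_theta_def e_z_def inner_prod_def)

lemma inner_e: "x \<bullet> e_theta = fst x" "x \<bullet> e_z = snd x"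
  by (auto simp: e_theta_def e_z_def inner_prod_def)

lemma A_NL_admissible:
  assumes "\<Phi> \<in> A_NL lam 1 m"
  shows "\<exists>\<rho> T Z \<rho>1 T1 Z1 \<rho>2 T2 Z2. admissible \<rho> T Z \<rho>1 T1 Z1 \<rho>2 T2 Z2 m lam \<and>
    (\<forall>h. energy_NL h \<Phi> = (\<integral>\<^sup>+x. ennreal (cylindrical.dens \<rho> \<rho>1 T1 Z1 \<rho>2 T2 Z2 h x) \<partial>Q))"
proof -
  note A = assms[unfolded A_NL_def mem_Collect_eq]
  have H: "Phi_rho \<Phi> \<in> H_per 2" "(\<lambda>(\<theta>, z). Phi_theta \<Phi> (\<theta>, z) - \<theta>) \<in> H_per 2" "(\<lambda>(\<theta>, z). Phi_z \<Phi> (\<theta>, z) - (1 - lam) * z) \<in> H_per 2"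
    and ge: "AE x in leb_Omega. Phi_rho \<Phi> x \<ge> 1" and mono: "AE x in leb_Omega. weak_deriv e_z (Phi_z \<Phi>) x \<ge> 0"
    and mx: "(MAX (i, u) \<in> {e_theta, e_z} \<times> {Phi_rho \<Phi>, Phi_theta \<Phi>, Phi_z \<Phi>}. Linf_norm (weak_deriv i u)) \<le> ereal m"
    by (rule conjunct1[OF A] conjunct1[OF conjunct2[OF A]] conjunct1[OF conjunct2[OF conjunct2[OF A]]]
      conjunct1[OF conjunct2[OF conjunct2[OF conjunct2[OF A]]]]
      conjunct2[OF conjunct2[OF conjunct2[OF conjunct2[OF conjunct2[OF A]]]]]
      conjunct1[OF conjunct2[OF conjunct2[OF conjunct2[OF conjunct2[OF A]]]]])+
  have mx': "Linf_norm (weak_deriv i u) \<le> ereal m" if "i \<in> Basis" "u \<in> {Phi_rho \<Phi>, Phi_theta \<Phi>, Phi_z \<Phi>}" for i u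
  proof -
    have "Linf_norm (weak_deriv i u) \<in> (\<lambda>(i, u). Linf_norm (weak_deriv i u)) ` ({e_theta, e_z} \<times> {Phi_rho \<Phi>, Phi_theta \<Phi>, Phi_z \<Phi>})"
      using that by (intro image_eqI[of _ _ "(i, u)"]) (auto simp: Basis_dir)
    then have "Linf_norm (weak_deriv i u) \<le> (MAX (i, u) \<in> {e_theta, e_z} \<times> {Phi_rho \<Phi>, Phi_theta \<Phi>, Phi_z \<Phi>}. Linf_norm (weak_deriv i u))"
      by (intro Max_ge) auto
    then show ?thesis using mx by (rule order_trans)
  qed
  obtain \<rho> \<rho>1 \<rho>2 where \<rho>: "twice_diff \<rho> \<rho>1 \<rho>2" "AE x in leb_Omega. Phi_rho \<Phi> x = \<rho> x"
    "\<forall>i\<in>Basis. zero_mean i (\<rho>1 i) \<and> (\<forall>j\<in>Basis. zero_mean j (\<rho>2 i j))" using H_per_2_rep[OF H(1)] by blast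
  obtain v v1 v2 where v: "twice_diff v v1 v2" "AE x in leb_Omega. (\<lambda>(\<theta>, z). Phi_theta \<Phi> (\<theta>, z) - \<theta>) x = v x"
    "\<forall>i\<in>Basis. zero_mean i (v1 i) \<and> (\<forall>j\<in>Basis. zero_mean j (v2 i j))" using H_per_2_rep[OF H(2)] by blast
  obtain w w1 w2 where w: "twice_diff w w1 w2" "AE x in leb_Omega. (\<lambda>(\<theta>, z). Phi_z \<Phi> (\<theta>, z) - (1 - lam) * z) x = w x"
    "\<forall>i\<in>Basis. zero_mean i (w1 i) \<and> (\<forall>j\<in>Basis. zero_mean j (w2 i j))" using H_per_2_rep[OF H(3)] by blast
  define T where "T x = v x + 1 * (x \<bullet> e_theta)" for x
  define T1 where "T1 i x = v1 i x + 1 * (i \<bullet> e_theta)" for i x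
  define Z where "Z x = w x + (1 - lam) * (x \<bullet> e_z)" for x
  define Z1 where "Z1 i x = w1 i x + (1 - lam) * (i \<bullet> e_z)" for i x
  have T: "twice_diff T T1 v2" unfolding T_def[abs_def] T1_def[abs_def] by (rule twice_add_lin[OF v(1)])
  have Z: "twice_diff Z Z1 w2" unfolding Z_def[abs_def] Z1_def[abs_def] by (rule twice_add_lin[OF w(1)])
  have eT: "AE x in leb_Omega. Phi_theta \<Phi> x = T x" using v(2) by eventually_elim (auto simp: T_def case_prod_unfold inner_e)
  have eZ: "AE x in leb_Omega. Phi_z \<Phi> x = Z x" using w(2) by eventually_elim (auto simp: Z_def case_prod_unfold inner_e)
  have L2: "u \<in> borel_measurable leb_Omega" if "u \<in> H_per 2" for u
    using that by (auto simp: numeral_2_eq_2 L2_Omega_def)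
  have mr: "Phi_rho \<Phi> \<in> borel_measurable leb_Omega" by (rule L2[OF H(1)])
  have fs: "fst \<in> borel_measurable leb_Omega" "snd \<in> borel_measurable leb_Omega" by (auto intro: meas_leb)
  have mt: "Phi_theta \<Phi> \<in> borel_measurable leb_Omega"
    using borel_measurable_add[OF L2[OF H(2)] fs(1)] by (simp add: case_prod_unfold)
  have mz: "Phi_z \<Phi> \<in> borel_measurable leb_Omega"
    using borel_measurable_add[OF L2[OF H(3)] borel_measurable_times[OF borel_measurable_const[of "1 - lam"] fs(2)]] by (simp add: case_prod_unfold)
  have wr: "AE x in leb_Omega. weak_deriv i (Phi_rho \<Phi>) x = \<rho>1 i x" if "i \<in> Basis" for i by (rule weak_deriv_of_twice[OF \<rho>(1,2) mr that])
  have wt: "AE x in leb_Omega. weak_deriv i (Phi_theta \<Phi>) x = T1 i x" if "i \<in> Basis" for i by (rule weak_deriv_of_twice[OF T eT mt that])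
  have wz: "AE x in leb_Omega. weak_deriv i (Phi_z \<Phi>) x = Z1 i x" if "i \<in> Basis" for i by (rule weak_deriv_of_twice[OF Z eZ mz that])
  note e\<rho> = \<rho>(2)
  have adm: "admissible \<rho> T Z \<rho>1 T1 Z1 \<rho>2 v2 w2 m lam"
  proof
    show "twice_diff \<rho> \<rho>1 \<rho>2" "twice_diff T T1 v2" "twice_diff Z Z1 w2" by fact+
    fix i j :: "real \<times> real" assume i: "i \<in> Basis"
    have l: "AE x in leb_Omega. \<bar>weak_deriv i (Phi_rho \<Phi>) x\<bar> \<le> m" "AE x in leb_Omega. \<bar>weak_deriv i (Phi_theta \<Phi>) x\<bar> \<le> m"
      "AE x in leb_Omega. \<bar>weak_deriv i (Phi_z \<Phi>) x\<bar> \<le> m"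
      by (rule Linf_norm_AE[OF mx'[OF i]], simp)+
    have "AE x in leb_Omega. \<bar>\<rho>1 i x\<bar> \<le> m \<and> \<bar>T1 i x\<bar> \<le> m \<and> \<bar>Z1 i x\<bar> \<le> m"
      using wr[OF i] wt[OF i] wz[OF i] l by eventually_elim simp
    then show "AE x in Q. \<bar>\<rho>1 i x\<bar> \<le> m \<and> \<bar>T1 i x\<bar> \<le> m \<and> \<bar>Z1 i x\<bar> \<le> m" by (simp only: AE_Q_leb)
    show "zero_mean i (\<rho>1 i)" using \<rho>(3) i by blast
    assume "j \<in> Basis" then show "zero_mean j (\<rho>2 i j)" using \<rho>(3) i by blast
  next
    show "zero_mean e_theta (\<lambda>x. T1 e_theta x - 1)" using v(3) by (simp add: T1_def Basis_dir)
    show "zero_mean e_z (\<lambda>x. Z1 e_z x - (1 - lam))" using w(3) by (simp add: Z1_def Basis_dir)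
    have "AE x in leb_Omega. \<rho> x \<ge> 1" using ge \<rho>(2) by eventually_elim simp
    then show "AE x in Q. \<rho> x \<ge> 1" by (simp only: AE_Q_leb)
    have "AE x in leb_Omega. Z1 e_z x \<ge> 0" using mono wz[of e_z, simplified Basis_dir, simplified] by eventually_elim simp
    then show "AE x in Q. Z1 e_z x \<ge> 0" by (simp only: AE_Q_leb)
  qed
  then interpret admissible \<rho> T Z \<rho>1 T1 Z1 \<rho>2 v2 w2 m lam .
  have "energy_NL h \<Phi> = (\<integral>\<^sup>+x. ennreal (dens h x) \<partial>Q)" for h
    by (rule energy_formula[OF mr mt mz e\<rho> eT eZ])
  then show ?thesis using adm
    by (intro exI[of _ \<rho>] exI[of _ T] exI[of _ Z] exI[of _ \<rho>1] exI[of _ T1] exI[of _ Z1] exI[of _ \<rho>2] exI[of _ v2] exI[of _ w2] conjI allI)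
qed

section \<open>Estimates along circles\<close>

lemma continuous_AE_nonpos:
  fixes h :: "real \<Rightarrow> real"
  assumes c: "continuous_on {a..b} h" and e: "AE t in seg a b. h t \<le> 0" and ab: "a < b" and t0: "t0 \<in> {a..b}"
  shows "h t0 \<le> 0"
proof (rule ccontr)
  assume n: "\<not> h t0 \<le> 0"
  then obtain \<delta> where \<delta>: "\<delta> > 0" "\<And>t. t \<in> {a..b} \<Longrightarrow> \<bar>t - t0\<bar> < \<delta> \<Longrightarrow> \<bar>h t - h t0\<bar> < h t0"
    using c[unfolded continuous_on_iff, rule_format, OF t0, of "h t0"] by (auto simp: dist_real_def)
  define p where "p = max a (t0 - \<delta>/2)" define q where "q = min b (t0 + \<delta>/2)"
  have pq: "p < q" "a \<le> p" "q \<le> b" using \<delta>(1) ab t0 by (auto simp: p_def q_def)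
  have pos: "h t > 0" if "t \<in> {p..q}" for t
    using \<delta>(2)[of t] that pq \<delta>(1) by (auto simp: p_def q_def abs_less_iff)
  have "AE t in lborel. t \<notin> {p..q}"
    using e unfolding AE_seg by eventually_elim (use pos pq in fastforce)
  then have "{p..q} \<in> null_sets lborel" by (subst AE_iff_null_sets) auto
  then have "emeasure lborel {p..q} = 0" by (rule null_setsD1)
  then show False using pq by simp
qed

lemma AC_on_osc:
  assumes A: "AC_on c d F f" and pq: "c \<le> p" "q \<le> d" "s \<in> {p..q}" "t \<in> {p..q}"
  shows "\<bar>F t - F s\<bar> \<le> integral {p..q} (\<lambda>x. \<bar>f x\<bar>)"
proof -
  have ai: "f integrable_on {u..v}" "(\<lambda>x. \<bar>f x\<bar>) integrable_on {u..v}" if "p \<le> u" "v \<le> q" for u v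
    using AC_on_abs_int[OF A, of u v] that pq by (auto simp: absolutely_integrable_on_def)
  have *: "\<bar>F v - F u\<bar> \<le> integral {p..q} (\<lambda>x. \<bar>f x\<bar>)" if "p \<le> u" "u \<le> v" "v \<le> q" for u v
  proof -
    have "norm (integral {u..v} f) \<le> integral {u..v} (\<lambda>x. \<bar>f x\<bar>)"
      by (rule integral_norm_bound_integral) (use ai[of u v] that in auto)
    also have "\<dots> \<le> integral {p..q} (\<lambda>x. \<bar>f x\<bar>)"
      by (rule integral_subset_le) (use ai[of u v] ai[of p q] that in auto)
    finally show ?thesis using AC_on_diff[OF A, of u v] that pq by auto
  qed
  show ?thesis using *[of s t] *[of t s] pq by (cases "s \<le> t") (auto simp: abs_minus_commute)
qed

text \<open>Essentially bounded Borel functions on an interval: a class that is closed under the operations that occur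
  below, so that integrability is obtained by rules.\<close>

definition ess_bounded :: "real \<Rightarrow> real \<Rightarrow> (real \<Rightarrow> real) \<Rightarrow> bool" where
  "ess_bounded a b g \<longleftrightarrow> g \<in> borel_measurable borel \<and> (\<exists>K. AE t in seg a b. \<bar>g t\<bar> \<le> K)"

lemma bd_integrable: "ess_bounded a b g \<Longrightarrow> integrable (seg a b) g"
  unfolding ess_bounded_def by (auto intro!: finite_measure.integrable_const_bound[OF finite_measure_seg])

lemma bd_const: "ess_bounded a b (\<lambda>t. k)" unfolding ess_bounded_def by (auto intro!: exI[of _ "\<bar>k\<bar>"])

lemma bd_add: assumes "ess_bounded a b f" "ess_bounded a b g" shows "ess_bounded a b (\<lambda>t. f t + g t)"
proof -
  from assms obtain K L where "AE t in seg a b. \<bar>f t\<bar> \<le> K" "AE t in seg a b. \<bar>g t\<bar> \<le> L" by (auto simp: ess_bounded_def)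
  then have "AE t in seg a b. \<bar>f t + g t\<bar> \<le> K + L" by eventually_elim linarith
  then show ?thesis using assms by (auto simp: ess_bounded_def)
qed

lemma bd_mult: assumes "ess_bounded a b f" "ess_bounded a b g" shows "ess_bounded a b (\<lambda>t. f t * g t)"
proof -
  from assms obtain K L where "AE t in seg a b. \<bar>f t\<bar> \<le> K" "AE t in seg a b. \<bar>g t\<bar> \<le> L" by (auto simp: ess_bounded_def)
  then have "AE t in seg a b. \<bar>f t * g t\<bar> \<le> K * L"
  proof eventually_elim
    case (elim x)
    then show ?case unfolding abs_mult by (intro mult_mono) (auto intro: order_trans[OF abs_ge_zero])
  qed
  then show ?thesis using assms by (auto simp: ess_bounded_def)
qed

lemma bd_diff: "ess_bounded a b f \<Longrightarrow> ess_bounded a b g \<Longrightarrow> ess_bounded a b (\<lambda>t. f t - g t)"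
  using bd_add[of a b f "\<lambda>t. -1 * g t"] bd_mult[OF bd_const[of a b "-1"], of g] by simp

lemma bd_power2: "ess_bounded a b f \<Longrightarrow> ess_bounded a b (\<lambda>t. (f t)\<^sup>2)"
  unfolding power2_eq_square by (rule bd_mult)

lemma bd_abs: "ess_bounded a b f \<Longrightarrow> ess_bounded a b (\<lambda>t. \<bar>f t\<bar>)"
  unfolding ess_bounded_def by auto

lemmas bd_intros = bd_add bd_mult bd_diff bd_power2 bd_const bd_abs

lemma integral_seg_const: "a \<le> b \<Longrightarrow> (\<integral>t. k \<partial>seg a b) = k * (b - a)"
  by (simp add: measure_seg)

text \<open>The estimates on one circle, where \<open>f = rho - 1\<close>, \<open>rt\<close> is its derivative, \<open>\<tau>\<close> is the derivative of
  the angle, \<open>wt\<close> that of the height, and \<open>a\<close> is the \<open>L\<^sup>1\<close> norm of the stretching. Since \<open>\<tau>\<close> has mean one,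
  the stretching has the same integral as the sum of the nonnegative terms \<open>rt\<^sup>2\<close>, \<open>wt\<^sup>2\<close>,
  \<open>(2 f + f\<^sup>2) \<tau>\<^sup>2\<close> and \<open>(\<tau> - 1)\<^sup>2\<close>. The third of them controls \<open>f\<close> only where \<open>\<tau>\<close> is not small. Elsewhere
  \<open>f\<close> is bounded by its minimum plus its oscillation, and \<open>(\<tau> - 1)\<^sup>2\<close> pays for the size of this set.
  For the \<open>L\<^sup>2\<close> norm, \<open>f\<close> is compared with its average over a window of length \<open>l\<close>: this bounds its supremum by
  a multiple of \<open>a / l + l\<^sup>2\<close>.\<close>

lemma theta_line:
  fixes f rt \<tau> wt F :: "real \<Rightarrow> real" and m :: real
  defines "\<mu> \<equiv> seg 0 (2 * pi)" and "C1 \<equiv> 1 + (1 + m)\<^sup>2 + 4 * pi * m"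
  assumes m: "m \<ge> 0" and fm: "f \<in> borel_measurable borel" and F: "AC_on 0 (2 * pi) F rt" "AE t in \<mu>. f t = F t" "AE t in \<mu>. f t \<ge> 0"
    and rt: "ess_bounded 0 (2*pi) rt" "AE t in \<mu>. \<bar>rt t\<bar> \<le> m" and \<tau>: "ess_bounded 0 (2*pi) \<tau>" "AE t in \<mu>. \<bar>\<tau> t\<bar> \<le> m" "(\<integral>t. \<tau> t \<partial>\<mu>) = 2 * pi"
    and wt: "ess_bounded 0 (2*pi) wt"
  defines "a \<equiv> (\<integral>t. \<bar>(rt t)\<^sup>2 + (1 + f t)\<^sup>2 * (\<tau> t)\<^sup>2 + (wt t)\<^sup>2 - 1\<bar> \<partial>\<mu>)"
  shows "(\<integral>t. (rt t)\<^sup>2 \<partial>\<mu>) \<le> a" "(\<integral>t. (wt t)\<^sup>2 \<partial>\<mu>) \<le> a" "(\<integral>t. (\<tau> t - 1)\<^sup>2 \<partial>\<mu>) \<le> a"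
    "(\<integral>t. f t \<partial>\<mu>) \<le> C1 * a"
    "\<And>l. 0 < l \<Longrightarrow> l \<le> 1 \<Longrightarrow> (\<integral>t. (f t)\<^sup>2 \<partial>\<mu>) \<le> (C1 + 1)\<^sup>2 * (a\<^sup>2 / l + l\<^sup>2 * a)"
proof -
  have Fc: "continuous_on {0..2*pi} F" by (rule AC_on_continuous[OF F(1)])
  have F0: "F t \<ge> 0" if "t \<in> {0..2*pi}" for t
  proof -
    have "AE t in seg 0 (2*pi). - F t \<le> 0" using F(2,3) unfolding \<mu>_def by eventually_elim simp
    from continuous_AE_nonpos[OF _ this _ that] Fc show ?thesis by (auto intro!: continuous_intros)
  qed
  obtain S where "\<forall>y\<in>F ` {0..2*pi}. norm y \<le> S"
    using compact_imp_bounded[OF compact_continuous_image[OF Fc compact_Icc]] unfolding bounded_iff by blast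
  then have S: "\<bar>F t\<bar> \<le> S" if "t \<in> {0..2*pi}" for t using that by simp
  have f: "ess_bounded 0 (2*pi) f"
  proof -
    have "AE t in seg 0 (2*pi). \<bar>f t\<bar> \<le> S" using F(2)[unfolded \<mu>_def] AE_seg_in[of 0 "2*pi"] by eventually_elim (simp add: S)
    then show ?thesis using fm by (auto simp: ess_bounded_def)
  qed
  note bds = f rt(1) \<tau>(1) wt
  have ii: "integrable \<mu> g" if "ess_bounded 0 (2*pi) g" for g
    unfolding \<mu>_def using that by (rule bd_integrable)
  define P where "P t = (2 * f t + (f t)\<^sup>2) * (\<tau> t)\<^sup>2" for t
  have P: "ess_bounded 0 (2*pi) P" unfolding P_def by (intro bd_intros bds)
  have P0: "AE t in \<mu>. P t \<ge> 0" using F(3) by eventually_elim (simp add: P_def)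
  have kc: "(\<integral>t. k \<partial>\<mu>) = k * (2 * pi)" for k unfolding \<mu>_def by (subst integral_seg_const) auto
  have sum_le: "(\<integral>t. (rt t)\<^sup>2 \<partial>\<mu>) + (\<integral>t. (wt t)\<^sup>2 \<partial>\<mu>) + (\<integral>t. P t \<partial>\<mu>) + (\<integral>t. (\<tau> t - 1)\<^sup>2 \<partial>\<mu>) \<le> a"
  proof -
    have e: "(rt t)\<^sup>2 + (1 + f t)\<^sup>2 * (\<tau> t)\<^sup>2 + (wt t)\<^sup>2 - 1 = (rt t)\<^sup>2 + (wt t)\<^sup>2 + P t + (\<tau> t - 1)\<^sup>2 + (2 * \<tau> t - 2)" for t
      by (simp add: P_def power2_eq_square algebra_simps)
    have "(\<integral>t. (rt t)\<^sup>2 + (wt t)\<^sup>2 + P t + (\<tau> t - 1)\<^sup>2 + (2 * \<tau> t - 2) \<partial>\<mu>)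
      = (\<integral>t. (rt t)\<^sup>2 \<partial>\<mu>) + (\<integral>t. (wt t)\<^sup>2 \<partial>\<mu>) + (\<integral>t. P t \<partial>\<mu>) + (\<integral>t. (\<tau> t - 1)\<^sup>2 \<partial>\<mu>) + (2 * (\<integral>t. \<tau> t \<partial>\<mu>) - (\<integral>t. 2 \<partial>\<mu>))"
      using ii[OF bd_power2[OF rt(1)]] ii[OF bd_power2[OF wt]] ii[OF P] ii[OF bd_power2[OF bd_diff[OF \<tau>(1) bd_const[of _ _ 1]]]]
        ii[OF \<tau>(1)] ii[OF bd_const[of _ _ 2]] by simp
    also have "\<dots> = (\<integral>t. (rt t)\<^sup>2 \<partial>\<mu>) + (\<integral>t. (wt t)\<^sup>2 \<partial>\<mu>) + (\<integral>t. P t \<partial>\<mu>) + (\<integral>t. (\<tau> t - 1)\<^sup>2 \<partial>\<mu>)"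
      unfolding \<tau>(3) kc by simp
    finally have "(\<integral>t. (rt t)\<^sup>2 \<partial>\<mu>) + (\<integral>t. (wt t)\<^sup>2 \<partial>\<mu>) + (\<integral>t. P t \<partial>\<mu>) + (\<integral>t. (\<tau> t - 1)\<^sup>2 \<partial>\<mu>)
        = (\<integral>t. (rt t)\<^sup>2 + (1 + f t)\<^sup>2 * (\<tau> t)\<^sup>2 + (wt t)\<^sup>2 - 1 \<partial>\<mu>)" by (simp only: e)
    also have "\<dots> \<le> a" unfolding a_def by (rule order_trans[OF abs_ge_self integral_abs_bound])
    finally show ?thesis .
  qed
  have nn: "(\<integral>t. (rt t)\<^sup>2 \<partial>\<mu>) \<ge> 0" "(\<integral>t. (wt t)\<^sup>2 \<partial>\<mu>) \<ge> 0" "(\<integral>t. P t \<partial>\<mu>) \<ge> 0" "(\<integral>t. (\<tau> t - 1)\<^sup>2 \<partial>\<mu>) \<ge> 0" "a \<ge> 0"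
    unfolding a_def using P0 by (auto intro: integral_nonneg_AE)
  show rta: "(\<integral>t. (rt t)\<^sup>2 \<partial>\<mu>) \<le> a" and "(\<integral>t. (wt t)\<^sup>2 \<partial>\<mu>) \<le> a" and \<tau>a: "(\<integral>t. (\<tau> t - 1)\<^sup>2 \<partial>\<mu>) \<le> a"
    using sum_le nn by linarith+
  have Pa: "(\<integral>t. P t \<partial>\<mu>) \<le> a" using sum_le nn by linarith
  have osc: "F t \<le> F s + 2 * pi * m" if "s \<in> {0..2*pi}" "t \<in> {0..2*pi}" for s t
  proof -
    have "integral {0..2*pi} (\<lambda>t. \<bar>rt t\<bar>) = (\<integral>t. \<bar>rt t\<bar> \<partial>\<mu>)"
      unfolding \<mu>_def using bd_abs[OF rt(1)] by (intro integral_seg[symmetric] bd_integrable) (auto simp: ess_bounded_def)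
    also have "\<dots> \<le> (\<integral>t. m \<partial>\<mu>)" by (intro integral_mono_AE ii bd_intros bds rt)
    finally show ?thesis using AC_on_osc[OF F(1), of 0 "2*pi" s t] that unfolding kc by (simp add: mult_ac)
  qed
  obtain t0 where t0: "t0 \<in> {0..2*pi}" "\<And>t. t \<in> {0..2*pi} \<Longrightarrow> F t0 \<le> F t"
    using continuous_attains_inf[OF compact_Icc _ Fc] by auto
  \<comment> \<open>The minimum of \<open>f\<close> is small, because the mean of \<open>\<tau>\<^sup>2\<close> is at least one.\<close>
  define \<mu>0 where "\<mu>0 = F t0"
  have \<mu>0: "\<mu>0 \<ge> 0" using F0 t0 by (simp add: \<mu>0_def)
  have fb: "AE t in \<mu>. \<mu>0 \<le> f t \<and> f t \<le> \<mu>0 + 2 * pi * m \<and> f t \<ge> 0"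
    using F(2,3) AE_seg_in[of 0 "2*pi", folded \<mu>_def] by eventually_elim (use t0 osc in \<open>auto simp: \<mu>0_def\<close>)
  have "(\<integral>t. 2 * \<mu>0 * (2 * \<tau> t - 1) \<partial>\<mu>) \<le> (\<integral>t. P t \<partial>\<mu>)"
  proof (intro integral_mono_AE ii bd_intros bds P)
    show "AE t in \<mu>. 2 * \<mu>0 * (2 * \<tau> t - 1) \<le> P t"
      using fb
    proof eventually_elim
      case (elim t)
      have "2 * \<mu>0 * (2 * \<tau> t - 1) \<le> 2 * \<mu>0 * (\<tau> t)\<^sup>2"
        using \<mu>0 zero_le_power2[of "\<tau> t - 1"] by (intro mult_left_mono) (auto simp: power2_eq_square algebra_simps)
      also have "\<dots> \<le> P t" unfolding P_def using elim by (intro mult_right_mono) (auto intro: add_increasing2)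
      finally show ?case .
    qed
  qed
  also have "(\<integral>t. 2 * \<mu>0 * (2 * \<tau> t - 1) \<partial>\<mu>) = 2 * \<mu>0 * (2 * (\<integral>t. \<tau> t \<partial>\<mu>) - (\<integral>t. 1 \<partial>\<mu>))"
    using ii[OF \<tau>(1)] ii[OF bd_const] by simp
  also have "\<dots> = 4 * pi * \<mu>0" unfolding \<tau>(3) kc by simp
  finally have \<mu>0a: "4 * pi * \<mu>0 \<le> a" using Pa by simp
  have I1: "(\<integral>t. (\<tau> t - 1)\<^sup>2 \<partial>\<mu>) \<le> (1 + m)\<^sup>2 * (2 * pi)"
  proof -
    have "(\<integral>t. (\<tau> t - 1)\<^sup>2 \<partial>\<mu>) \<le> (\<integral>t. (1 + m)\<^sup>2 \<partial>\<mu>)"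
    proof (intro integral_mono_AE ii bd_intros bds)
      show "AE t in \<mu>. (\<tau> t - 1)\<^sup>2 \<le> (1 + m)\<^sup>2" using \<tau>(2)
      proof eventually_elim
        case (elim t)
        then have "\<bar>\<tau> t - 1\<bar> \<le> 1 + m" by linarith
        from power_mono[OF this abs_ge_zero, of 2] show ?case by simp
      qed
    qed
    then show ?thesis unfolding kc .
  qed
  have "(\<integral>t. f t \<partial>\<mu>) \<le> (\<integral>t. P t + 2 * (\<mu>0 + 2 * pi * m) * (\<tau> t - 1)\<^sup>2 \<partial>\<mu>)"
  proof (intro integral_mono_AE ii bd_intros bds P)
    show "AE t in \<mu>. f t \<le> P t + 2 * (\<mu>0 + 2 * pi * m) * (\<tau> t - 1)\<^sup>2"
      using fb
    proof eventually_elim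
      case (elim t)
      \<comment> \<open>One of \<open>\<tau>\<close> and \<open>1 - \<tau>\<close> is at least one half; this inequality avoids the case distinction.\<close>
      have "1 \<le> 2 * (\<tau> t)\<^sup>2 + 2 * (\<tau> t - 1)\<^sup>2"
        using zero_le_power2[of "2 * \<tau> t - 1"] by (simp add: power2_eq_square algebra_simps)
      then have "f t * 1 \<le> f t * (2 * (\<tau> t)\<^sup>2 + 2 * (\<tau> t - 1)\<^sup>2)" using elim by (intro mult_left_mono) auto
      also have "\<dots> = 2 * f t * (\<tau> t)\<^sup>2 + 2 * f t * (\<tau> t - 1)\<^sup>2" by (simp add: algebra_simps)
      also have "\<dots> \<le> P t + 2 * (\<mu>0 + 2 * pi * m) * (\<tau> t - 1)\<^sup>2"
        unfolding P_def using elim by (intro add_mono mult_right_mono) auto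
      finally show ?case by simp
    qed
  qed
  also have "\<dots> = (\<integral>t. P t \<partial>\<mu>) + 2 * (\<mu>0 + 2 * pi * m) * (\<integral>t. (\<tau> t - 1)\<^sup>2 \<partial>\<mu>)"
    using ii[OF P] ii[OF bd_power2[OF bd_diff[OF \<tau>(1) bd_const[of _ _ 1]]]] by simp
  also have "\<dots> \<le> a + (2 * \<mu>0 * ((1 + m)\<^sup>2 * (2 * pi)) + 4 * pi * m * a)"
  proof -
    have "2 * \<mu>0 * (\<integral>t. (\<tau> t - 1)\<^sup>2 \<partial>\<mu>) \<le> 2 * \<mu>0 * ((1 + m)\<^sup>2 * (2 * pi))" using \<mu>0 I1 by (intro mult_left_mono) auto
    moreover have "4 * pi * m * (\<integral>t. (\<tau> t - 1)\<^sup>2 \<partial>\<mu>) \<le> 4 * pi * m * a" using m \<tau>a by (intro mult_left_mono) auto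
    moreover have "2 * (\<mu>0 + 2 * pi * m) * (\<integral>t. (\<tau> t - 1)\<^sup>2 \<partial>\<mu>)
        = 2 * \<mu>0 * (\<integral>t. (\<tau> t - 1)\<^sup>2 \<partial>\<mu>) + 4 * pi * m * (\<integral>t. (\<tau> t - 1)\<^sup>2 \<partial>\<mu>)"
      by (simp add: distrib_right distrib_left)
    ultimately show ?thesis using Pa by linarith
  qed
  also have "2 * \<mu>0 * ((1 + m)\<^sup>2 * (2 * pi)) \<le> (1 + m)\<^sup>2 * a"
    using mult_left_mono[OF \<mu>0a, of "(1 + m)\<^sup>2"] by (simp add: mult_ac)
  finally show fa: "(\<integral>t. f t \<partial>\<mu>) \<le> C1 * a" by (simp add: C1_def algebra_simps)

  fix l :: real assume l: "0 < l" "l \<le> 1"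
  have C1: "C1 \<ge> 1" using m by (simp add: C1_def)
  define K where "K = a / (2 * l) + l\<^sup>2 / 2"
  define Sl where "Sl = (C1 + 1) * a / l + l\<^sup>2"
  have Fint: "integral {0..2*pi} F = (\<integral>t. f t \<partial>\<mu>)"
  proof -
    have "(\<integral>t. f t \<partial>\<mu>) = integral {0..2*pi} f" unfolding \<mu>_def by (intro integral_seg bd_integrable f fm)
    also have "\<dots> = integral {0..2*pi} F" by (rule seg_AE_integral_cong[OF F(2)[unfolded \<mu>_def]])
    finally show ?thesis by simp
  qed
  have rt2: "(\<lambda>t. (rt t)\<^sup>2) absolutely_integrable_on {0..2*pi}" "integral {0..2*pi} (\<lambda>t. (rt t)\<^sup>2) = (\<integral>t. (rt t)\<^sup>2 \<partial>\<mu>)"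
    using bd_integrable[OF bd_power2[OF rt(1)]] bd_power2[OF rt(1)] integrable_seg[of "\<lambda>t. (rt t)\<^sup>2" 0 "2*pi"]
      integral_seg[of "\<lambda>t. (rt t)\<^sup>2" 0 "2*pi"] by (auto simp: ess_bounded_def \<mu>_def)
  have FS: "F t \<le> Sl" if t: "t \<in> {0..2*pi}" for t
  proof -
    \<comment> \<open>A window of length \<open>l\<close> that contains \<open>t\<close> and lies in the period.\<close>
    define c where "c = min t (2 * pi - l)"
    have c: "0 \<le> c" "c + l \<le> 2 * pi" "t \<in> {c..c+l}" using t l pi_gt3 by (auto simp: c_def)
    have r2i: "(\<lambda>t. (rt t)\<^sup>2) integrable_on {c..c+l}"
      by (rule integrable_on_subinterval[of _ "{0..2*pi}"]) (use rt2 c l in \<open>auto simp: absolutely_integrable_on_def\<close>)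
    have rai: "(\<lambda>t. \<bar>rt t\<bar>) integrable_on {c..c+l}"
      using AC_on_abs_int[OF F(1), of c "c+l"] c by (auto simp: absolutely_integrable_on_def)
    have Fi: "F integrable_on {c..c+l}"
      by (intro integrable_continuous_real continuous_on_subset[OF Fc]) (use c in auto)
    have "integral {c..c+l} (\<lambda>t. \<bar>rt t\<bar>) \<le> integral {c..c+l} (\<lambda>t. (1/(2*l)) * (rt t)\<^sup>2 + l/2)"
    proof (rule integral_le[OF rai])
      show "(\<lambda>t. (1/(2*l)) * (rt t)\<^sup>2 + l/2) integrable_on {c..c+l}"
        by (intro integrable_add integrable_on_mult_right r2i integrable_const_ivl)
      \<comment> \<open>Young's inequality with weight \<open>l\<close>: the oscillation over the window is at most \<open>a / (2 * l) + l\<^sup>2 / 2\<close>.\<close>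
      fix x show "\<bar>rt x\<bar> \<le> (1/(2*l)) * (rt x)\<^sup>2 + l/2"
      proof -
        have "0 \<le> (\<bar>rt x\<bar> - l)\<^sup>2 / (2 * l)" using l by simp
        also have "\<dots> = (1/(2*l)) * (rt x)\<^sup>2 + l/2 - \<bar>rt x\<bar>" using l by (simp add: power2_eq_square field_simps)
        finally show ?thesis by simp
      qed
    qed
    also have "\<dots> = (1/(2*l)) * integral {c..c+l} (\<lambda>t. (rt t)\<^sup>2) + l\<^sup>2/2"
      using integral_add[OF integrable_on_mult_right[OF r2i, of "1/(2*l)"] integrable_const_ivl[of "l/2" c "c+l"]] l
      by (simp add: power2_eq_square)
    also have "\<dots> \<le> K"
    proof -
      have "integral {c..c+l} (\<lambda>t. (rt t)\<^sup>2) \<le> integral {0..2*pi} (\<lambda>t. (rt t)\<^sup>2)"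
        by (rule integral_subset_le) (use r2i rt2 c in \<open>auto simp: absolutely_integrable_on_def\<close>)
      then have "(1/(2*l)) * integral {c..c+l} (\<lambda>t. (rt t)\<^sup>2) \<le> (1/(2*l)) * a"
        using rt2(2) rta l by (intro mult_left_mono) auto
      then show ?thesis by (simp add: K_def)
    qed
    finally have Kb: "integral {c..c+l} (\<lambda>t. \<bar>rt t\<bar>) \<le> K" .
    have "F t * l = integral {c..c+l} (\<lambda>s. F t)" using l by simp
    also have "\<dots> \<le> integral {c..c+l} (\<lambda>s. F s + K)"
    proof (rule integral_le)
      fix s assume s: "s \<in> {c..c+l}"
      show "F t \<le> F s + K" using AC_on_osc[OF F(1) c(1,2) s c(3)] Kb by linarith
    qed (intro integrable_const_ivl integrable_add Fi)+
    also have "\<dots> = integral {c..c+l} F + K * l"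
      using integral_add[OF Fi integrable_const_ivl[of K c "c+l"]] l by (simp add: mult.commute)
    also have "integral {c..c+l} F \<le> integral {0..2*pi} F"
      by (rule integral_subset_le) (use Fi c F0 integrable_continuous_real[OF Fc] in auto)
    also have "integral {0..2*pi} F \<le> C1 * a" using Fint fa by simp
    finally have "F t * l \<le> C1 * a + K * l" by simp
    then have "F t \<le> C1 * a / l + K" using l by (simp add: field_simps)
    also have "\<dots> \<le> Sl"
    proof -
      have "a / (2 * l) \<le> a / l" using nn(5) l by (simp add: field_simps)
      moreover have "l\<^sup>2 / 2 \<le> l\<^sup>2" by simp
      ultimately have "K \<le> a / l + l\<^sup>2" unfolding K_def by linarith
      then show ?thesis unfolding Sl_def by (simp add: add_divide_distrib distrib_right)
    qed
    finally show ?thesis .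
  qed
  have "(\<integral>t. (f t)\<^sup>2 \<partial>\<mu>) \<le> (\<integral>t. Sl * f t \<partial>\<mu>)"
  proof (intro integral_mono_AE ii bd_intros bds)
    show "AE t in \<mu>. (f t)\<^sup>2 \<le> Sl * f t"
      using F(2) AE_seg_in[of 0 "2*pi", folded \<mu>_def]
      by eventually_elim (use FS F0 in \<open>auto simp: power2_eq_square intro!: mult_right_mono\<close>)
  qed
  also have "\<dots> \<le> Sl * (C1 * a)"
  proof -
    have "Sl \<ge> 0" using C1 nn(5) l by (simp add: Sl_def)
    then show ?thesis using fa by (simp add: mult_left_mono)
  qed
  also have "\<dots> = (C1 + 1) * C1 * (a\<^sup>2 / l) + C1 * (l\<^sup>2 * a)" using l by (simp add: Sl_def power2_eq_square field_simps)
  also have "\<dots> \<le> (C1 + 1)\<^sup>2 * (a\<^sup>2 / l) + (C1 + 1)\<^sup>2 * (l\<^sup>2 * a)"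
    using C1 nn(5) l by (intro add_mono mult_right_mono) (auto simp: power2_eq_square intro: mult_mono order_trans[OF _ mult_mono[of 1 "C1+1" "C1" "C1+1"]])
  finally show "(\<integral>t. (f t)\<^sup>2 \<partial>\<mu>) \<le> (C1 + 1)\<^sup>2 * (a\<^sup>2 / l + l\<^sup>2 * a)" by (simp add: distrib_left)
qed

section \<open>Interpolation on intervals\<close>

text \<open>Here \<open>G\<close> is the derivative of \<open>F \<ge> 0\<close>, and \<open>g2\<close> that of \<open>G\<close>. A weighted mean of \<open>G\<close> is controlled by the
  integral of \<open>F\<close> through integration by parts, and \<open>G\<close> differs from this mean by at most the integral of
  \<open>\<bar>g2\<bar>\<close>. Using \<open>\<bar>G\<bar> \<le> m\<close> once makes the first contribution linear in \<open>F\<close>, which is what the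
  \<open>L\<^sup>1\<close> bound on \<open>f\<close> calls for.\<close>

lemma cell_estimate:
  fixes F G g2 :: "real \<Rightarrow> real"
  assumes cd: "c < d" and F: "AC_on c d F G" and G: "AC_on c d G g2" and m: "m \<ge> 0"
    and F0: "\<And>t. t \<in> {c..d} \<Longrightarrow> F t \<ge> 0" and Gm: "\<And>t. t \<in> {c..d} \<Longrightarrow> \<bar>G t\<bar> \<le> m"
    and g22: "(\<lambda>t. (g2 t)\<^sup>2) integrable_on {c..d}"
  shows "integral {c..d} (\<lambda>t. (G t)\<^sup>2) \<le> 12 * m / (d - c) * integral {c..d} F + (d - c)\<^sup>2 * integral {c..d} (\<lambda>t. (g2 t)\<^sup>2)"
proof -
  define l where "l = d - c"
  have l: "l > 0" using cd by (simp add: l_def)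
  \<comment> \<open>A weight with integral one that vanishes at both ends.\<close>
  define \<eta> where "\<eta> y = 6 * (y - c) * (d - y) / l ^ 3" for y
  define \<eta>' where "\<eta>' y = 6 * (c + d - 2 * y) / l ^ 3" for y
  have d\<eta>: "(\<eta> has_real_derivative \<eta>' y) (at y within S)" for y S
    unfolding \<eta>_def \<eta>'_def using l by (auto intro!: derivative_eq_intros simp: field_simps)
  have \<eta>AC: "AC_on c d \<eta> \<eta>'"
    by (rule AC_on_C1[OF d\<eta>]) (use l in \<open>auto simp: \<eta>'_def intro!: continuous_intros\<close>)
  have \<eta>c: "continuous_on {c..d} \<eta>" by (rule AC_on_continuous[OF \<eta>AC])
  have \<eta>0: "\<eta> y \<ge> 0" if "y \<in> {c..d}" for y using that l by (simp add: \<eta>_def)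
  have Fc: "continuous_on {c..d} F" and Gc: "continuous_on {c..d} G" by (rule AC_on_continuous[OF F] AC_on_continuous[OF G])+
  have \<eta>1: "(\<eta> has_integral 1) {c..d}"
  proof -
    define H where "H y = 6 * (l * (y - c)^2 / 2 - (y - c)^3 / 3) / l ^ 3" for y
    have "(H has_real_derivative \<eta> y) (at y within {c..d})" for y
      unfolding H_def \<eta>_def using l by (auto intro!: derivative_eq_intros simp: l_def field_simps power2_eq_square)
    then have "(\<eta> has_integral (H d - H c)) {c..d}"
      using cd by (intro fundamental_theorem_of_calculus) (auto simp: has_real_derivative_iff_has_vector_derivative)
    moreover have "H d - H c = 1" using l by (simp add: H_def l_def[symmetric] field_simps power2_eq_square power3_eq_cube)
    ultimately show ?thesis by simp
  qed
  define A where "A = 6 / l\<^sup>2 * integral {c..d} F"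
  define B where "B = integral {c..d} (\<lambda>t. \<bar>g2 t\<bar>)"
  have Gi: "(\<lambda>t. \<eta> t * G t) integrable_on {c..d}" and Fi: "(\<lambda>t. F t * \<eta>' t) integrable_on {c..d}" and FFi: "F integrable_on {c..d}"
    by (intro integrable_continuous_real continuous_on_mult \<eta>c Gc Fc; (simp add: \<eta>'_def)?; (intro continuous_intros)?; use l in simp)+
  have "integral {c..d} (\<lambda>t. \<eta> t * G t + F t * \<eta>' t) = F d * \<eta> d - F c * \<eta> c"
    using AC_on_diff[OF AC_on_mult[OF F \<eta>AC], of c d] cd by simp
  then have "integral {c..d} (\<lambda>t. \<eta> t * G t) = - integral {c..d} (\<lambda>t. F t * \<eta>' t)"
    using integral_add[OF Gi Fi] by (simp add: \<eta>_def)
  moreover have "norm (integral {c..d} (\<lambda>t. F t * \<eta>' t)) \<le> integral {c..d} (\<lambda>t. 6 / l\<^sup>2 * F t)"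
  proof (rule integral_norm_bound_integral[OF Fi])
    show "(\<lambda>t. 6 / l\<^sup>2 * F t) integrable_on {c..d}" by (intro integrable_on_mult_right FFi)
    fix t assume t: "t \<in> {c..d}"
    have "\<bar>c + d - 2 * t\<bar> \<le> l" using t by (auto simp: l_def abs_le_iff)
    then have "\<bar>\<eta>' t\<bar> \<le> 6 * l / l ^ 3" using l unfolding \<eta>'_def abs_divide abs_mult by (auto intro!: divide_right_mono)
    also have "\<dots> = 6 / l\<^sup>2" using l by (simp add: power2_eq_square power3_eq_cube)
    finally show "norm (F t * \<eta>' t) \<le> 6 / l\<^sup>2 * F t" using mult_right_mono[of "\<bar>\<eta>' t\<bar>" "6 / l\<^sup>2" "F t"] F0[OF t] by (simp add: abs_mult mult.commute[of "F t"])
  qed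
  ultimately have A: "\<bar>integral {c..d} (\<lambda>t. \<eta> t * G t)\<bar> \<le> A" by (simp add: A_def)
  have AB: "\<bar>G t\<bar> \<le> A + B" if t: "t \<in> {c..d}" for t
  proof -
    have i1: "((\<lambda>s. G t * \<eta> s) has_integral G t) {c..d}" using has_integral_mult_right[OF \<eta>1, of "G t"] by simp
    have h1: "((\<lambda>s. G t * \<eta> s - \<eta> s * G s) has_integral (G t - integral {c..d} (\<lambda>t. \<eta> t * G t))) {c..d}"
      by (intro has_integral_diff i1 integrable_integral Gi)
    have h2: "((\<lambda>s. B * \<eta> s) has_integral B) {c..d}" using has_integral_mult_right[OF \<eta>1, of B] by simp
    have "norm (integral {c..d} (\<lambda>s. G t * \<eta> s - \<eta> s * G s)) \<le> integral {c..d} (\<lambda>s. B * \<eta> s)"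
    proof (rule integral_norm_bound_integral)
      show "(\<lambda>s. G t * \<eta> s - \<eta> s * G s) integrable_on {c..d}" "(\<lambda>s. B * \<eta> s) integrable_on {c..d}"
        using h1 h2 by (auto intro: has_integral_integrable)
      fix s assume s: "s \<in> {c..d}"
      have "\<bar>G t - G s\<bar> \<le> B" unfolding B_def by (rule AC_on_osc[OF G order_refl order_refl s t])
      then have "\<bar>G t - G s\<bar> * \<eta> s \<le> B * \<eta> s" using \<eta>0[OF s] by (rule mult_right_mono)
      moreover have "\<bar>G t * \<eta> s - \<eta> s * G s\<bar> = \<bar>G t - G s\<bar> * \<eta> s"
      proof -
        have "G t * \<eta> s - \<eta> s * G s = (G t - G s) * \<eta> s" by (simp add: left_diff_distrib)
        then show ?thesis using \<eta>0[OF s] by (simp only: abs_mult abs_of_nonneg)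
      qed
      ultimately show "norm (G t * \<eta> s - \<eta> s * G s) \<le> B * \<eta> s" by simp
    qed
    then have "\<bar>G t - integral {c..d} (\<lambda>t. \<eta> t * G t)\<bar> \<le> B"
      unfolding integral_unique[OF h1] integral_unique[OF h2] by simp
    then show ?thesis using A by linarith
  qed
  have Gsq: "(G t)\<^sup>2 \<le> 2 * m * A + B\<^sup>2" if t: "t \<in> {c..d}" for t
  proof -
    have A0: "A \<ge> 0" using A by linarith
    have "(G t)\<^sup>2 = \<bar>G t\<bar> * \<bar>G t\<bar>" by (simp add: power2_eq_square)
    also have "\<dots> \<le> \<bar>G t\<bar> * A + \<bar>G t\<bar> * B" using mult_left_mono[OF AB[OF t], of "\<bar>G t\<bar>"] by (simp add: distrib_left)
    also have "\<bar>G t\<bar> * A \<le> m * A" using Gm[OF t] A0 by (rule mult_right_mono)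
    also have "\<bar>G t\<bar> * B \<le> (G t)\<^sup>2 / 2 + B\<^sup>2 / 2"
      using zero_le_power2[of "\<bar>G t\<bar> - B"] by (simp add: power2_diff)
    finally show ?thesis by simp
  qed
  have BB: "B\<^sup>2 \<le> l * integral {c..d} (\<lambda>t. (g2 t)\<^sup>2)"
  proof -
    have gi: "(\<lambda>t. \<bar>g2 t\<bar>) integrable_on {c..d}"
      using AC_on_abs_int[OF G, of c d] by (auto simp: absolutely_integrable_on_def)
    have "0 \<le> integral {c..d} (\<lambda>t. ((g2 t)\<^sup>2 + (B/l)\<^sup>2) - 2 * (B/l) * \<bar>g2 t\<bar>)"
    proof (rule integral_nonneg)
      show "(\<lambda>t. ((g2 t)\<^sup>2 + (B/l)\<^sup>2) - 2 * (B/l) * \<bar>g2 t\<bar>) integrable_on {c..d}"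
        by (intro integrable_diff integrable_add g22 integrable_const_ivl integrable_on_mult_right gi)
      fix t show "0 \<le> ((g2 t)\<^sup>2 + (B/l)\<^sup>2) - 2 * (B/l) * \<bar>g2 t\<bar>"
        using zero_le_power2[of "\<bar>g2 t\<bar> - B/l"] by (simp add: power2_diff mult_ac)
    qed
    also have "\<dots> = integral {c..d} (\<lambda>t. (g2 t)\<^sup>2 + (B/l)\<^sup>2) - integral {c..d} (\<lambda>t. 2 * (B/l) * \<bar>g2 t\<bar>)"
      by (intro integral_diff integrable_add g22 integrable_const_ivl integrable_on_mult_right gi)
    also have "integral {c..d} (\<lambda>t. (g2 t)\<^sup>2 + (B/l)\<^sup>2) = integral {c..d} (\<lambda>t. (g2 t)\<^sup>2) + l * (B/l)\<^sup>2"
      using integral_add[OF g22 integrable_const_ivl[of "(B/l)\<^sup>2"]] cd by (simp add: l_def)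
    also have "integral {c..d} (\<lambda>t. 2 * (B/l) * \<bar>g2 t\<bar>) = 2 * (B/l) * B" by (simp add: B_def)
    finally have "B\<^sup>2 / l \<le> integral {c..d} (\<lambda>t. (g2 t)\<^sup>2)" using l by (simp add: power2_eq_square)
    then show ?thesis using l by (simp add: field_simps)
  qed
  have "integral {c..d} (\<lambda>t. (G t)\<^sup>2) \<le> integral {c..d} (\<lambda>t. 2 * m * A + B\<^sup>2)"
    by (rule integral_le) (auto intro!: Gsq integrable_continuous_real continuous_intros Gc)
  also have "\<dots> = 2 * m * A * l + l * B\<^sup>2" using cd by (simp add: l_def algebra_simps)
  also have "\<dots> \<le> 2 * m * A * l + l * (l * integral {c..d} (\<lambda>t. (g2 t)\<^sup>2))" using BB l by simp
  also have "2 * m * A * l = 12 * m / l * integral {c..d} F" using l by (simp add: A_def power2_eq_square)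
  finally show ?thesis by (simp add: l_def power2_eq_square mult.assoc)
qed

text \<open>The interval is cut into \<open>N\<close> cells of equal length, and the cell estimates are added up.\<close>

lemma strip_estimate:
  fixes F G g2 :: "real \<Rightarrow> real" and N :: nat
  assumes cd: "c < d" and F: "AC_on c d F G" and G: "AC_on c d G g2" and m: "m \<ge> 0" and N: "N \<ge> 1"
    and F0: "\<And>t. t \<in> {c..d} \<Longrightarrow> F t \<ge> 0" and Gm: "\<And>t. t \<in> {c..d} \<Longrightarrow> \<bar>G t\<bar> \<le> m"
    and g22: "(\<lambda>t. (g2 t)\<^sup>2) integrable_on {c..d}"
  defines "l \<equiv> (d - c) / real N"
  shows "integral {c..d} (\<lambda>t. (G t)\<^sup>2) \<le> 12 * m / l * integral {c..d} F + l\<^sup>2 * integral {c..d} (\<lambda>t. (g2 t)\<^sup>2)"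
proof -
  have l: "l > 0" using cd N by (simp add: l_def)
  have Nl: "c + real N * l = d" using N by (simp add: l_def)
  have Fc: "continuous_on {c..d} F" and Gc: "continuous_on {c..d} G" by (rule AC_on_continuous[OF F] AC_on_continuous[OF G])+
  have G2i: "(\<lambda>t. (G t)\<^sup>2) integrable_on {c..d}" and Fi: "F integrable_on {c..d}"
    by (intro integrable_continuous_real continuous_intros Gc Fc)+
  have "integral {c..c + real k * l} (\<lambda>t. (G t)\<^sup>2) \<le> 12 * m / l * integral {c..c + real k * l} F + l\<^sup>2 * integral {c..c + real k * l} (\<lambda>t. (g2 t)\<^sup>2)"
    if "k \<le> N" for k
    using that
  proof (induction k)
    case 0 then show ?case by simp
  next
    case (Suc k)
    define p q where "p = c + real k * l" and "q = c + real (Suc k) * l"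
    have "q \<le> c + real N * l" unfolding q_def using Suc.prems l by (intro add_left_mono mult_right_mono) auto
    then have pq: "c \<le> p" "p < q" "q \<le> d" "q - p = l" using l Nl by (auto simp: p_def q_def algebra_simps)
    have sub: "AC_on p q U u" if "AC_on c d U u" for U u
      by (rule AC_onI) (use AC_on_abs_int[OF that] AC_on_diff[OF that] pq in auto)
    have comb: "integral {c..q} h = integral {c..p} h + integral {p..q} h" if "h integrable_on {c..d}" for h :: "real \<Rightarrow> real"
      by (rule Henstock_Kurzweil_Integration.integral_combine[symmetric]) (use pq in \<open>auto intro: integrable_on_subinterval[OF that]\<close>)
    have "integral {p..q} (\<lambda>t. (G t)\<^sup>2) \<le> 12 * m / (q - p) * integral {p..q} F + (q - p)\<^sup>2 * integral {p..q} (\<lambda>t. (g2 t)\<^sup>2)"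
      by (rule cell_estimate[OF pq(2) sub[OF F] sub[OF G] m]) (use F0 Gm pq in \<open>auto intro: integrable_on_subinterval[OF g22]\<close>)
    moreover have "integral {c..p} (\<lambda>t. (G t)\<^sup>2) \<le> 12 * m / l * integral {c..p} F + l\<^sup>2 * integral {c..p} (\<lambda>t. (g2 t)\<^sup>2)"
      unfolding p_def using Suc by simp
    ultimately have "integral {c..q} (\<lambda>t. (G t)\<^sup>2) \<le> 12 * m / l * integral {c..q} F + l\<^sup>2 * integral {c..q} (\<lambda>t. (g2 t)\<^sup>2)"
      unfolding comb[OF G2i] comb[OF Fi] comb[OF g22] distrib_left pq(4) by linarith
    then show ?case by (simp only: q_def)
  qed
  from this[of N] show ?thesis unfolding Nl by simp
qed

lemma mono_lines:
  fixes p q :: "real \<times> real \<Rightarrow> real"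
  assumes "integrable Q p" "integrable Q q"
    and "AE s in across i. (\<integral>t. p (pt i s t) \<partial>line i) \<le> (\<integral>t. q (pt i s t) \<partial>line i)"
  shows "(\<integral>x. p x \<partial>Q) \<le> (\<integral>x. q x \<partial>Q)"
  unfolding integral_lines[OF assms(1), of i, symmetric] integral_lines[OF assms(2), of i, symmetric]
  by (intro integral_mono_AE integrable_lines assms)

lemma integral_zero_mean:
  assumes "zero_mean i g" "integrable Q g" shows "integral\<^sup>L Q g = 0"
  unfolding integral_lines[OF assms(2), of i, symmetric]
  by (rule integral_eq_zero_AE) (use assms(1) in \<open>simp add: zero_mean_def\<close>)

text \<open>The integral of \<open>(\<bar>g\<bar> - k)\<^sup>2\<close> is nonnegative, where \<open>k\<close> is the mean of \<open>\<bar>g\<bar>\<close>.\<close>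

lemma (in finite_measure) square_of_L1_norm_le:
  fixes g :: "'a \<Rightarrow> real"
  assumes g: "integrable M g" "integrable M (\<lambda>x. (g x)\<^sup>2)" and pos: "measure M (space M) > 0"
  shows "(\<integral>x. \<bar>g x\<bar> \<partial>M)\<^sup>2 \<le> measure M (space M) * (\<integral>x. (g x)\<^sup>2 \<partial>M)"
proof -
  define v where "v = measure M (space M)"
  have v: "v > 0" using pos by (simp add: v_def)
  define k where "k = (\<integral>x. \<bar>g x\<bar> \<partial>M) / v"
  have "0 \<le> (\<integral>x. (g x)\<^sup>2 + k\<^sup>2 - 2 * k * \<bar>g x\<bar> \<partial>M)"
  proof (rule integral_nonneg_AE, rule AE_I2)
    fix x show "0 \<le> (g x)\<^sup>2 + k\<^sup>2 - 2 * k * \<bar>g x\<bar>"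
      using zero_le_power2[of "\<bar>g x\<bar> - k"] by (simp add: power2_diff mult_ac)
  qed
  also have "\<dots> = (\<integral>x. (g x)\<^sup>2 \<partial>M) + k\<^sup>2 * v - 2 * k * (\<integral>x. \<bar>g x\<bar> \<partial>M)"
    using g by (simp add: v_def)
  also have "(\<integral>x. \<bar>g x\<bar> \<partial>M) = k * v" using v by (simp add: k_def)
  finally have "k\<^sup>2 * v \<le> (\<integral>x. (g x)\<^sup>2 \<partial>M)" by (simp add: power2_eq_square algebra_simps)
  then have "k\<^sup>2 * v * v \<le> (\<integral>x. (g x)\<^sup>2 \<partial>M) * v" using v by (intro mult_right_mono) auto
  moreover have "(\<integral>x. \<bar>g x\<bar> \<partial>M)\<^sup>2 = k\<^sup>2 * v * v" using v by (simp add: k_def power2_eq_square)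
  ultimately show ?thesis by (simp add: mult.commute v_def)
qed

lemma WD_periodic_product:
  assumes u: "WD i u g" and v: "WD i v k" and z: "zero_mean i g" "zero_mean i k" and int: "integrable Q (\<lambda>x. v x * g x + u x * k x)"
  shows "(\<integral>x. v x * g x + u x * k x \<partial>Q) = 0"
proof (rule integral_zero_mean[OF _ int])
  have [measurable]: "u \<in> borel_measurable borel" "g \<in> borel_measurable borel" "v \<in> borel_measurable borel" "k \<in> borel_measurable borel"
    using u v by (auto simp: WD_def)
  have gk: "integrable Q g" "integrable Q k" using u v by (auto simp: WD_def)
  show "zero_mean i (\<lambda>x. v x * g x + u x * k x)"
    unfolding zero_mean_def
    using WD_lines[OF u] WD_lines[OF v] z[unfolded zero_mean_def] AE_integrable_lines[OF int, of i]
      AE_integrable_lines[OF gk(1), of i] AE_integrable_lines[OF gk(2), of i]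
  proof eventually_elim
    case (elim s)
    obtain F where F: "AC_on (lo i) (hi i) F (\<lambda>t. g (pt i s t))" "AE t in line i. u (pt i s t) = F t" using elim(1) by blast
    obtain G where G: "AC_on (lo i) (hi i) G (\<lambda>t. k (pt i s t))" "AE t in line i. v (pt i s t) = G t" using elim(2) by blast
    have per: "U (hi i) = U (lo i)" if "AC_on (lo i) (hi i) U (\<lambda>t. w (pt i s t))" "(\<integral>t. w (pt i s t) \<partial>line i) = 0"
      "integrable (line i) (\<lambda>t. w (pt i s t))" "w \<in> borel_measurable borel" for U w
    proof -
      have "(\<lambda>t. w (pt i s t)) \<in> borel_measurable borel" using measurable_compose[OF pt_measurable(2) that(4)] .
      then have "integral {lo i..hi i} (\<lambda>t. w (pt i s t)) = 0" using that(2,3) unfolding line_def by (simp add: integral_seg)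
      then show ?thesis using AC_on_diff[OF that(1), of "lo i" "hi i"] by simp
    qed
    have FG: "F (hi i) = F (lo i)" "G (hi i) = G (lo i)"
      using per[OF F(1) elim(3) elim(6)] per[OF G(1) elim(4) elim(7)] by auto
    have "(\<integral>t. v (pt i s t) * g (pt i s t) + u (pt i s t) * k (pt i s t) \<partial>line i)
        = integral {lo i..hi i} (\<lambda>t. v (pt i s t) * g (pt i s t) + u (pt i s t) * k (pt i s t))"
      using elim(5) unfolding line_def by (intro integral_seg) auto
    also have "\<dots> = integral {lo i..hi i} (\<lambda>t. G t * g (pt i s t) + F t * k (pt i s t))"
    proof (rule seg_AE_integral_cong)
      show "AE t in seg (lo i) (hi i). v (pt i s t) * g (pt i s t) + u (pt i s t) * k (pt i s t) = G t * g (pt i s t) + F t * k (pt i s t)"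
        using F(2)[unfolded line_def] G(2)[unfolded line_def] by eventually_elim simp
    qed
    also have "\<dots> = 0" using AC_on_diff[OF AC_on_mult[OF F(1) G(1)], of "lo i" "hi i"] FG by simp
    finally show ?case .
  qed
qed

section \<open>Stretching and bending of an admissible deformation\<close>

lemma dir_angular: "lo e_theta = 0" "hi e_theta = 2 * pi" "line e_theta = seg 0 (2 * pi)"
  and dir_axial: "lo e_z = -1/2" "hi e_z = 1/2" "line e_z = seg (-1/2) (1/2)"
  by (simp_all add: dir_defs)

lemma e_Basis[simp]: "e_theta \<in> Basis" "e_z \<in> Basis" by (simp_all add: Basis_dir)

context admissible
begin

text \<open>\<open>f\<close> is the radial displacement. In the abbreviations the letters \<open>r\<close> and \<open>w\<close> refer to the radius and the
  height and the last letters to the directions of differentiation; \<open>\<tau>\<close>, \<open>tz\<close> are the derivatives of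
  the angle, and \<open>\<zeta>\<close> is the axial derivative of the height. The entries of the strain are \<open>gtt\<close>, \<open>gtz\<close>, \<open>gzz\<close>.\<close>

definition "f x = \<rho> x - 1"
abbreviation "rt \<equiv> \<rho>1 e_theta"
abbreviation "rz \<equiv> \<rho>1 e_z"
abbreviation "\<tau> \<equiv> T1 e_theta"
abbreviation "tz \<equiv> T1 e_z"
abbreviation "wt \<equiv> Z1 e_theta"
abbreviation "\<zeta> \<equiv> Z1 e_z"
abbreviation "rzz \<equiv> \<rho>2 e_z e_z"
definition "gtt x = (rt x)\<^sup>2 + (1 + f x)\<^sup>2 * (\<tau> x)\<^sup>2 + (wt x)\<^sup>2 - 1"
definition "gtz x = rt x * rz x + (\<rho> x)\<^sup>2 * \<tau> x * tz x + wt x * \<zeta> x"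
definition "gzz x = (rz x)\<^sup>2 + (\<rho> x)\<^sup>2 * (tz x)\<^sup>2 + (\<zeta> x)\<^sup>2 - 1"

lemma sq_f: "square_integrable f" using sq_add[OF square_integrable_components(1) sq_const[of "-1"]] by (simp add: f_def[abs_def])

lemma f_nonneg: "AE x in Q. f x \<ge> 0" using \<rho>_ge by eventually_elim (simp add: f_def)

lemmas component_meas [measurable] = measurable_components(1) sq_f[THEN sq_measurable] measurable_components(4)[OF e_Basis(1)] measurable_components(4)[OF e_Basis(2)]
  measurable_components(5)[OF e_Basis(1)] measurable_components(5)[OF e_Basis(2)] measurable_components(6)[OF e_Basis(1)] measurable_components(6)[OF e_Basis(2)] measurable_components(7)[OF e_Basis(2) e_Basis(2)]

lemma gtt_meas[measurable]: "gtt \<in> borel_measurable borel" unfolding gtt_def[abs_def] by measurable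

lemma pt_comp_meas: "u \<in> borel_measurable borel \<Longrightarrow> (\<lambda>t. u (pt i s t)) \<in> borel_measurable borel"
  by (rule measurable_compose[OF pt_measurable(2)])

text \<open>The estimates on circles, integrated over all circles. The square of the \<open>L\<^sup>1\<close> norm on a circle is first
  replaced by the \<open>L\<^sup>2\<close> norm, so that the bound is linear in quantities that can be integrated.\<close>

lemma theta_estimates:
  assumes m: "m \<ge> 0" and g: "square_integrable gtt"
  defines "C1 \<equiv> 1 + (1 + m)\<^sup>2 + 4 * pi * m" and "\<alpha> \<equiv> (\<integral>x. \<bar>gtt x\<bar> \<partial>Q)"
  shows "(\<integral>x. (rt x)\<^sup>2 \<partial>Q) \<le> \<alpha>" "(\<integral>x. (wt x)\<^sup>2 \<partial>Q) \<le> \<alpha>" "(\<integral>x. (\<tau> x - 1)\<^sup>2 \<partial>Q) \<le> \<alpha>"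
    "(\<integral>x. f x \<partial>Q) \<le> C1 * \<alpha>"
    "\<And>l. 0 < l \<Longrightarrow> l \<le> 1 \<Longrightarrow> (\<integral>x. (f x)\<^sup>2 \<partial>Q) \<le> (C1 + 1)\<^sup>2 * (2 * pi * (\<integral>x. (gtt x)\<^sup>2 \<partial>Q) / l + l\<^sup>2 * \<alpha>)"
proof -
  let ?L = "line e_theta" let ?p = "pt e_theta"
  have gi: "integrable Q gtt" "integrable Q (\<lambda>x. (gtt x)\<^sup>2)" "integrable Q (\<lambda>x. \<bar>gtt x\<bar>)"
    using g integrable_sq[OF g] by (auto simp: square_integrable_def)
  have \<tau>i: "integrable Q \<tau>" using square_integrable_components by (simp add: integrable_sq)
  have main: "AE s in across e_theta.
      (\<integral>t. (rt (?p s t))\<^sup>2 \<partial>?L) \<le> (\<integral>t. \<bar>gtt (?p s t)\<bar> \<partial>?L) \<and> (\<integral>t. (wt (?p s t))\<^sup>2 \<partial>?L) \<le> (\<integral>t. \<bar>gtt (?p s t)\<bar> \<partial>?L) \<and>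
      (\<integral>t. (\<tau> (?p s t) - 1)\<^sup>2 \<partial>?L) \<le> (\<integral>t. \<bar>gtt (?p s t)\<bar> \<partial>?L) \<and> (\<integral>t. f (?p s t) \<partial>?L) \<le> C1 * (\<integral>t. \<bar>gtt (?p s t)\<bar> \<partial>?L) \<and>
      (\<forall>l. 0 < l \<longrightarrow> l \<le> 1 \<longrightarrow> (\<integral>t. (f (?p s t))\<^sup>2 \<partial>?L) \<le> (C1 + 1)\<^sup>2 * ((\<integral>t. \<bar>gtt (?p s t)\<bar> \<partial>?L)\<^sup>2 / l + l\<^sup>2 * (\<integral>t. \<bar>gtt (?p s t)\<bar> \<partial>?L))) \<and>
      (\<integral>t. \<bar>gtt (?p s t)\<bar> \<partial>?L)\<^sup>2 \<le> 2 * pi * (\<integral>t. (gtt (?p s t))\<^sup>2 \<partial>?L)"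
    using WD_lines[OF WD_components(1)[OF e_Basis(1)]] AE_lines[OF bounds[OF e_Basis(1)], of e_theta]
      AE_lines[OF f_nonneg, of e_theta] T_per[unfolded zero_mean_def] AE_integrable_lines[OF \<tau>i, of e_theta]
      AE_integrable_lines[OF gi(1), of e_theta] AE_integrable_lines[OF gi(2), of e_theta]
  proof eventually_elim
    case (elim s)
    obtain F where F: "AC_on 0 (2*pi) F (\<lambda>t. rt (?p s t))" "AE t in seg 0 (2*pi). \<rho> (?p s t) = F t"
      using elim(1) unfolding dir_angular by blast
    have F': "AC_on 0 (2*pi) (\<lambda>t. F t + -1) (\<lambda>t. rt (?p s t))" using AC_on_add[OF F(1) AC_on_const[of _ _ "-1"]] by simp
    have F'': "AE t in seg 0 (2*pi). f (?p s t) = F t + -1" using F(2) by eventually_elim (simp add: f_def)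
    have b: "AE t in seg 0 (2*pi). \<bar>rt (?p s t)\<bar> \<le> m" "AE t in seg 0 (2*pi). \<bar>\<tau> (?p s t)\<bar> \<le> m" "AE t in seg 0 (2*pi). \<bar>wt (?p s t)\<bar> \<le> m"
      using elim(2) unfolding dir_angular by (eventually_elim, simp)+
    have bds: "ess_bounded 0 (2*pi) (\<lambda>t. rt (?p s t))" "ess_bounded 0 (2*pi) (\<lambda>t. \<tau> (?p s t))" "ess_bounded 0 (2*pi) (\<lambda>t. wt (?p s t))"
      unfolding ess_bounded_def using b by (auto intro: pt_comp_meas component_meas)
    have "(\<integral>t. \<tau> (?p s t) - 1 \<partial>seg 0 (2*pi)) = 0" using elim(4) unfolding dir_angular .
    then have \<tau>1: "(\<integral>t. \<tau> (?p s t) \<partial>seg 0 (2*pi)) = 2 * pi"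
      using bd_integrable[OF bds(2)] bd_integrable[OF bd_const[of 0 "2*pi" 1]] by (simp add: measure_seg)
    note L = theta_line[OF m pt_comp_meas[OF component_meas(2)] F' F'' elim(3)[unfolded dir_angular] bds(1) b(1) bds(2) b(2) \<tau>1 bds(3), folded gtt_def C1_def]
    have "(\<integral>t. \<bar>gtt (?p s t)\<bar> \<partial>seg 0 (2*pi))\<^sup>2 \<le> 2 * pi * (\<integral>t. (gtt (?p s t))\<^sup>2 \<partial>seg 0 (2*pi))"
      using finite_measure.square_of_L1_norm_le[OF finite_measure_seg elim(6,7)[unfolded dir_angular]] by (simp add: measure_seg)
    then show ?case using L unfolding dir_angular by auto
  qed
  have C1: "C1 \<ge> 0" using m by (simp add: C1_def)
  have sqi: "integrable Q (\<lambda>x. (rt x)\<^sup>2)" "integrable Q (\<lambda>x. (wt x)\<^sup>2)" "integrable Q (\<lambda>x. (\<tau> x - 1)\<^sup>2)" "integrable Q (\<lambda>x. (f x)\<^sup>2)" "integrable Q f"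
    using square_integrable_components(4,6)[of e_theta] sq_add[OF square_integrable_components(5)[of e_theta] sq_const[of "-1"]] sq_f integrable_sq[OF sq_f] by (auto simp: square_integrable_def)
  show "(\<integral>x. (rt x)\<^sup>2 \<partial>Q) \<le> \<alpha>" "(\<integral>x. (wt x)\<^sup>2 \<partial>Q) \<le> \<alpha>" "(\<integral>x. (\<tau> x - 1)\<^sup>2 \<partial>Q) \<le> \<alpha>"
    unfolding \<alpha>_def using main by (auto intro!: mono_lines[where i=e_theta] sqi gi elim: eventually_mono)
  have "(\<integral>x. f x \<partial>Q) \<le> (\<integral>x. C1 * \<bar>gtt x\<bar> \<partial>Q)"
  proof (rule mono_lines[where i=e_theta])
    show "AE s in across e_theta. (\<integral>t. f (?p s t) \<partial>?L) \<le> (\<integral>t. C1 * \<bar>gtt (?p s t)\<bar> \<partial>?L)"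
      using main by eventually_elim simp
  qed (use sqi gi in auto)
  then show "(\<integral>x. f x \<partial>Q) \<le> C1 * \<alpha>" by (simp add: \<alpha>_def)
  fix l :: real assume l: "0 < l" "l \<le> 1"
  have "(\<integral>x. (f x)\<^sup>2 \<partial>Q) \<le> (\<integral>x. (C1 + 1)\<^sup>2 * ((2 * pi / l) * (gtt x)\<^sup>2 + l\<^sup>2 * \<bar>gtt x\<bar>) \<partial>Q)"
  proof (rule mono_lines[where i=e_theta])
    show "integrable Q (\<lambda>x. (C1 + 1)\<^sup>2 * ((2 * pi / l) * (gtt x)\<^sup>2 + l\<^sup>2 * \<bar>gtt x\<bar>))" using gi by auto
    show "AE s in across e_theta. (\<integral>t. (f (?p s t))\<^sup>2 \<partial>?L) \<le> (\<integral>t. (C1 + 1)\<^sup>2 * ((2 * pi / l) * (gtt (?p s t))\<^sup>2 + l\<^sup>2 * \<bar>gtt (?p s t)\<bar>) \<partial>?L)"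
      using main AE_integrable_lines[OF gi(2), of e_theta] AE_integrable_lines[OF gi(3), of e_theta]
    proof eventually_elim
      case (elim s)
      define a where "a = (\<integral>t. \<bar>gtt (?p s t)\<bar> \<partial>?L)"
      have "(\<integral>t. (f (?p s t))\<^sup>2 \<partial>?L) \<le> (C1 + 1)\<^sup>2 * (a\<^sup>2 / l + l\<^sup>2 * a)" using elim(1) l unfolding a_def by blast
      also have "\<dots> \<le> (C1 + 1)\<^sup>2 * ((2 * pi * (\<integral>t. (gtt (?p s t))\<^sup>2 \<partial>?L)) / l + l\<^sup>2 * a)"
        using elim(1) l unfolding a_def[symmetric] by (intro mult_left_mono add_right_mono divide_right_mono) auto
      also have "\<dots> = (\<integral>t. (C1 + 1)\<^sup>2 * ((2 * pi / l) * (gtt (?p s t))\<^sup>2 + l\<^sup>2 * \<bar>gtt (?p s t)\<bar>) \<partial>?L)"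
        using elim(2,3) by (simp add: a_def)
      finally show ?case .
    qed
  qed (rule sqi)
  also have "\<dots> = (C1 + 1)\<^sup>2 * (2 * pi * (\<integral>x. (gtt x)\<^sup>2 \<partial>Q) / l + l\<^sup>2 * \<alpha>)"
    using gi by (simp add: \<alpha>_def)
  finally show "(\<integral>x. (f x)\<^sup>2 \<partial>Q) \<le> (C1 + 1)\<^sup>2 * (2 * pi * (\<integral>x. (gtt x)\<^sup>2 \<partial>Q) / l + l\<^sup>2 * \<alpha>)" .
qed

text \<open>The strip estimate on each axial line with strips of height \<open>1 / N\<close>, integrated over all lines.\<close>

lemma z_estimate_strips:
  assumes m: "m \<ge> 0" and N: "N \<ge> (1::nat)"
  shows "(\<integral>x. (rz x)\<^sup>2 \<partial>Q) \<le> 12 * m * real N * (\<integral>x. f x \<partial>Q) + (\<integral>x. (rzz x)\<^sup>2 \<partial>Q) / (real N)\<^sup>2"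
proof -
  let ?L = "line e_z" let ?p = "pt e_z"
  have sqi: "integrable Q (\<lambda>x. (rz x)\<^sup>2)" "integrable Q (\<lambda>x. (rzz x)\<^sup>2)" "integrable Q f"
    using square_integrable_components(4)[of e_z] square_integrable_components(7)[of e_z e_z] integrable_sq[OF sq_f] by (auto simp: square_integrable_def)
  have "(\<integral>x. (rz x)\<^sup>2 \<partial>Q) \<le> (\<integral>x. 12 * m * real N * f x + (1 / (real N)\<^sup>2) * (rzz x)\<^sup>2 \<partial>Q)"
  proof (rule mono_lines[where i=e_z])
    show "integrable Q (\<lambda>x. 12 * m * real N * f x + (1 / (real N)\<^sup>2) * (rzz x)\<^sup>2)" using sqi by auto
    show "AE s in across e_z. (\<integral>t. (rz (?p s t))\<^sup>2 \<partial>?L) \<le> (\<integral>t. 12 * m * real N * f (?p s t) + (1 / (real N)\<^sup>2) * (rzz (?p s t))\<^sup>2 \<partial>?L)"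
      using WD_lines[OF WD_components(1)[OF e_Basis(2)]] WD_lines[OF WD_components(4)[OF e_Basis(2) e_Basis(2)]] AE_lines[OF bounds[OF e_Basis(2)], of e_z]
        AE_lines[OF f_nonneg, of e_z] AE_integrable_lines[OF sqi(1), of e_z] AE_integrable_lines[OF sqi(2), of e_z] AE_integrable_lines[OF sqi(3), of e_z]
    proof eventually_elim
      case (elim s)
      let ?S = "seg (-1/2) (1/2)"
      obtain F where F: "AC_on (-1/2) (1/2) F (\<lambda>t. rz (?p s t))" "AE t in ?S. \<rho> (?p s t) = F t"
        using elim(1) unfolding dir_axial by blast
      obtain G where G: "AC_on (-1/2) (1/2) G (\<lambda>t. rzz (?p s t))" "AE t in ?S. rz (?p s t) = G t"
        using elim(2) unfolding dir_axial by blast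
      have "AE t in ?S. G t = rz (?p s t)" using G(2) by eventually_elim simp
      from AC_on_add[OF AC_on_cong_AE[OF F(1) this] AC_on_const[of _ _ "-1"]]
      have F': "AC_on (-1/2) (1/2) (\<lambda>t. F t + -1) G" by simp
      have F'': "AE t in ?S. f (?p s t) = F t + -1" using F(2) by eventually_elim (simp add: f_def)
      have F0: "F t + -1 \<ge> 0" if t: "t \<in> {-1/2..1/2}" for t
      proof -
        have "AE t in ?S. - (F t + -1) \<le> 0" using F'' elim(4)[unfolded dir_axial] by eventually_elim simp
        from continuous_AE_nonpos[OF continuous_on_minus[OF AC_on_continuous[OF F']] this _ t] show ?thesis by simp
      qed
      have Gm: "\<bar>G t\<bar> \<le> m" if t: "t \<in> {-1/2..1/2}" for t
      proof -
        have "AE t in ?S. \<bar>G t\<bar> - m \<le> 0" using G(2) elim(3)[unfolded dir_axial] by eventually_elim simp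
        moreover have "continuous_on {-1/2..1/2} (\<lambda>t. \<bar>G t\<bar> - m)" by (intro continuous_intros AC_on_continuous[OF G(1)])
        ultimately show ?thesis using continuous_AE_nonpos[of "-1/2" "1/2" "\<lambda>t. \<bar>G t\<bar> - m" t] t by simp
      qed
      have r2: "(\<lambda>t. (rzz (?p s t))\<^sup>2) integrable_on {-1/2..1/2}" "(\<integral>t. (rzz (?p s t))\<^sup>2 \<partial>?S) = integral {-1/2..1/2} (\<lambda>t. (rzz (?p s t))\<^sup>2)"
        using elim(6) integrable_seg[of "\<lambda>t. (rzz (?p s t))\<^sup>2" "-1/2" "1/2"] integral_seg[of "\<lambda>t. (rzz (?p s t))\<^sup>2" "-1/2" "1/2"]
          pt_comp_meas[OF component_meas(9), of e_z s] unfolding dir_axial by (auto simp: absolutely_integrable_on_def)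
      have r1: "(\<integral>t. (rz (?p s t))\<^sup>2 \<partial>?S) = integral {-1/2..1/2} (\<lambda>t. (G t)\<^sup>2)"
      proof -
        have "(\<integral>t. (rz (?p s t))\<^sup>2 \<partial>?S) = integral {-1/2..1/2} (\<lambda>t. (rz (?p s t))\<^sup>2)"
          using elim(5) pt_comp_meas[OF component_meas(4), of e_z s] unfolding dir_axial by (intro integral_seg) auto
        also have "\<dots> = integral {-1/2..1/2} (\<lambda>t. (G t)\<^sup>2)"
        proof (rule seg_AE_integral_cong)
          show "AE t in ?S. (rz (?p s t))\<^sup>2 = (G t)\<^sup>2" using G(2) by eventually_elim simp
        qed
        finally show ?thesis .
      qed
      have r0: "(\<integral>t. f (?p s t) \<partial>?S) = integral {-1/2..1/2} (\<lambda>t. F t + -1)"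
      proof -
        have "(\<integral>t. f (?p s t) \<partial>?S) = integral {-1/2..1/2} (\<lambda>t. f (?p s t))"
          using elim(7) pt_comp_meas[OF component_meas(2), of e_z s] unfolding dir_axial by (intro integral_seg) auto
        also have "\<dots> = integral {-1/2..1/2} (\<lambda>t. F t + -1)" by (rule seg_AE_integral_cong[OF F''])
        finally show ?thesis .
      qed
      have "integral {-1/2..1/2} (\<lambda>t. (G t)\<^sup>2) \<le> 12 * m / ((1/2 - -1/2) / real N) * integral {-1/2..1/2} (\<lambda>t. F t + -1) + ((1/2 - -1/2) / real N)\<^sup>2 * integral {-1/2..1/2} (\<lambda>t. (rzz (?p s t))\<^sup>2)"
        by (rule strip_estimate[OF _ F' G(1) m N F0 Gm r2(1)]) auto
      then have "(\<integral>t. (rz (?p s t))\<^sup>2 \<partial>?S) \<le> 12 * m * real N * (\<integral>t. f (?p s t) \<partial>?S) + (1 / (real N)\<^sup>2) * (\<integral>t. (rzz (?p s t))\<^sup>2 \<partial>?S)"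
        unfolding r0 r1 r2 by (simp add: power_divide)
      also have "\<dots> = (\<integral>t. 12 * m * real N * f (?p s t) + (1 / (real N)\<^sup>2) * (rzz (?p s t))\<^sup>2 \<partial>?S)"
        using elim(6,7) unfolding dir_axial by simp
      finally show ?case unfolding dir_axial .
    qed
  qed (rule sqi)
  also have "\<dots> = 12 * m * real N * (\<integral>x. f x \<partial>Q) + (\<integral>x. (rzz x)\<^sup>2 \<partial>Q) / (real N)\<^sup>2" using sqi by simp
  finally show ?thesis .
qed

text \<open>By periodicity the integral of \<open>rz\<^sup>2\<close> equals that of \<open>- f * rzz\<close>. The product is split with a weight \<open>k\<close>, whose
  choice is left to the application.\<close>

lemma z_estimate_product:
  assumes k: "k > 0"
  shows "(\<integral>x. (rz x)\<^sup>2 \<partial>Q) \<le> (k * (\<integral>x. (f x)\<^sup>2 \<partial>Q) + (\<integral>x. (rzz x)\<^sup>2 \<partial>Q) / k) / 2"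
proof -
  have s: "square_integrable rz" "square_integrable rzz" by (intro square_integrable_components; simp)+
  have sqi: "integrable Q (\<lambda>x. (rz x)\<^sup>2)" "integrable Q (\<lambda>x. (rzz x)\<^sup>2)" "integrable Q (\<lambda>x. (f x)\<^sup>2)"
    using s sq_f by (auto simp: square_integrable_def)
  have fr: "integrable Q (\<lambda>x. f x * rzz x)" using integrable_mult3[OF sq_f s(2), of "\<lambda>x. 1" 1] by simp
  have "WD e_z (\<lambda>x. \<rho> x + -1) (\<lambda>x. rz x + 0)"
    by (rule WD_add[OF WD_components(1)[OF e_Basis(2)]], rule WD_C1) (auto intro!: continuous_intros)
  then have Wf: "WD e_z f rz" by (simp add: f_def[abs_def])
  have "(\<integral>x. rz x * rz x + f x * rzz x \<partial>Q) = 0"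
    by (rule WD_periodic_product[OF Wf WD_components(4)[OF e_Basis(2) e_Basis(2)] \<rho>_per(1)[OF e_Basis(2)] \<rho>_per(2)[OF e_Basis(2) e_Basis(2)]])
       (use sqi fr in \<open>auto simp: power2_eq_square\<close>)
  then have "(\<integral>x. (rz x)\<^sup>2 \<partial>Q) = (\<integral>x. - (f x * rzz x) \<partial>Q)"
    using sqi fr by (simp add: power2_eq_square)
  also have "\<dots> \<le> (\<integral>x. k/2 * (f x)\<^sup>2 + 1/(2*k) * (rzz x)\<^sup>2 \<partial>Q)"
  proof (rule integral_mono)
    fix x
    have "0 \<le> (k * f x + rzz x)\<^sup>2 / (2 * k)" using k by simp
    also have "\<dots> = k/2 * (f x)\<^sup>2 + 1/(2*k) * (rzz x)\<^sup>2 + f x * rzz x" using k by (simp add: power2_eq_square field_simps)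
    finally show "- (f x * rzz x) \<le> k/2 * (f x)\<^sup>2 + 1/(2*k) * (rzz x)\<^sup>2" by simp
  qed (use sqi fr in auto)
  also have "\<dots> = (k * (\<integral>x. (f x)\<^sup>2 \<partial>Q) + (\<integral>x. (rzz x)\<^sup>2 \<partial>Q) / k) / 2" using sqi k by (simp add: field_simps)
  finally show ?thesis .
qed

lemma all_bounds: "AE x in Q. \<bar>rt x\<bar> \<le> m \<and> \<bar>rz x\<bar> \<le> m \<and> \<bar>\<tau> x\<bar> \<le> m \<and> \<bar>tz x\<bar> \<le> m \<and> \<bar>wt x\<bar> \<le> m \<and> \<bar>\<zeta> x\<bar> \<le> m"
  using bounds[OF e_Basis(1)] bounds[OF e_Basis(2)] by eventually_elim simp

lemma sq_\<rho>tz: "integrable Q (\<lambda>x. (\<rho> x)\<^sup>2 * (tz x)\<^sup>2)"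
proof -
  have "AE x in Q. \<bar>(tz x)\<^sup>2\<bar> \<le> m\<^sup>2" using all_bounds 
  proof eventually_elim
    case (elim x)
    then show ?case using power_mono[of "\<bar>tz x\<bar>" m 2] by simp
  qed
  from integrable_mult3[OF square_integrable_components(1) square_integrable_components(1) _ this] show ?thesis by (simp add: power2_eq_square)
qed

text \<open>Where \<open>\<tau> \<ge> 1/2\<close>, the mixed strain \<open>gtz\<close> contains \<open>\<rho>\<^sup>2 * \<tau> * tz\<close>, and its other terms contain a factor
  \<open>rt\<close> or \<open>wt\<close>. Where \<open>\<tau> < 1/2\<close>, the constant \<open>1 \<le> 4 * (\<tau> - 1)\<^sup>2\<close> is already small in the mean.\<close>

lemma twist_estimate:
  assumes m: "m \<ge> 0" and g: "square_integrable gtz"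
  shows "(\<integral>x. (\<rho> x)\<^sup>2 * (tz x)\<^sup>2 \<partial>Q) \<le> 12 * (\<integral>x. (gtz x)\<^sup>2 \<partial>Q) + 12 * m\<^sup>2 * (\<integral>x. (rt x)\<^sup>2 \<partial>Q) + 12 * m\<^sup>2 * (\<integral>x. (wt x)\<^sup>2 \<partial>Q)
    + 8 * m\<^sup>2 * (\<integral>x. (\<tau> x - 1)\<^sup>2 \<partial>Q) + 2 * m\<^sup>2 * (\<integral>x. (f x)\<^sup>2 \<partial>Q)"
proof -
  have sqi: "integrable Q (\<lambda>x. (gtz x)\<^sup>2)" "integrable Q (\<lambda>x. (rt x)\<^sup>2)" "integrable Q (\<lambda>x. (wt x)\<^sup>2)" "integrable Q (\<lambda>x. (\<tau> x - 1)\<^sup>2)" "integrable Q (\<lambda>x. (f x)\<^sup>2)"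
    using g square_integrable_components(4,6)[of e_theta] sq_add[OF square_integrable_components(5)[of e_theta] sq_const[of "-1"]] sq_f by (auto simp: square_integrable_def)
  have "(\<integral>x. (\<rho> x)\<^sup>2 * (tz x)\<^sup>2 \<partial>Q) \<le> (\<integral>x. 12 * (gtz x)\<^sup>2 + 12 * m\<^sup>2 * (rt x)\<^sup>2 + 12 * m\<^sup>2 * (wt x)\<^sup>2 + 8 * m\<^sup>2 * (\<tau> x - 1)\<^sup>2 + 2 * m\<^sup>2 * (f x)\<^sup>2 \<partial>Q)"
  proof (rule integral_mono_AE[OF sq_\<rho>tz])
    show "AE x in Q. (\<rho> x)\<^sup>2 * (tz x)\<^sup>2 \<le> 12 * (gtz x)\<^sup>2 + 12 * m\<^sup>2 * (rt x)\<^sup>2 + 12 * m\<^sup>2 * (wt x)\<^sup>2 + 8 * m\<^sup>2 * (\<tau> x - 1)\<^sup>2 + 2 * m\<^sup>2 * (f x)\<^sup>2"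
      using all_bounds \<rho>_ge
    proof eventually_elim
      case (elim x)
      show ?case
      proof (cases "\<tau> x \<ge> 1/2")
        case True
        have "\<rho> x * \<bar>tz x\<bar> \<le> 2 * ((\<rho> x)\<^sup>2 * \<tau> x * \<bar>tz x\<bar>)"
        proof -
          have "1 \<le> \<rho> x * (2 * \<tau> x)" using elim True mult_mono[of 1 "\<rho> x" 1 "2 * \<tau> x"] by simp
          then have "(\<rho> x * \<bar>tz x\<bar>) * 1 \<le> (\<rho> x * \<bar>tz x\<bar>) * (\<rho> x * (2 * \<tau> x))" using elim by (intro mult_left_mono) auto
          then show ?thesis by (simp add: power2_eq_square mult_ac)
        qed
        also have "(\<rho> x)\<^sup>2 * \<tau> x * \<bar>tz x\<bar> = \<bar>gtz x - rt x * rz x - wt x * \<zeta> x\<bar>"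
          using True by (simp add: gtz_def abs_mult)
        also have "\<dots> \<le> \<bar>gtz x\<bar> + m * \<bar>rt x\<bar> + m * \<bar>wt x\<bar>"
        proof -
          have "\<bar>rt x * rz x\<bar> \<le> m * \<bar>rt x\<bar>" "\<bar>wt x * \<zeta> x\<bar> \<le> m * \<bar>wt x\<bar>"
            unfolding abs_mult using elim by (auto simp: mult.commute[of m] intro!: mult_left_mono)
          then show ?thesis by linarith
        qed
        finally have le: "\<rho> x * \<bar>tz x\<bar> \<le> 2 * (\<bar>gtz x\<bar> + m * \<bar>rt x\<bar> + m * \<bar>wt x\<bar>)" by simp
        have "(\<rho> x)\<^sup>2 * (tz x)\<^sup>2 = (\<rho> x * \<bar>tz x\<bar>)\<^sup>2" by (simp add: power_mult_distrib)
        also have "\<dots> \<le> (2 * (\<bar>gtz x\<bar> + m * \<bar>rt x\<bar> + m * \<bar>wt x\<bar>))\<^sup>2" using le elim by (intro power_mono) auto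
        also have "\<dots> \<le> 12 * (gtz x)\<^sup>2 + 12 * m\<^sup>2 * (rt x)\<^sup>2 + 12 * m\<^sup>2 * (wt x)\<^sup>2"
        proof -
          have q: "(2 * (a + b + c))\<^sup>2 \<le> 12 * a\<^sup>2 + 12 * b\<^sup>2 + 12 * c\<^sup>2" for a b c :: real
          proof -
            have "0 \<le> 4 * (a - b)\<^sup>2 + 4 * (b - c)\<^sup>2 + 4 * (a - c)\<^sup>2" by simp
            then show ?thesis by (simp add: power2_eq_square algebra_simps)
          qed
          from q[of "\<bar>gtz x\<bar>" "m * \<bar>rt x\<bar>" "m * \<bar>wt x\<bar>"] show ?thesis by (simp add: power_mult_distrib mult.assoc)
        qed
        finally show ?thesis by (simp add: add_increasing2)
      next
        case False
        have t2: "(tz x)\<^sup>2 \<le> m\<^sup>2" using elim power_mono[of "\<bar>tz x\<bar>" m 2] by simp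
        have "1 \<le> 4 * (\<tau> x - 1)\<^sup>2" using False power_mono[of 1 "2 * (1 - \<tau> x)" 2] by (simp add: power2_eq_square algebra_simps)
        moreover have "(\<rho> x)\<^sup>2 \<le> 2 + 2 * (f x)\<^sup>2"
        proof -
          have "\<rho> x = 1 + f x" by (simp add: f_def)
          then show ?thesis using zero_le_power2[of "1 - f x"] by (simp add: power2_sum power2_diff)
        qed
        ultimately have "(\<rho> x)\<^sup>2 \<le> 8 * (\<tau> x - 1)\<^sup>2 + 2 * (f x)\<^sup>2" by linarith
        then have "(\<rho> x)\<^sup>2 * (tz x)\<^sup>2 \<le> (8 * (\<tau> x - 1)\<^sup>2 + 2 * (f x)\<^sup>2) * m\<^sup>2" using t2 by (intro mult_mono) auto
        also have "\<dots> \<le> 12 * (gtz x)\<^sup>2 + 12 * m\<^sup>2 * (rt x)\<^sup>2 + 12 * m\<^sup>2 * (wt x)\<^sup>2 + (8 * (\<tau> x - 1)\<^sup>2 + 2 * (f x)\<^sup>2) * m\<^sup>2" by simp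
        finally show ?thesis by (simp add: algebra_simps)
      qed
    qed
  qed (use sqi in auto)
  also have "\<dots> = 12 * (\<integral>x. (gtz x)\<^sup>2 \<partial>Q) + 12 * m\<^sup>2 * (\<integral>x. (rt x)\<^sup>2 \<partial>Q) + 12 * m\<^sup>2 * (\<integral>x. (wt x)\<^sup>2 \<partial>Q)
    + 8 * m\<^sup>2 * (\<integral>x. (\<tau> x - 1)\<^sup>2 \<partial>Q) + 2 * m\<^sup>2 * (\<integral>x. (f x)\<^sup>2 \<partial>Q)" using sqi by simp
  finally show ?thesis .
qed

text \<open>The mean of \<open>1 - \<zeta>\<close> is the prescribed compression \<open>lam\<close>. For \<open>0 \<le> \<zeta> \<le> 1\<close> it is at most
  \<open>1 - \<zeta>\<^sup>2\<close>, which is \<open>rz\<^sup>2 + \<rho>\<^sup>2 * tz\<^sup>2 - gzz\<close>. This is where the monotonicity of the height enters.\<close>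

lemma compression_estimate:
  assumes g: "square_integrable gzz"
  shows "2 * pi * lam \<le> (\<integral>x. \<bar>gzz x\<bar> \<partial>Q) + (\<integral>x. (rz x)\<^sup>2 \<partial>Q) + (\<integral>x. (\<rho> x)\<^sup>2 * (tz x)\<^sup>2 \<partial>Q)"
proof -
  have i: "integrable Q \<zeta>" "integrable Q (\<lambda>x. (rz x)\<^sup>2)" "integrable Q (\<lambda>x. \<bar>gzz x\<bar>)"
    using square_integrable_components(4,6)[of e_z] integrable_sq[OF g] by (auto simp: square_integrable_def integrable_sq)
  have "(\<integral>x. \<zeta> x - (1 - lam) \<partial>Q) = 0" by (rule integral_zero_mean[OF Z_per]) (use i in auto)
  then have "2 * pi * lam = (\<integral>x. 1 - \<zeta> x \<partial>Q)" using i by (simp add: measure_Q algebra_simps)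
  also have "\<dots> \<le> (\<integral>x. \<bar>gzz x\<bar> + (rz x)\<^sup>2 + (\<rho> x)\<^sup>2 * (tz x)\<^sup>2 \<partial>Q)"
  proof (rule integral_mono_AE)
    show "AE x in Q. 1 - \<zeta> x \<le> \<bar>gzz x\<bar> + (rz x)\<^sup>2 + (\<rho> x)\<^sup>2 * (tz x)\<^sup>2"
      using Z_mono
    proof eventually_elim
      case (elim x)
      show ?case
      proof (cases "\<zeta> x \<le> 1")
        case True
        then have "(\<zeta> x)\<^sup>2 \<le> \<zeta> x" using elim by (simp add: power2_eq_square mult_left_le)
        then show ?thesis unfolding gzz_def by linarith
      next
        case False
        then have "1 - \<zeta> x \<le> 0" by simp
        also have "0 \<le> \<bar>gzz x\<bar> + (rz x)\<^sup>2 + (\<rho> x)\<^sup>2 * (tz x)\<^sup>2" by simp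
        finally show ?thesis .
      qed
    qed
  qed (use i sq_\<rho>tz in auto)
  also have "\<dots> = (\<integral>x. \<bar>gzz x\<bar> \<partial>Q) + (\<integral>x. (rz x)\<^sup>2 \<partial>Q) + (\<integral>x. (\<rho> x)\<^sup>2 * (tz x)\<^sup>2 \<partial>Q)" using i sq_\<rho>tz by simp
  finally show ?thesis .
qed

text \<open>The radial component \<open>A\<close> of the axial curvature is \<open>rzz - \<rho> * tz\<^sup>2\<close>, so it controls \<open>rzz\<close> up to the twist.\<close>

lemma curvature_estimate:
  assumes A: "integrable Q (\<lambda>x. (A e_z e_z x)\<^sup>2)"
  shows "(\<integral>x. (rzz x)\<^sup>2 \<partial>Q) \<le> 2 * (\<integral>x. (A e_z e_z x)\<^sup>2 \<partial>Q) + 2 * m\<^sup>2 * (\<integral>x. (\<rho> x)\<^sup>2 * (tz x)\<^sup>2 \<partial>Q)"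
proof -
  have i: "integrable Q (\<lambda>x. (rzz x)\<^sup>2)" using square_integrable_components(7)[of e_z e_z] by (simp add: square_integrable_def)
  have "(\<integral>x. (rzz x)\<^sup>2 \<partial>Q) \<le> (\<integral>x. 2 * (A e_z e_z x)\<^sup>2 + 2 * m\<^sup>2 * ((\<rho> x)\<^sup>2 * (tz x)\<^sup>2) \<partial>Q)"
  proof (rule integral_mono_AE[OF i])
    show "AE x in Q. (rzz x)\<^sup>2 \<le> 2 * (A e_z e_z x)\<^sup>2 + 2 * m\<^sup>2 * ((\<rho> x)\<^sup>2 * (tz x)\<^sup>2)"
      using all_bounds
    proof eventually_elim
      case (elim x)
      have t2: "(tz x)\<^sup>2 \<le> m\<^sup>2" using elim power_mono[of "\<bar>tz x\<bar>" m 2] by simp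
      have "rzz x = A e_z e_z x + \<rho> x * (tz x)\<^sup>2" by (simp add: A_def power2_eq_square)
      then have "(rzz x)\<^sup>2 \<le> 2 * (A e_z e_z x)\<^sup>2 + 2 * (\<rho> x * (tz x)\<^sup>2)\<^sup>2"
        using zero_le_power2[of "A e_z e_z x - \<rho> x * (tz x)\<^sup>2"] by (simp add: power2_sum power2_diff)
      also have "(\<rho> x * (tz x)\<^sup>2)\<^sup>2 = (tz x)\<^sup>2 * ((\<rho> x)\<^sup>2 * (tz x)\<^sup>2)" by (simp add: power2_eq_square)
      also have "\<dots> \<le> m\<^sup>2 * ((\<rho> x)\<^sup>2 * (tz x)\<^sup>2)" using t2 by (intro mult_right_mono) auto
      finally show ?case by simp
    qed
  qed (use A sq_\<rho>tz in auto)
  also have "\<dots> = 2 * (\<integral>x. (A e_z e_z x)\<^sup>2 \<partial>Q) + 2 * m\<^sup>2 * (\<integral>x. (\<rho> x)\<^sup>2 * (tz x)\<^sup>2 \<partial>Q)" using A sq_\<rho>tz by simp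
  finally show ?thesis .
qed

text \<open>With \<open>A\<close> the radial component of the angular curvature, which is \<open>-1\<close> on the unit cylinder,
  \<open>A\<^sup>2 \<ge> - 2 * A - 1\<close> and \<open>- A \<ge> \<tau>\<^sup>2 - \<rho>\<^sub>\<theta>\<^sub>\<theta> \<ge> 2 * \<tau> - 1 - \<rho>\<^sub>\<theta>\<^sub>\<theta>\<close>. The means of \<open>\<tau>\<close> and of the second
  derivative \<open>\<rho>\<^sub>\<theta>\<^sub>\<theta>\<close> are one and zero.\<close>

lemma bulk_bending:
  assumes A: "integrable Q (\<lambda>x. (A e_theta e_theta x)\<^sup>2)"
  shows "2 * pi \<le> (\<integral>x. (A e_theta e_theta x)\<^sup>2 \<partial>Q)"
proof -
  have i: "integrable Q (\<rho>2 e_theta e_theta)" "integrable Q \<tau>" using square_integrable_components(7)[of e_theta e_theta] square_integrable_components(5)[of e_theta] by (simp_all add: integrable_sq)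
  have 1: "(\<integral>x. \<rho>2 e_theta e_theta x \<partial>Q) = 0" by (rule integral_zero_mean[OF \<rho>_per(2)[OF e_Basis(1) e_Basis(1)] i(1)])
  have "(\<integral>x. \<tau> x - 1 \<partial>Q) = 0" by (rule integral_zero_mean[OF T_per]) (use i in auto)
  then have 2: "(\<integral>x. \<tau> x \<partial>Q) = 2 * pi" using i by (simp add: measure_Q)
  have "2 * pi = (\<integral>x. 4 * \<tau> x - 3 - 2 * \<rho>2 e_theta e_theta x \<partial>Q)" using i 1 2 by (simp add: measure_Q)
  also have "\<dots> \<le> (\<integral>x. (A e_theta e_theta x)\<^sup>2 \<partial>Q)"
  proof (rule integral_mono_AE)
    show "AE x in Q. 4 * \<tau> x - 3 - 2 * \<rho>2 e_theta e_theta x \<le> (A e_theta e_theta x)\<^sup>2"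
      using \<rho>_ge
    proof eventually_elim
      case (elim x)
      have "0 \<le> (A e_theta e_theta x + 1)\<^sup>2" by simp
      then have "- 2 * A e_theta e_theta x - 1 \<le> (A e_theta e_theta x)\<^sup>2" by (simp add: power2_sum)
      moreover have "1 * (\<tau> x)\<^sup>2 \<le> \<rho> x * (\<tau> x)\<^sup>2" using elim by (intro mult_right_mono) auto
      moreover have "2 * \<tau> x - 1 \<le> (\<tau> x)\<^sup>2" using zero_le_power2[of "\<tau> x - 1"] by (simp add: power2_diff)
      moreover have "A e_theta e_theta x = \<rho>2 e_theta e_theta x - \<rho> x * (\<tau> x)\<^sup>2" by (simp add: A_def power2_eq_square)
      ultimately show ?case by linarith
    qed
  qed (use i A in auto)
  finally show ?thesis .
qed

lemma A_meas: "i \<in> Basis \<Longrightarrow> A i i \<in> borel_measurable borel"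
  unfolding A_def[abs_def] by (intro borel_measurable_diff borel_measurable_times measurable_components)

lemma g_meas[measurable]: "gtz \<in> borel_measurable borel" "gzz \<in> borel_measurable borel"
  unfolding gtz_def[abs_def] gzz_def[abs_def] by measurable

text \<open>The dropped terms are squares; among them is one of the two equal off-diagonal entries of the strain.\<close>

lemma dens_lower: "(gtt x)\<^sup>2 + (gtz x)\<^sup>2 + (gzz x)\<^sup>2 + h\<^sup>2 * (A e_theta e_theta x)\<^sup>2 + h\<^sup>2 * (A e_z e_z x)\<^sup>2 \<le> dens h x"
proof -
  have e: "rt x * rt x + (\<rho> x)\<^sup>2 * \<tau> x * \<tau> x + wt x * wt x - 1 = gtt x"
    "rt x * rz x + (\<rho> x)\<^sup>2 * \<tau> x * tz x + wt x * \<zeta> x = gtz x"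
    "rz x * rz x + (\<rho> x)\<^sup>2 * tz x * tz x + \<zeta> x * \<zeta> x - 1 = gzz x"
    by (simp_all add: gtt_def gtz_def gzz_def f_def power2_eq_square)
  define R where "R = (A e_theta e_z x)\<^sup>2 + (A e_z e_theta x)\<^sup>2 + (B e_theta e_theta x)\<^sup>2 + (B e_theta e_z x)\<^sup>2 + (B e_z e_theta x)\<^sup>2 + (B e_z e_z x)\<^sup>2
     + (Z2 e_theta e_theta x)\<^sup>2 + (Z2 e_theta e_z x)\<^sup>2 + (Z2 e_z e_theta x)\<^sup>2 + (Z2 e_z e_z x)\<^sup>2"
  define S where "S = (rz x * rt x + (\<rho> x)\<^sup>2 * tz x * \<tau> x + \<zeta> x * wt x)\<^sup>2"
  have "dens h x = (gtt x)\<^sup>2 + (gtz x)\<^sup>2 + S + (gzz x)\<^sup>2 + h\<^sup>2 * ((A e_theta e_theta x)\<^sup>2 + (A e_z e_z x)\<^sup>2 + R)"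
    unfolding dens_def sum_dirs e_inner diff_zero e S_def R_def distrib_left by linarith
  moreover have "h\<^sup>2 * R \<ge> 0" "S \<ge> 0" by (simp_all add: R_def S_def)
  ultimately show ?thesis by (simp add: distrib_left)
qed

text \<open>The angular bending term uses up the bulk energy, so each of the remaining terms is at most the excess.\<close>

lemma excess_bounds:
  assumes h: "h > 0" and \<epsilon>: "\<epsilon> \<ge> 0" and E: "(\<integral>\<^sup>+x. ennreal (dens h x) \<partial>Q) \<le> ennreal (2 * pi * h\<^sup>2 + \<epsilon>)"
  shows "square_integrable gtt" "square_integrable gtz" "square_integrable gzz" "(\<integral>x. (gtt x)\<^sup>2 \<partial>Q) \<le> \<epsilon>" "(\<integral>x. (gtz x)\<^sup>2 \<partial>Q) \<le> \<epsilon>" "(\<integral>x. (gzz x)\<^sup>2 \<partial>Q) \<le> \<epsilon>"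
    "integrable Q (\<lambda>x. (A e_z e_z x)\<^sup>2)" "(\<integral>x. (A e_z e_z x)\<^sup>2 \<partial>Q) \<le> \<epsilon> / h\<^sup>2"
proof -
  note [measurable] = A_meas[OF e_Basis(1)] A_meas[OF e_Basis(2)]
  have d0: "dens h x \<ge> 0" for x using order_trans[OF _ dens_lower[of x h]] by (simp add: add_nonneg_nonneg)
  have di: "integrable Q (dens h)"
  proof (rule integrableI_nonneg)
    show "(\<integral>\<^sup>+x. ennreal (dens h x) \<partial>Q) < \<infinity>" using E by (rule order_le_less_trans) simp
  qed (use d0 in auto)
  have dE: "(\<integral>x. dens h x \<partial>Q) \<le> 2 * pi * h\<^sup>2 + \<epsilon>"
    using E unfolding nn_integral_eq_integral[OF di AE_I2[OF d0]]
    by (subst (asm) ennreal_le_iff) (use h \<epsilon> in auto)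
  have part: "integrable Q p" if "p \<in> borel_measurable borel" "\<And>x. 0 \<le> p x" "\<And>x. p x \<le> dens h x" for p
    by (rule Bochner_Integration.integrable_bound[OF di]) (use that d0 in auto)
  have dl: "(gtt x)\<^sup>2 \<le> dens h x" "(gtz x)\<^sup>2 \<le> dens h x" "(gzz x)\<^sup>2 \<le> dens h x"
    "h\<^sup>2 * (A e_theta e_theta x)\<^sup>2 \<le> dens h x" "h\<^sup>2 * (A e_z e_z x)\<^sup>2 \<le> dens h x" for x
  proof -
    have "(gtt x)\<^sup>2 \<ge> 0" "(gtz x)\<^sup>2 \<ge> 0" "(gzz x)\<^sup>2 \<ge> 0" "h\<^sup>2 * (A e_theta e_theta x)\<^sup>2 \<ge> 0" "h\<^sup>2 * (A e_z e_z x)\<^sup>2 \<ge> 0" by simp_all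
    with dens_lower[of x h] show "(gtt x)\<^sup>2 \<le> dens h x" "(gtz x)\<^sup>2 \<le> dens h x" "(gzz x)\<^sup>2 \<le> dens h x"
      "h\<^sup>2 * (A e_theta e_theta x)\<^sup>2 \<le> dens h x" "h\<^sup>2 * (A e_z e_z x)\<^sup>2 \<le> dens h x" by linarith+
  qed
  have i: "integrable Q (\<lambda>x. (gtt x)\<^sup>2)" "integrable Q (\<lambda>x. (gtz x)\<^sup>2)" "integrable Q (\<lambda>x. (gzz x)\<^sup>2)"
    and i': "integrable Q (\<lambda>x. h\<^sup>2 * (A e_theta e_theta x)\<^sup>2)" "integrable Q (\<lambda>x. h\<^sup>2 * (A e_z e_z x)\<^sup>2)"
    by (rule part[OF _ _ dl(1)] part[OF _ _ dl(2)] part[OF _ _ dl(3)] part[OF _ _ dl(4)] part[OF _ _ dl(5)]; simp)+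
  show "square_integrable gtt" "square_integrable gtz" "square_integrable gzz" using i by (auto simp: square_integrable_def)
  have hn: "h\<^sup>2 \<noteq> 0" using h by simp
  have iA: "integrable Q (\<lambda>x. (A e_theta e_theta x)\<^sup>2)" "integrable Q (\<lambda>x. (A e_z e_z x)\<^sup>2)"
    using i' hn by auto
  then show "integrable Q (\<lambda>x. (A e_z e_z x)\<^sup>2)" by simp
  have "(\<integral>x. (gtt x)\<^sup>2 + (gtz x)\<^sup>2 + (gzz x)\<^sup>2 + h\<^sup>2 * (A e_theta e_theta x)\<^sup>2 + h\<^sup>2 * (A e_z e_z x)\<^sup>2 \<partial>Q) \<le> 2 * pi * h\<^sup>2 + \<epsilon>"
    by (rule order_trans[OF integral_mono dE]) (use i i' di dens_lower in auto)
  then have "(\<integral>x. (gtt x)\<^sup>2 \<partial>Q) + (\<integral>x. (gtz x)\<^sup>2 \<partial>Q) + (\<integral>x. (gzz x)\<^sup>2 \<partial>Q) + h\<^sup>2 * (\<integral>x. (A e_theta e_theta x)\<^sup>2 \<partial>Q) + h\<^sup>2 * (\<integral>x. (A e_z e_z x)\<^sup>2 \<partial>Q) \<le> 2 * pi * h\<^sup>2 + \<epsilon>"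
    using i iA by simp
  moreover have "2 * pi * h\<^sup>2 \<le> h\<^sup>2 * (\<integral>x. (A e_theta e_theta x)\<^sup>2 \<partial>Q)"
    using mult_left_mono[OF bulk_bending[OF iA(1)], of "h\<^sup>2"] by (simp add: mult_ac)
  moreover have "(\<integral>x. (gtt x)\<^sup>2 \<partial>Q) \<ge> 0" "(\<integral>x. (gtz x)\<^sup>2 \<partial>Q) \<ge> 0" "(\<integral>x. (gzz x)\<^sup>2 \<partial>Q) \<ge> 0" "h\<^sup>2 * (\<integral>x. (A e_z e_z x)\<^sup>2 \<partial>Q) \<ge> 0"
    by (auto intro: integral_nonneg_AE)
  ultimately have r: "(\<integral>x. (gtt x)\<^sup>2 \<partial>Q) \<le> \<epsilon>" "(\<integral>x. (gtz x)\<^sup>2 \<partial>Q) \<le> \<epsilon>" "(\<integral>x. (gzz x)\<^sup>2 \<partial>Q) \<le> \<epsilon>" "h\<^sup>2 * (\<integral>x. (A e_z e_z x)\<^sup>2 \<partial>Q) \<le> \<epsilon>"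
    by linarith+
  then show "(\<integral>x. (gtt x)\<^sup>2 \<partial>Q) \<le> \<epsilon>" "(\<integral>x. (gtz x)\<^sup>2 \<partial>Q) \<le> \<epsilon>" "(\<integral>x. (gzz x)\<^sup>2 \<partial>Q) \<le> \<epsilon>" by auto
  show "(\<integral>x. (A e_z e_z x)\<^sup>2 \<partial>Q) \<le> \<epsilon> / h\<^sup>2" using r(4) h by (simp add: field_simps)
qed

end

section \<open>The lower bound\<close>

text \<open>If \<open>lam \<le> 4 * C * \<surd>\<epsilon>\<close>, the alternative \<open>lam\<^sup>2\<close> holds. Otherwise the term \<open>\<surd>\<epsilon>\<close> in the first hypothesis can be
  absorbed into \<open>lam\<close>. In the other hypothesis, \<open>N\<close> is taken as large as possible with the first term at most
  \<open>lam / 4\<close>, so that the second term has to account for the rest of \<open>lam\<close>.\<close>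

lemma scalar_lower_bound:
  fixes C h lam \<epsilon> :: real
  assumes C: "C \<ge> 1" and h: "h > 0" and lam: "lam > 0" and \<epsilon>: "0 < \<epsilon>"
    and a: "lam \<le> C * (sqrt \<epsilon> + \<epsilon> powr (11/12) / h)"
    and b: "\<And>N::nat. N \<ge> 1 \<Longrightarrow> lam \<le> C * (real N * sqrt \<epsilon> + \<epsilon> / (h\<^sup>2 * (real N)\<^sup>2))"
  shows "min (max (h * lam powr (3/2)) ((h * lam) powr (12/11))) (lam\<^sup>2) \<le> 16 * C\<^sup>2 * \<epsilon>"
proof (cases "lam \<le> 4 * C * sqrt \<epsilon>")
  case True
  then have "lam\<^sup>2 \<le> (4 * C * sqrt \<epsilon>)\<^sup>2" using lam by (intro power_mono) auto
  also have "\<dots> = 16 * C\<^sup>2 * \<epsilon>" using \<epsilon> by (simp add: power_mult_distrib)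
  finally show ?thesis by simp
next
  case False
  define e where "e = sqrt \<epsilon>"
  have e: "e > 0" "e\<^sup>2 = \<epsilon>" using \<epsilon> by (auto simp: e_def)
  have Ce: "4 * C * e < lam" using False by (simp add: e_def)
  have "(h * lam) powr (12/11) \<le> 16 * C\<^sup>2 * \<epsilon>"
  proof -
    have "lam \<le> lam / 4 + C * (\<epsilon> powr (11/12) / h)" using a Ce by (simp add: e_def algebra_simps)
    then have "lam * (3/4) \<le> C * (\<epsilon> powr (11/12) / h)" by linarith
    from mult_left_mono[OF this, of h] have "(h * lam) * (3/4) \<le> C * \<epsilon> powr (11/12)" using h by simp
    moreover have "C * \<epsilon> powr (11/12) \<ge> 0" using C by simp
    ultimately have "h * lam \<le> 2 * C * \<epsilon> powr (11/12)" by linarith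
    then have "(h * lam) powr (12/11) \<le> (2 * C * \<epsilon> powr (11/12)) powr (12/11)" using h lam by (intro powr_mono2) auto
    also have "\<dots> = (2 * C) powr (12/11) * \<epsilon>" using C \<epsilon> by (simp add: powr_mult powr_powr)
    also have "\<dots> \<le> 16 * C\<^sup>2 * \<epsilon>"
    proof (rule mult_right_mono)
      have "(2 * C) powr (12/11) \<le> (2 * C) powr 2" using C by (intro powr_mono) auto
      also have "\<dots> = 4 * C\<^sup>2" using C by (simp add: power_mult_distrib)
      also have "\<dots> \<le> 16 * C\<^sup>2" by simp
      finally show "(2 * C) powr (12/11) \<le> 16 * C\<^sup>2" .
    qed (use \<epsilon> in simp)
    finally show ?thesis .
  qed
  moreover have "h * lam powr (3/2) \<le> 16 * C\<^sup>2 * \<epsilon>"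
  proof -
    \<comment> \<open>The number of strips is the integer part of \<open>x > 1\<close>, which is between \<open>x / 2\<close> and \<open>x\<close>.\<close>
    define x where "x = lam / (4 * C * e)"
    have x: "x > 1" using Ce C e by (simp add: x_def)
    define N where "N = nat \<lfloor>x\<rfloor>"
    have f: "1 \<le> \<lfloor>x\<rfloor>" using x by (simp add: le_floor_iff)
    have rN: "real N = real_of_int \<lfloor>x\<rfloor>" using f by (simp add: N_def)
    have f': "1 \<le> real_of_int \<lfloor>x\<rfloor>" using f by linarith
    have N: "N \<ge> 1" "real N \<le> x" "x \<le> 2 * real N"
      using f f' rN of_int_floor_le[of x] real_of_int_floor_add_one_gt[of x] by linarith+
    have "lam \<le> C * (real N * e + \<epsilon> / (h\<^sup>2 * (real N)\<^sup>2))" using b[OF N(1)] by (simp add: e_def)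
    also have "\<dots> = C * e * real N + C * (\<epsilon> / (h\<^sup>2 * (real N)\<^sup>2))" by (simp add: algebra_simps)
    also have "C * e * real N \<le> C * e * x" using N C e by (intro mult_left_mono) auto
    also have "C * e * x = lam / 4" using C e by (simp add: x_def)
    also have "C * (\<epsilon> / (h\<^sup>2 * (real N)\<^sup>2)) \<le> C * (\<epsilon> / (h\<^sup>2 * (x / 2)\<^sup>2))"
      using N x C \<epsilon> h by (intro mult_left_mono divide_left_mono mult_pos_pos power_mono) auto
    also have "\<dots> = 64 * C ^ 3 * \<epsilon>\<^sup>2 / (h\<^sup>2 * lam\<^sup>2)"
      using C e h lam unfolding x_def e(2)[symmetric] by (simp add: field_simps power2_eq_square power3_eq_cube)
    finally have "lam * (3/4) \<le> 64 * C ^ 3 * \<epsilon>\<^sup>2 / (h\<^sup>2 * lam\<^sup>2)" by simp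
    then have "(lam * (3/4)) * (h\<^sup>2 * lam\<^sup>2) \<le> 64 * C ^ 3 * \<epsilon>\<^sup>2" using h lam by (simp add: pos_le_divide_eq)
    then have "h\<^sup>2 * lam ^ 3 \<le> 64 * C ^ 3 * \<epsilon>\<^sup>2 * (4/3)" by (simp add: power2_eq_square power3_eq_cube field_simps)
    also have "\<dots> \<le> 256 * C ^ 4 * \<epsilon>\<^sup>2"
    proof -
      have "C ^ 3 * \<epsilon>\<^sup>2 \<le> C ^ 4 * \<epsilon>\<^sup>2" using C by (intro mult_right_mono power_increasing) auto
      moreover have "C ^ 4 * \<epsilon>\<^sup>2 \<ge> 0" using C by simp
      moreover have "64 * C ^ 3 * \<epsilon>\<^sup>2 * (4/3) = 256 / 3 * (C ^ 3 * \<epsilon>\<^sup>2)" "256 * C ^ 4 * \<epsilon>\<^sup>2 = 256 * (C ^ 4 * \<epsilon>\<^sup>2)" by simp_all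
      ultimately show ?thesis by linarith
    qed
    also have "\<dots> = (16 * C\<^sup>2 * \<epsilon>)\<^sup>2" by (simp add: power_mult_distrib flip: power_mult)
    also have "h\<^sup>2 * lam ^ 3 = (h * lam powr (3/2))\<^sup>2"
    proof -
      have "(lam powr (3/2))\<^sup>2 = lam powr 3" using lam by (simp add: power2_eq_square powr_add[symmetric])
      then show ?thesis using lam by (simp add: power_mult_distrib)
    qed
    finally show ?thesis by (rule power2_le_imp_le) (use C \<epsilon> in auto)
  qed
  ultimately show ?thesis by simp
qed

context admissible
begin

text \<open>All estimates combined, with \<open>e = \<surd>\<epsilon>\<close>. The curvature \<open>R\<close> is at most of order \<open>\<epsilon> / h\<^sup>2 + e\<close>, and the twist \<open>W\<close> of order
  \<open>e\<close>, so that the axial slope \<open>S\<close> has to account for \<open>lam\<close> up to \<open>e\<close>. For the first bound, the window length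
  \<open>l = \<epsilon> powr (1/6)\<close> balances \<open>\<epsilon> / l\<close> and \<open>l\<^sup>2 * e\<close> and bounds the integral of \<open>f\<^sup>2\<close> by a multiple of
  \<open>\<epsilon> powr (5/6)\<close>.\<close>

lemma compression_bounds:
  assumes m: "m \<ge> 1" and h: "h > 0" and \<epsilon>: "0 < \<epsilon>" "\<epsilon> \<le> 1" and lam: "lam \<ge> 0"
    and E: "(\<integral>\<^sup>+x. ennreal (dens h x) \<partial>Q) \<le> ennreal (2 * pi * h\<^sup>2 + \<epsilon>)"
  defines "C \<equiv> 423 * m ^ 4 * (2 + (1 + m)\<^sup>2 + 4 * pi * m)\<^sup>2"
  shows "lam \<le> C * (sqrt \<epsilon> + \<epsilon> powr (11/12) / h)"
    and "\<And>N::nat. N \<ge> 1 \<Longrightarrow> lam \<le> C * (real N * sqrt \<epsilon> + \<epsilon> / (h\<^sup>2 * (real N)\<^sup>2))"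
proof -
  have m0: "m \<ge> 0" using m by simp
  note X = excess_bounds[OF h less_imp_le[OF \<epsilon>(1)] E]
  define e where "e = sqrt \<epsilon>"
  have e: "0 < e" "e \<le> 1" "e\<^sup>2 = \<epsilon>" "\<epsilon> \<le> e"
  proof -
    show e0: "0 < e" and e2: "e\<^sup>2 = \<epsilon>" using \<epsilon> by (auto simp: e_def)
    show e1: "e \<le> 1" using real_sqrt_le_mono[OF \<epsilon>(2)] by (simp add: e_def)
    show "\<epsilon> \<le> e" using mult_left_mono[OF e1, of e] e0 unfolding e2[symmetric] by (simp add: power2_eq_square)
  qed
  have nn: "(\<integral>x. (g x)\<^sup>2 \<partial>Q) \<ge> 0" for g :: "real \<times> real \<Rightarrow> real" by (rule integral_nonneg_AE) simp
  define C1 where "C1 = 1 + (1 + m)\<^sup>2 + 4 * pi * m"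
  define K where "K = C1 + 1"
  have C1: "C1 \<ge> 1" using m by (simp add: C1_def)
  have K: "K \<ge> 1" "C1 \<le> K" using C1 by (auto simp: K_def)
  have CK: "C = 423 * (m ^ 4 * K\<^sup>2)" by (simp add: C_def K_def C1_def add_ac)
  have L1: "(\<integral>x. \<bar>g x\<bar> \<partial>Q) \<le> 3 * e" if "square_integrable g" "(\<integral>x. (g x)\<^sup>2 \<partial>Q) \<le> \<epsilon>" for g
  proof -
    have "(\<integral>x. \<bar>g x\<bar> \<partial>Q)\<^sup>2 \<le> 2 * pi * (\<integral>x. (g x)\<^sup>2 \<partial>Q)" using Qf.square_of_L1_norm_le[OF integrable_sq[OF that(1)]] that(1) by (simp add: square_integrable_def measure_Q)
    also have "\<dots> \<le> 9 * \<epsilon>" using that(2) pi_less_4 nn[of g] by (intro mult_mono) auto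
    also have "\<dots> = (3 * e)\<^sup>2" using e by (simp add: power_mult_distrib)
    finally show ?thesis by (rule power2_le_imp_le) (use e in simp)
  qed
  define \<alpha> where "\<alpha> = (\<integral>x. \<bar>gtt x\<bar> \<partial>Q)"
  have \<alpha>: "\<alpha> \<le> 3 * e" unfolding \<alpha>_def by (rule L1[OF X(1,4)])
  note T = theta_estimates[OF m0 X(1), folded C1_def \<alpha>_def, folded K_def]
  have f1: "(\<integral>x. f x \<partial>Q) \<le> 3 * K * e"
  proof -
    have "C1 * \<alpha> \<le> K * (3 * e)" using \<alpha> K C1 e by (intro mult_mono) (auto simp: \<alpha>_def)
    then show ?thesis using T(4) by simp
  qed
  have f2: "(\<integral>x. (f x)\<^sup>2 \<partial>Q) \<le> K\<^sup>2 * (7 * (\<epsilon> / l) + 3 * (l\<^sup>2 * e))" if l: "0 < l" "l \<le> 1" for l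
  proof -
    have "2 * pi * (\<integral>x. (gtt x)\<^sup>2 \<partial>Q) \<le> 7 * \<epsilon>" using X(4) pi_approx(2) nn[of gtt] by (intro mult_mono) auto
    then have "2 * pi * (\<integral>x. (gtt x)\<^sup>2 \<partial>Q) / l \<le> 7 * (\<epsilon> / l)" using l by (simp add: divide_right_mono)
    moreover have "l\<^sup>2 * \<alpha> \<le> 3 * (l\<^sup>2 * e)" using mult_left_mono[OF \<alpha>, of "l\<^sup>2"] by simp
    ultimately have "K\<^sup>2 * (2 * pi * (\<integral>x. (gtt x)\<^sup>2 \<partial>Q) / l + l\<^sup>2 * \<alpha>) \<le> K\<^sup>2 * (7 * (\<epsilon> / l) + 3 * (l\<^sup>2 * e))"
      by (intro mult_left_mono add_mono) auto
    then show ?thesis using T(5)[OF l] by linarith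
  qed
  \<comment> \<open>All constants are expressed through \<open>P\<close>, which dominates every product of \<open>m\<close> and \<open>K\<close> that occurs; the
    strip bound then collects \<open>36 + 256 + 131 = 423\<close>.\<close>
  define P where "P = m ^ 4 * K\<^sup>2"
  have P: "m\<^sup>2 * K\<^sup>2 \<le> P" "m * K \<le> P" "K\<^sup>2 \<le> P" "1 \<le> P" "m\<^sup>2 \<le> m\<^sup>2 * K\<^sup>2" "1 \<le> m\<^sup>2 * K\<^sup>2" "1 \<le> m\<^sup>2"
  proof -
    have a: "1 \<le> m\<^sup>2" "1 \<le> K\<^sup>2" "K \<le> K\<^sup>2" "m \<le> m ^ 4" "m\<^sup>2 \<le> m ^ 4" "1 \<le> m ^ 4"
      by (rule one_le_power[OF m] one_le_power[OF K(1)] self_le_power[OF K(1)] self_le_power[OF m] power_increasing[OF _ m]; simp)+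
    then show "1 \<le> m\<^sup>2" by simp
    show "m\<^sup>2 * K\<^sup>2 \<le> P" using mult_right_mono[OF a(5), of "K\<^sup>2"] by (simp add: P_def)
    show "m * K \<le> P" using mult_mono[OF a(4) a(3)] m K by (simp add: P_def)
    show K2: "K\<^sup>2 \<le> P" using mult_right_mono[OF a(6), of "K\<^sup>2"] by (simp add: P_def)
    show "1 \<le> P" using K2 a(2) by linarith
    show m2: "m\<^sup>2 \<le> m\<^sup>2 * K\<^sup>2" using mult_left_mono[OF a(2), of "m\<^sup>2"] by simp
    show "1 \<le> m\<^sup>2 * K\<^sup>2" using m2 a(1) by linarith
  qed
  define W where "W = (\<integral>x. (\<rho> x)\<^sup>2 * (tz x)\<^sup>2 \<partial>Q)"
  have f2': "(\<integral>x. (f x)\<^sup>2 \<partial>Q) \<le> 10 * K\<^sup>2 * e"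
  proof -
    have "K\<^sup>2 * (7 * (\<epsilon> / 1) + 3 * (1\<^sup>2 * e)) \<le> K\<^sup>2 * (10 * e)" using e by (intro mult_left_mono) auto
    then show ?thesis using f2[of 1] by simp
  qed
  have W: "W \<le> 128 * (m\<^sup>2 * K\<^sup>2) * e"
  proof -
    have "W \<le> 12 * \<epsilon> + 12 * m\<^sup>2 * (3 * e) + 12 * m\<^sup>2 * (3 * e) + 8 * m\<^sup>2 * (3 * e) + 2 * m\<^sup>2 * (10 * K\<^sup>2 * e)"
      unfolding W_def
      by (rule order_trans[OF twist_estimate[OF m0 X(2)]])
         (intro add_mono mult_left_mono X f2' order_trans[OF T(1) \<alpha>] order_trans[OF T(2) \<alpha>] order_trans[OF T(3) \<alpha>]; simp)
    also have "\<dots> \<le> 12 * (m\<^sup>2 * K\<^sup>2 * e) + 96 * (m\<^sup>2 * K\<^sup>2 * e) + 20 * (m\<^sup>2 * K\<^sup>2 * e)"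
    proof -
      have "\<epsilon> \<le> m\<^sup>2 * K\<^sup>2 * e" using mult_right_mono[OF P(6), of e] e by linarith
      moreover have "m\<^sup>2 * e \<le> m\<^sup>2 * K\<^sup>2 * e" using mult_right_mono[OF P(5), of e] e by simp
      moreover have "12 * \<epsilon> + 12 * m\<^sup>2 * (3 * e) + 12 * m\<^sup>2 * (3 * e) + 8 * m\<^sup>2 * (3 * e) + 2 * m\<^sup>2 * (10 * K\<^sup>2 * e)
          = 12 * \<epsilon> + 96 * (m\<^sup>2 * e) + 20 * (m\<^sup>2 * K\<^sup>2 * e)" by (simp add: algebra_simps)
      ultimately show ?thesis by linarith
    qed
    finally show ?thesis by (simp add: mult_ac)
  qed
  define R where "R = (\<integral>x. (rzz x)\<^sup>2 \<partial>Q)"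
  have R: "R \<le> 2 * (\<epsilon> / h\<^sup>2) + 256 * P * e"
  proof -
    have "R \<le> 2 * (\<integral>x. (A e_z e_z x)\<^sup>2 \<partial>Q) + 2 * m\<^sup>2 * W"
      unfolding R_def W_def by (rule curvature_estimate[OF X(7)])
    also have "\<dots> \<le> 2 * (\<epsilon> / h\<^sup>2) + 2 * m\<^sup>2 * (128 * (m\<^sup>2 * K\<^sup>2) * e)"
      by (intro add_mono mult_left_mono X(8) W) auto
    also have "2 * m\<^sup>2 * (128 * (m\<^sup>2 * K\<^sup>2) * e) = 256 * P * e" by (simp add: P_def power2_eq_square power4_eq_xxxx)
    finally show ?thesis .
  qed
  define S where "S = (\<integral>x. (rz x)\<^sup>2 \<partial>Q)"
  have lS: "lam \<le> S + 131 * P * e"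
  proof -
    have "lam * 1 \<le> lam * (2 * pi)" using lam pi_gt3 by (intro mult_left_mono) auto
    also have "\<dots> \<le> 3 * e + S + W" using compression_estimate[OF X(3)] L1[OF X(3,6)] by (simp add: S_def W_def mult_ac)
    also have "\<dots> \<le> 3 * (P * e) + S + 128 * (P * e)"
    proof -
      have "1 * e \<le> P * e" "m\<^sup>2 * K\<^sup>2 * e \<le> P * e" using P(1,4) e by (intro mult_right_mono; simp)+
      moreover have "128 * (m\<^sup>2 * K\<^sup>2) * e = 128 * (m\<^sup>2 * K\<^sup>2 * e)" by simp
      ultimately show ?thesis using W by linarith
    qed
    finally show ?thesis by simp
  qed
  show "lam \<le> C * (real N * sqrt \<epsilon> + \<epsilon> / (h\<^sup>2 * (real N)\<^sup>2))" if N: "N \<ge> 1" for N :: nat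
  proof -
    have "S \<le> 12 * m * real N * (\<integral>x. f x \<partial>Q) + R / (real N)\<^sup>2"
      unfolding S_def R_def by (rule z_estimate_strips[OF m0 N])
    also have "12 * m * real N * (\<integral>x. f x \<partial>Q) \<le> 12 * m * real N * (3 * K * e)"
      by (intro mult_left_mono f1) (use m in auto)
    also have "R / (real N)\<^sup>2 \<le> (2 * (\<epsilon> / h\<^sup>2) + 256 * P * e) / (real N)\<^sup>2" using R by (intro divide_right_mono) auto
    also have "\<dots> = 2 * (\<epsilon> / (h\<^sup>2 * (real N)\<^sup>2)) + 256 * P * e / (real N)\<^sup>2" by (simp add: add_divide_distrib)
    also have "256 * P * e / (real N)\<^sup>2 \<le> 256 * P * e / 1"
      using N P e by (intro divide_left_mono) (auto simp: one_le_power)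
    finally have S: "S \<le> 36 * (m * K * e * real N) + 2 * (\<epsilon> / (h\<^sup>2 * (real N)\<^sup>2)) + 256 * (P * e)" by (simp add: mult_ac)
    have N1: "P * e \<le> P * e * real N" using mult_left_mono[of 1 "real N" "P * e"] N P(4) e by simp
    have "m * K * e * real N \<le> P * e * real N" using P(2) e by (intro mult_right_mono) auto
    then have "lam \<le> 423 * (P * e * real N) + 2 * (\<epsilon> / (h\<^sup>2 * (real N)\<^sup>2))" using S lS N1 by simp
    also have "2 * (\<epsilon> / (h\<^sup>2 * (real N)\<^sup>2)) \<le> 423 * P * (\<epsilon> / (h\<^sup>2 * (real N)\<^sup>2))"
      using P(4) \<epsilon> by (intro mult_right_mono) auto
    finally show ?thesis by (simp add: CK P_def e_def algebra_simps)
  qed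
  \<comment> \<open>The weight of the product estimate. The first summand balances \<open>k * \<epsilon> powr (5/6)\<close> and \<open>\<epsilon> / (h\<^sup>2 * k)\<close>; the second
    keeps \<open>k \<ge> 1\<close>, as needed for the part of the curvature bound of order \<open>e\<close>, and contributes only
    \<open>\<epsilon> powr (2/3) \<le> e\<close>.\<close>
  define k where "k = \<epsilon> powr (1/12) / h + \<epsilon> powr (-1/6)"
  have k: "k > 0" using \<epsilon> h by (simp add: k_def add_pos_pos)
  have p23: "\<epsilon> powr (2/3) \<le> e" unfolding e_def powr_half_sqrt[symmetric, OF less_imp_le[OF \<epsilon>(1)]] using \<epsilon> by (intro powr_mono') auto
  have f56: "(\<integral>x. (f x)\<^sup>2 \<partial>Q) \<le> 10 * K\<^sup>2 * \<epsilon> powr (5/6)"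
  proof -
    have a: "\<epsilon> / \<epsilon> powr (1/6) = \<epsilon> powr (5/6)"
      using \<epsilon> powr_diff[of \<epsilon> 1 "1/6"] by simp
    have b: "(\<epsilon> powr (1/6))\<^sup>2 * e = \<epsilon> powr (5/6)"
      unfolding e_def powr_half_sqrt[symmetric, OF less_imp_le[OF \<epsilon>(1)]] using \<epsilon> by (simp add: power2_eq_square powr_add[symmetric])
    have "\<epsilon> powr (1/6) \<le> 1" using \<epsilon> by (simp add: powr_le1)
    from f2[OF _ this] \<epsilon> show ?thesis unfolding a b by simp
  qed
  have "S \<le> (k * (\<integral>x. (f x)\<^sup>2 \<partial>Q) + R / k) / 2"
    unfolding S_def R_def by (rule z_estimate_product[OF k])
  also have "\<dots> \<le> (k * (10 * K\<^sup>2 * \<epsilon> powr (5/6)) + R / k) / 2"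
    by (intro divide_right_mono add_mono mult_left_mono f56 order_refl) (use k in auto)
  also have "\<dots> = 5 * K\<^sup>2 * (k * \<epsilon> powr (5/6)) + R / k / 2" by simp
  also have "k * \<epsilon> powr (5/6) = \<epsilon> powr (11/12) / h + \<epsilon> powr (2/3)"
    using \<epsilon> by (simp add: k_def distrib_right powr_add[symmetric])
  also have "R / k / 2 \<le> \<epsilon> powr (11/12) / h + 128 * P * e"
  proof -
    have "R / k \<le> (2 * (\<epsilon> / h\<^sup>2) + 256 * P * e) / k" using R k by (intro divide_right_mono) auto
    also have "\<dots> = 2 * (\<epsilon> / h\<^sup>2) / k + 256 * P * e / k" by (simp add: add_divide_distrib)
    also have "2 * (\<epsilon> / h\<^sup>2) / k \<le> 2 * (\<epsilon> / h\<^sup>2) / (\<epsilon> powr (1/12) / h)"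
      using \<epsilon> h k by (intro divide_left_mono) (auto simp: k_def add_pos_pos)
    also have "\<dots> = 2 * (\<epsilon> powr (11/12) / h)"
      using \<epsilon> h powr_diff[of \<epsilon> 1 "1/12"] by (simp add: power2_eq_square field_simps)
    also have "256 * P * e / k \<le> 256 * P * e / 1"
    proof (rule divide_left_mono)
      have "1 \<le> \<epsilon> powr (-1/6)" using \<epsilon> powr_mono'[of "-1/6" 0 \<epsilon>] by simp
      then show "1 \<le> k" using \<epsilon> h unfolding k_def by (intro add_increasing) auto
    qed (use P e k in auto)
    finally show ?thesis by simp
  qed
  finally have "S \<le> 5 * K\<^sup>2 * (\<epsilon> powr (11/12) / h + \<epsilon> powr (2/3)) + (\<epsilon> powr (11/12) / h + 128 * P * e)" by simp
  moreover have "5 * K\<^sup>2 * (\<epsilon> powr (11/12) / h + \<epsilon> powr (2/3)) \<le> 5 * K\<^sup>2 * (\<epsilon> powr (11/12) / h + e)"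
    using p23 by (intro mult_left_mono) auto
  ultimately have "S \<le> 5 * K\<^sup>2 * (\<epsilon> powr (11/12) / h + e) + \<epsilon> powr (11/12) / h + 128 * (P * e)" by linarith
  also have "\<dots> \<le> 5 * P * (\<epsilon> powr (11/12) / h + e) + P * (\<epsilon> powr (11/12) / h) + 128 * (P * e)"
    using P(3,4) e h mult_right_mono[OF P(4), of "\<epsilon> powr (11/12) / h"] by (intro add_mono mult_right_mono) auto
  finally have "lam \<le> 264 * (P * e) + 6 * (P * (\<epsilon> powr (11/12) / h))" using lS by (simp add: algebra_simps)
  also have "\<dots> \<le> 423 * (P * e) + 423 * (P * (\<epsilon> powr (11/12) / h))"
    using P(4) e h by (intro add_mono mult_right_mono) auto
  finally show "lam \<le> C * (sqrt \<epsilon> + \<epsilon> powr (11/12) / h)" by (simp add: CK P_def e_def algebra_simps)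
qed

end

text \<open>A deformation whose excess is below \<open>LB / C\<close> would contradict the scalar bound.\<close>

lemma energy_lower_bound:
  assumes m: "m \<ge> 1"
  shows "\<exists>C>0. \<forall>h\<in>{0<..1/2}. \<forall>lam\<in>{0<..1/2}.
            ereal (min (max (h * lam powr (3/2)) ((h * lam) powr (12/11))) (lam\<^sup>2))
              \<le> ereal C * (min_energy_NL lam 1 m h - ereal (bulk_energy_NL 1 h))"
proof -
  define C0 where "C0 = 423 * m ^ 4 * (2 + (1 + m)\<^sup>2 + 4 * pi * m)\<^sup>2"
  have C0: "C0 \<ge> 1"
  proof -
    have "1 \<le> m ^ 4" using m by simp
    moreover have "1 \<le> (2 + (1 + m)\<^sup>2 + 4 * pi * m)\<^sup>2" using m by (intro one_le_power) (simp add: add_increasing2)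
    ultimately have "1 * 1 \<le> m ^ 4 * (2 + (1 + m)\<^sup>2 + 4 * pi * m)\<^sup>2" by (intro mult_mono) auto
    then show ?thesis by (simp add: C0_def mult.assoc)
  qed
  define C where "C = 16 * C0\<^sup>2"
  have C: "C > 0" using C0 by (simp add: C_def)
  show ?thesis
  proof (intro exI[of _ C] conjI C ballI)
    fix h lam :: real assume "h \<in> {0<..1/2}" "lam \<in> {0<..1/2}"
    then have h: "0 < h" and lam: "0 < lam" "lam \<le> 1/2" by auto
    define LB where "LB = min (max (h * lam powr (3/2)) ((h * lam) powr (12/11))) (lam\<^sup>2)"
    have LB: "LB > 0" "LB \<le> 1"
    proof -
      show "LB > 0" using h lam by (auto simp: LB_def min_def max_def)
      have "lam\<^sup>2 \<le> 1\<^sup>2" using lam by (intro power_mono) auto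
      then show "LB \<le> 1" by (simp add: LB_def)
    qed
    have lower: "ennreal (2 * pi * h\<^sup>2 + LB / C) \<le> energy_NL h \<Phi>" if \<Phi>: "\<Phi> \<in> A_NL lam 1 m" for \<Phi>
    proof (rule ccontr)
      assume "\<not> ennreal (2 * pi * h\<^sup>2 + LB / C) \<le> energy_NL h \<Phi>"
      then have lt: "energy_NL h \<Phi> < ennreal (2 * pi * h\<^sup>2 + LB / C)" by simp
      then obtain E where E: "energy_NL h \<Phi> = ennreal E" "E \<ge> 0" by (cases "energy_NL h \<Phi>") auto
      have EB: "E < 2 * pi * h\<^sup>2 + LB / C" using lt E by (simp add: ennreal_less_iff)
      \<comment> \<open>The maximum only serves to have \<open>\<epsilon> > 0\<close>.\<close>
      define \<epsilon> where "\<epsilon> = max (E - 2 * pi * h\<^sup>2) (LB / (2 * C))"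
      have BC: "LB / C \<le> 1" using LB C C0 by (simp add: C_def) (smt (verit) one_le_power)
      have "0 < LB / (2 * C)" "LB / (2 * C) < LB / C" using LB C by (auto intro!: divide_strict_left_mono)
      then have \<epsilon>: "0 < \<epsilon>" "\<epsilon> < LB / C" using EB by (auto simp: \<epsilon>_def less_max_iff_disj)
      obtain \<rho> T Z \<rho>1 T1 Z1 \<rho>2 T2 Z2 where adm: "admissible \<rho> T Z \<rho>1 T1 Z1 \<rho>2 T2 Z2 m lam"
        and en: "energy_NL h \<Phi> = (\<integral>\<^sup>+x. ennreal (cylindrical.dens \<rho> \<rho>1 T1 Z1 \<rho>2 T2 Z2 h x) \<partial>Q)"
        using A_NL_admissible[OF \<Phi>] by blast
      interpret admissible \<rho> T Z \<rho>1 T1 Z1 \<rho>2 T2 Z2 m lam by (rule adm)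
      have "(\<integral>\<^sup>+x. ennreal (dens h x) \<partial>Q) \<le> ennreal (2 * pi * h\<^sup>2 + \<epsilon>)"
        unfolding en[symmetric] E(1) by (intro ennreal_leI) (simp add: \<epsilon>_def)
      note bounds = compression_bounds[OF m h \<epsilon>(1) _ less_imp_le[OF lam(1)] this, folded C0_def]
      have "\<epsilon> \<le> 1" using \<epsilon> BC by simp
      then have "LB \<le> C * \<epsilon>" unfolding LB_def C_def
        by (intro scalar_lower_bound[OF C0 h lam(1) \<epsilon>(1)] bounds)
      also have "\<dots> < C * (LB / C)" using \<epsilon> C by (intro mult_strict_left_mono) auto
      finally show False using C by simp
    qed
    have "ennreal (2 * pi * h\<^sup>2 + LB / C) \<le> (INF \<Phi>\<in>A_NL lam 1 m. energy_NL h \<Phi>)" by (intro INF_greatest lower)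
    then have "enn2ereal (ennreal (2 * pi * h\<^sup>2 + LB / C)) \<le> min_energy_NL lam 1 m h"
      unfolding min_energy_NL_def by (simp only: less_eq_ennreal.rep_eq)
    then have le: "ereal (2 * pi * h\<^sup>2 + LB / C) \<le> min_energy_NL lam 1 m h"
      by (subst (asm) enn2ereal_ennreal) (use LB C in auto)
    have "ereal LB = ereal C * ereal (LB / C)" using C by simp
    also have "\<dots> \<le> ereal C * (min_energy_NL lam 1 m h - ereal (bulk_energy_NL 1 h))"
    proof (rule ereal_mult_left_mono)
      have "ereal (LB / C) = ereal (2 * pi * h\<^sup>2 + LB / C) - ereal (2 * pi * h\<^sup>2)" by simp
      also have "\<dots> \<le> min_energy_NL lam 1 m h - ereal (2 * pi * h\<^sup>2)" by (intro ereal_minus_mono le order_refl)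
      finally show "ereal (LB / C) \<le> min_energy_NL lam 1 m h - ereal (bulk_energy_NL 1 h)" by (simp add: bulk_one)
    qed (use C in simp)
    finally show "ereal (min (max (h * lam powr (3/2)) ((h * lam) powr (12/11))) (lam\<^sup>2)) \<le> ereal C * (min_energy_NL lam 1 m h - ereal (bulk_energy_NL 1 h))"
      by (simp only: LB_def)
  qed
qed

section \<open>The upper bound\<close>

lemma twice_of_z:
  fixes U U1 U2 :: "real \<Rightarrow> real"
  assumes d: "\<And>t. (U has_real_derivative U1 t) (at t)" "\<And>t. (U1 has_real_derivative U2 t) (at t)" and c: "continuous_on UNIV U2"
  shows "twice_diff (\<lambda>x. U (snd x)) (\<lambda>i x. if i = e_z then U1 (snd x) else 0) (\<lambda>i j x. if i = e_z \<and> j = e_z then U2 (snd x) else 0)"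
proof -
  have cU: "continuous_on UNIV U" "continuous_on UNIV U1"
    using DERIV_isCont[OF d(1)] DERIV_isCont[OF d(2)] by (simp_all add: continuous_at_imp_continuous_on)
  have cs: "continuous_on UNIV (\<lambda>x::real\<times>real. V (snd x))" if "continuous_on UNIV V" for V :: "real \<Rightarrow> real"
    using continuous_coords(2)[OF that, of e_z] by (simp add: line_coord_def)
  have sqc: "square_integrable V" if V: "continuous_on UNIV V" for V
  proof -
    obtain K where K: "\<And>x. x \<in> Omega \<Longrightarrow> \<bar>V x\<bar> \<le> K" using bounded_on_Omega[OF V] by blast
    show ?thesis
      by (rule sq_bounded[OF borel_measurable_continuous_onI[OF V], where K=K]) (use AE_Q_Omega in \<open>eventually_elim, simp add: K\<close>)
  qed
  have W: "WD i (\<lambda>x. V (snd x)) (\<lambda>x. if i = e_z then V1 (snd x) else 0)"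
    if "\<And>t. (V has_real_derivative V1 t) (at t)" "continuous_on UNIV V" "continuous_on UNIV V1" for i and V V1 :: "real \<Rightarrow> real"
  proof (cases "i = e_z")
    case True
    show ?thesis using True by (intro WD_C1) (auto simp: pt_def that cs)
  next
    case False
    show ?thesis using False by (intro WD_C1) (auto simp: pt_def that cs)
  qed
  have W0: "WD i (\<lambda>x. 0) (\<lambda>x. 0)" for i by (rule WD_C1) (auto intro!: continuous_intros)
  show ?thesis
    unfolding twice_diff_def
  proof (intro conjI ballI)
    show "square_integrable (\<lambda>x. U (snd x))" by (intro sqc cs cU)
    fix i j :: "real \<times> real"
    show "square_integrable (\<lambda>x. if i = e_z then U1 (snd x) else 0)" by (cases "i = e_z") (simp_all add: sqc cs cU sq_const)
    show "WD i (\<lambda>x. U (snd x)) (\<lambda>x. if i = e_z then U1 (snd x) else 0)" by (rule W[OF d(1) cU])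
    show "square_integrable (\<lambda>x. if i = e_z \<and> j = e_z then U2 (snd x) else 0)"
    proof (cases "i = e_z \<and> j = e_z")
      case True then show ?thesis by (simp add: sqc cs c)
    next
      case False
      then have eq0: "(\<lambda>x. if i = e_z \<and> j = e_z then U2 (snd x) else 0) = (\<lambda>x::real\<times>real. 0)" by auto
      show ?thesis unfolding eq0 by (rule sq_const)
    qed
    show "WD j (\<lambda>x. if i = e_z then U1 (snd x) else 0) (\<lambda>x. if i = e_z \<and> j = e_z then U2 (snd x) else 0)"
      using W[OF d(2) cU(2) c, of j] W0[of j] by (cases "i = e_z") simp_all
  qed
qed

lemma zero_mean_of_z:
  fixes V V1 :: "real \<Rightarrow> real"
  assumes d: "\<And>t. (V has_real_derivative V1 t) (at t)" and c: "continuous_on UNIV V1" and p: "V (1/2) = V (-1/2)"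
  shows "zero_mean i (\<lambda>x. if i = e_z then V1 (snd x) else 0)"
proof (cases "i = e_z")
  case True
  have "AC_on (-1/2) (1/2) V V1"
    by (rule AC_on_C1) (auto intro!: DERIV_subset[OF d] continuous_on_subset[OF c])
  then have "integral {-1/2..1/2} V1 = 0" using AC_on_diff[of "-1/2" "1/2" V V1 "-1/2" "1/2"] p by simp
  moreover have "V1 \<in> borel_measurable borel" by (rule borel_measurable_continuous_onI[OF c])
  moreover then have "integrable (seg (-1/2) (1/2)) V1"
    by (subst integrable_seg) (auto intro!: absolutely_integrable_continuous_real continuous_on_subset[OF c])
  ultimately have "(\<integral>t. V1 t \<partial>seg (-1/2) (1/2)) = 0" by (simp only: integral_seg)
  then show ?thesis using True by (simp add: zero_mean_def pt_def line_def lo_def hi_def)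
next
  case False then show ?thesis by (simp add: zero_mean_def)
qed

lemma zero_mean_zero: "zero_mean i (\<lambda>x. 0)" by (simp add: zero_mean_def)

text \<open>The way back from lines to weak derivatives, by integration by parts against periodic test functions.\<close>

lemma twice_imp_H_per_2:
  assumes t: "twice_diff u g h" and z: "\<And>i. i \<in> Basis \<Longrightarrow> zero_mean i (g i)" "\<And>i j. i \<in> Basis \<Longrightarrow> j \<in> Basis \<Longrightarrow> zero_mean j (h i j)"
  shows "u \<in> H_per 2"
proof -
  have L: "v \<in> L2_Omega" if "square_integrable v" for v
    using that by (auto simp: L2_Omega_def square_integrable_def integrable_Q_leb intro: meas_leb)
  have g: "g i \<in> H_per (Suc 0)" if i: "i \<in> Basis" for i
  proof -
    have "g i \<in> L2_Omega" using t i by (intro L) (auto simp: twice_diff_def)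
    moreover have "\<exists>k\<in>L2_Omega. has_weak_deriv per_test_fun j (g i) k" if j: "j \<in> Basis" for j
    proof (rule bexI[of _ "h i j"])
      show "h i j \<in> L2_Omega" using t i j by (intro L) (auto simp: twice_diff_def)
      show "has_weak_deriv per_test_fun j (g i) (h i j)"
        by (rule WD_imp_weak_per) (use t i j z in \<open>auto simp: twice_diff_def integrable_sq\<close>)
    qed
    ultimately show ?thesis by simp
  qed
  have "\<exists>k\<in>H_per (Suc 0). has_weak_deriv per_test_fun i u k" if i: "i \<in> Basis" for i
  proof (rule bexI[OF _ g[OF i]])
    show "has_weak_deriv per_test_fun i u (g i)"
      by (rule WD_imp_weak_per) (use t i z in \<open>auto simp: twice_diff_def integrable_sq\<close>)
  qed
  moreover have "u \<in> L2_Omega" using t by (intro L) (simp add: twice_diff_def)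
  ultimately show ?thesis unfolding numeral_2_eq_2 H_per.simps(2)[of "Suc 0"] by blast
qed

lemma Linf_norm_le:
  assumes m: "u \<in> borel_measurable leb_Omega" and b: "AE x in leb_Omega. \<bar>u x\<bar> \<le> k"
  shows "Linf_norm u \<le> ereal k"
  unfolding Linf_norm_def using m b by (intro esssup_I) auto

text \<open>The surface of revolution with profile \<open>(1 + w, Z)\<close>, angle \<open>\<theta>\<close>, and radius and height depending on \<open>z\<close> only. A pointwise
  bound on the density is integrated over the domain of area \<open>2 * pi\<close>.\<close>

lemma axisymmetric_competitor:
  fixes w w1 w2 Z Z1 Z2 :: "real \<Rightarrow> real"
  assumes dw: "\<And>t. (w has_real_derivative w1 t) (at t)" "\<And>t. (w1 has_real_derivative w2 t) (at t)" "continuous_on UNIV w2"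
    and dZ: "\<And>t. (Z has_real_derivative Z1 t) (at t)" "\<And>t. (Z1 has_real_derivative Z2 t) (at t)" "continuous_on UNIV Z2"
    and per: "w (1/2) = w (-1/2)" "w1 (1/2) = w1 (-1/2)" "Z (1/2) - Z (-1/2) = 1 - lam" "Z1 (1/2) = Z1 (-1/2)"
    and sgn: "\<And>t. w t \<ge> 0" "\<And>t. \<bar>w1 t\<bar> \<le> 1" "\<And>t. 0 \<le> Z1 t" "\<And>t. Z1 t \<le> 1" and m: "m \<ge> 1"
    and bound: "\<And>t. ((1 + w t)\<^sup>2 - 1)\<^sup>2 + ((w1 t)\<^sup>2 + (Z1 t)\<^sup>2 - 1)\<^sup>2 + h\<^sup>2 * ((1 + w t)\<^sup>2 + 2 * (w1 t)\<^sup>2 + (w2 t)\<^sup>2 + (Z2 t)\<^sup>2) \<le> h\<^sup>2 + b"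
    and b: "b \<ge> 0"
  shows "min_energy_NL lam 1 m h \<le> ereal (2 * pi * (h\<^sup>2 + b))"
proof -
  define \<Phi> where "\<Phi> = \<lparr>Phi_rho = (\<lambda>x. 1 + w (snd x)), Phi_theta = (\<lambda>x. 0 + 1 * (x \<bullet> e_theta)), Phi_z = (\<lambda>x. Z (snd x))\<rparr>"
  define \<rho>1 where "\<rho>1 i x = (if i = e_z then w1 (snd x) else 0)" for i x :: "real \<times> real"
  define \<rho>2 where "\<rho>2 i j x = (if i = e_z \<and> j = e_z then w2 (snd x) else 0)" for i j x :: "real \<times> real"
  define T1 where "T1 i x = 0 + 1 * (i \<bullet> e_theta)" for i x :: "real \<times> real"
  define T2 where "T2 i j x = (0::real)" for i j x :: "real \<times> real"
  define z1 where "z1 i x = (if i = e_z then Z1 (snd x) else 0)" for i x :: "real \<times> real"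
  define z2 where "z2 i j x = (if i = e_z \<and> j = e_z then Z2 (snd x) else 0)" for i j x :: "real \<times> real"
  have dw': "((\<lambda>t. 1 + w t) has_real_derivative w1 t) (at t)" for t by (auto intro!: derivative_eq_intros dw)
  have t\<rho>: "twice_diff (\<lambda>x. 1 + w (snd x)) \<rho>1 \<rho>2"
    unfolding \<rho>1_def[abs_def] \<rho>2_def[abs_def] by (rule twice_of_z[OF dw' dw(2,3)])
  have tZ: "twice_diff (\<lambda>x. Z (snd x)) z1 z2"
    unfolding z1_def[abs_def] z2_def[abs_def] by (rule twice_of_z[OF dZ])
  have t0: "twice_diff (\<lambda>x. 0) (\<lambda>i x. 0) (\<lambda>i j x. 0)"
    using twice_of_z[of "\<lambda>t. 0" "\<lambda>t. 0" "\<lambda>t. 0"] by simp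
  have tT: "twice_diff (\<lambda>x. 0 + 1 * (x \<bullet> e_theta)) T1 T2"
    using twice_add_lin[OF t0, of 1 e_theta] unfolding T1_def[abs_def] T2_def[abs_def] .
  have c1: "continuous_on UNIV w1" "continuous_on UNIV Z1"
    using DERIV_isCont[OF dw(2)] DERIV_isCont[OF dZ(2)] by (simp_all add: continuous_at_imp_continuous_on)
  have H1: "(\<lambda>x. 1 + w (snd x)) \<in> H_per 2"
  proof (rule twice_imp_H_per_2[OF t\<rho>])
    show "zero_mean i (\<rho>1 i)" for i unfolding \<rho>1_def[abs_def] by (rule zero_mean_of_z[OF dw(1) c1(1) per(1)])
    show "zero_mean j (\<rho>2 i j)" for i j
      using zero_mean_of_z[OF dw(2,3) per(2), of j] zero_mean_zero[of j] unfolding \<rho>2_def[abs_def] by (cases "i = e_z") simp_all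
  qed
  have H2: "(\<lambda>(\<theta>, z). Phi_theta \<Phi> (\<theta>, z) - \<theta>) \<in> H_per 2"
  proof -
    have "(\<lambda>x. 0) \<in> H_per 2" by (rule twice_imp_H_per_2[OF t0]) (rule zero_mean_zero)+
    moreover have "(\<lambda>(\<theta>, z). Phi_theta \<Phi> (\<theta>, z) - \<theta>) = (\<lambda>x. 0)" by (auto simp: \<Phi>_def inner_e fun_eq_iff)
    ultimately show ?thesis by simp
  qed
  have H3: "(\<lambda>(\<theta>, z). Phi_z \<Phi> (\<theta>, z) - (1 - lam) * z) \<in> H_per 2"
  proof -
    define U where "U t = Z t - (1 - lam) * t" for t
    define U1 where "U1 t = Z1 t - (1 - lam)" for t
    have dU: "(U has_real_derivative U1 t) (at t)" "(U1 has_real_derivative Z2 t) (at t)" for t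
      unfolding U_def[abs_def] U1_def[abs_def] by (auto intro!: derivative_eq_intros dZ)
    have pU: "U (1/2) = U (-1/2)" "U1 (1/2) = U1 (-1/2)" using per(3,4) by (auto simp: U_def U1_def algebra_simps)
    have cU: "continuous_on UNIV U1" unfolding U1_def[abs_def] by (intro continuous_intros c1)
    have "(\<lambda>x. U (snd x)) \<in> H_per 2"
    proof (rule twice_imp_H_per_2[OF twice_of_z[OF dU dZ(3)]])
      show "zero_mean i (\<lambda>x. if i = e_z then U1 (snd x) else 0)" for i by (rule zero_mean_of_z[OF dU(1) cU pU(1)])
      show "zero_mean j (\<lambda>x. if i = e_z \<and> j = e_z then Z2 (snd x) else 0)" for i j
        using zero_mean_of_z[OF dU(2) dZ(3) pU(2), of j] zero_mean_zero[of j] by (cases "i = e_z") simp_all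
    qed
    then show ?thesis by (simp add: \<Phi>_def U_def case_prod_unfold)
  qed
  have ms: "u \<in> borel_measurable leb_Omega" if "twice_diff u g k" for u g k
    using that by (auto simp: twice_diff_def square_integrable_def intro: meas_leb)
  note wd\<rho> = weak_deriv_of_twice[OF t\<rho> AE_I2[OF refl] ms[OF t\<rho>]]
  note wdT = weak_deriv_of_twice[OF tT AE_I2[OF refl] ms[OF tT]]
  note wdZ = weak_deriv_of_twice[OF tZ AE_I2[OF refl] ms[OF tZ]]
  have bnd: "\<bar>\<rho>1 i x\<bar> \<le> m" "\<bar>T1 i x\<bar> \<le> m" "\<bar>z1 i x\<bar> \<le> m" if "i \<in> Basis" for i x
  proof -
    show "\<bar>\<rho>1 i x\<bar> \<le> m" using sgn(2)[of "snd x"] m unfolding \<rho>1_def by auto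
    show "\<bar>z1 i x\<bar> \<le> m" using sgn(3,4)[of "snd x"] m unfolding z1_def by auto
    show "\<bar>T1 i x\<bar> \<le> m" using that m by (auto simp: T1_def Basis_dir)
  qed
  have Lr: "Linf_norm (weak_deriv i (\<lambda>x. 1 + w (snd x))) \<le> ereal m" if i: "i \<in> Basis" for i
    by (rule Linf_norm_le[OF wd\<rho>(2)[OF i]]) (use wd\<rho>(1)[OF i] in \<open>eventually_elim, simp add: bnd[OF i]\<close>)
  have LT: "Linf_norm (weak_deriv i (\<lambda>x. 0 + 1 * (x \<bullet> e_theta))) \<le> ereal m" if i: "i \<in> Basis" for i
    by (rule Linf_norm_le[OF wdT(2)[OF i]]) (use wdT(1)[OF i] in \<open>eventually_elim, simp add: bnd[OF i]\<close>)
  have LZ: "Linf_norm (weak_deriv i (\<lambda>x. Z (snd x))) \<le> ereal m" if i: "i \<in> Basis" for i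
    by (rule Linf_norm_le[OF wdZ(2)[OF i]]) (use wdZ(1)[OF i] in \<open>eventually_elim, simp add: bnd[OF i]\<close>)
  have comps: "Phi_rho \<Phi> = (\<lambda>x. 1 + w (snd x))" "Phi_theta \<Phi> = (\<lambda>x. 0 + 1 * (x \<bullet> e_theta))" "Phi_z \<Phi> = (\<lambda>x. Z (snd x))"
    by (simp_all add: \<Phi>_def)
  have mx: "(MAX (i, u) \<in> {e_theta, e_z} \<times> {Phi_rho \<Phi>, Phi_theta \<Phi>, Phi_z \<Phi>}. Linf_norm (weak_deriv i u)) \<le> ereal m"
  proof (rule Max.boundedI)
    fix a assume "a \<in> (\<lambda>(i, u). Linf_norm (weak_deriv i u)) ` ({e_theta, e_z} \<times> {Phi_rho \<Phi>, Phi_theta \<Phi>, Phi_z \<Phi>})"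
    then obtain p where p: "a = (\<lambda>(i, u). Linf_norm (weak_deriv i u)) p" "p \<in> {e_theta, e_z} \<times> {Phi_rho \<Phi>, Phi_theta \<Phi>, Phi_z \<Phi>}"
      by (rule imageE)
    obtain i u where pu: "p = (i, u)" by (cases p)
    have iu: "a = Linf_norm (weak_deriv i u)" "i = e_theta \<or> i = e_z" "u = Phi_rho \<Phi> \<or> u = Phi_theta \<Phi> \<or> u = Phi_z \<Phi>"
      using p unfolding pu by auto
    have "i \<in> Basis" using iu(2) by (auto simp: Basis_dir)
    from iu(3) show "a \<le> ereal m" unfolding iu(1) comps
      using Lr[OF \<open>i \<in> Basis\<close>] LT[OF \<open>i \<in> Basis\<close>] LZ[OF \<open>i \<in> Basis\<close>] by (elim disjE) simp_all
  qed auto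
  have ez: "e_z \<in> Basis" by (simp add: Basis_dir)
  have mono: "AE x in leb_Omega. weak_deriv e_z (Phi_z \<Phi>) x \<ge> 0"
    unfolding comps using wdZ(1)[OF ez] by eventually_elim (simp add: z1_def sgn)
  have adm: "\<Phi> \<in> A_NL lam 1 m"
    unfolding A_NL_def mem_Collect_eq
    by (intro conjI H2 H3 mx mono) (use H1 sgn in \<open>simp_all add: comps\<close>)
  interpret cylindrical "\<lambda>x. 1 + w (snd x)" "\<lambda>x. 0 + 1 * (x \<bullet> e_theta)" "\<lambda>x. Z (snd x)" \<rho>1 T1 z1 \<rho>2 T2 z2 m
    by (unfold_locales) (use t\<rho> tT tZ bnd in auto)
  have "energy_NL h \<Phi> = (\<integral>\<^sup>+x. ennreal (dens h x) \<partial>Q)"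
    by (rule energy_formula) (simp_all only: comps ms[OF t\<rho>] ms[OF tT] ms[OF tZ], auto)
  also have "\<dots> \<le> (\<integral>\<^sup>+x. ennreal (h\<^sup>2 + b) \<partial>Q)"
  proof (intro nn_integral_mono ennreal_leI)
    fix x :: "real \<times> real"
    have "dens h x = ((1 + w (snd x))\<^sup>2 - 1)\<^sup>2 + ((w1 (snd x))\<^sup>2 + (Z1 (snd x))\<^sup>2 - 1)\<^sup>2
       + h\<^sup>2 * ((1 + w (snd x))\<^sup>2 + 2 * (w1 (snd x))\<^sup>2 + (w2 (snd x))\<^sup>2 + (Z2 (snd x))\<^sup>2)"
      unfolding dens_def sum_dirs A_def B_def by (simp add: \<rho>1_def \<rho>2_def T1_def T2_def z1_def z2_def power2_eq_square algebra_simps)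
    then show "dens h x \<le> h\<^sup>2 + b" using bound[of "snd x"] by simp
  qed
  also have "\<dots> = ennreal (2 * pi * (h\<^sup>2 + b))"
  proof -
    have "emeasure Q UNIV = ennreal (2 * pi)" using Qf.emeasure_eq_measure[of UNIV] measure_Q by simp
    then show ?thesis using b by (simp add: ennreal_mult[symmetric] mult.commute del: ennreal_plus)
  qed
  finally have "(INF \<Phi>\<in>A_NL lam 1 m. energy_NL h \<Phi>) \<le> ennreal (2 * pi * (h\<^sup>2 + b))"
    using adm by (rule INF_lower2[rotated])
  then have "min_energy_NL lam 1 m h \<le> enn2ereal (ennreal (2 * pi * (h\<^sup>2 + b)))"
    unfolding min_energy_NL_def by (simp only: less_eq_ennreal.rep_eq)
  then show ?thesis by (subst (asm) enn2ereal_ennreal) (use b in auto)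
qed

lemma flat_competitor:
  assumes m: "m \<ge> 1" and lam: "0 \<le> lam" "lam \<le> 1/2"
  shows "min_energy_NL lam 1 m h \<le> ereal (2 * pi * (h\<^sup>2 + 4 * lam\<^sup>2))"
proof (rule axisymmetric_competitor[where w="\<lambda>t. 0" and ?w1.0="\<lambda>t. 0" and ?w2.0="\<lambda>t. 0" and Z="\<lambda>t. (1 - lam) * t" and ?Z1.0="\<lambda>t. 1 - lam" and ?Z2.0="\<lambda>t. 0"])
  fix t :: real
  have "((1 - lam)\<^sup>2 - 1)\<^sup>2 = lam\<^sup>2 * (2 - lam)\<^sup>2" by (simp add: power2_eq_square algebra_simps)
  also have "\<dots> \<le> lam\<^sup>2 * 2\<^sup>2" using lam by (intro mult_left_mono power_mono) auto
  finally show "((1 + 0)\<^sup>2 - 1)\<^sup>2 + (0\<^sup>2 + (1 - lam)\<^sup>2 - 1)\<^sup>2 + h\<^sup>2 * ((1 + 0)\<^sup>2 + 2 * 0\<^sup>2 + 0\<^sup>2 + 0\<^sup>2) \<le> h\<^sup>2 + 4 * lam\<^sup>2" by simp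
qed (use m lam in \<open>auto intro!: derivative_eq_intros simp: algebra_simps\<close>)

text \<open>With \<open>s = sin (k * z)\<close> and \<open>k = 2 * pi * N\<close>, the profile has the slopes \<open>Z1 = 1 - 2 * lam * s\<^sup>2\<close>, whose mean is \<open>1 - lam\<close>, and
  \<open>w1 = 2 * \<surd>lam * s * \<surd>(1 - lam * s\<^sup>2)\<close>, so that \<open>w1\<^sup>2 + Z1\<^sup>2 = 1\<close> and there is no axial stretching. What remains
  is the angular stretching, of order \<open>lam / N\<^sup>2\<close> because \<open>w\<close> is of order \<open>\<surd>lam / N\<close>, and the bending energy, of order
  \<open>h\<^sup>2 * N\<^sup>2 * lam\<close>.\<close>

lemma wrinkled_competitor:
  fixes N :: nat
  assumes m: "m \<ge> 1" and lam: "0 < lam" "lam \<le> 1/2" and N: "N \<ge> 1"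
  shows "min_energy_NL lam 1 m h \<le> ereal (2 * pi * (h\<^sup>2 + (9 * lam / (real N)\<^sup>2 + h\<^sup>2 * (3 * sqrt lam / real N + 8 * lam + 960 * (real N)\<^sup>2 * lam))))"
proof -
  define r where "r c = sqrt (1 - lam + lam * c\<^sup>2)" for c
  define q where "q c = 2 * sqrt lam * r c" for c
  define q' where "q' c = 2 * sqrt lam * (lam * c / r c)" for c
  have pos: "1 - lam + lam * c\<^sup>2 > 0" for c using lam by (simp add: add_pos_nonneg)
  have r: "r c > 0" "(r c)\<^sup>2 = 1 - lam + lam * c\<^sup>2" for c using pos[of c] by (simp_all add: r_def)
  have dr: "(r has_real_derivative lam * c / r c) (at c)" for c
    unfolding r_def[abs_def] using pos[of c] by (auto intro!: derivative_eq_intros simp: field_simps)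
  have dq: "(q has_real_derivative q' c) (at c)" for c
    unfolding q_def[abs_def] q'_def by (auto intro!: derivative_eq_intros dr)
  have cq: "continuous_on UNIV q" using DERIV_isCont[OF dq] by (simp add: continuous_at_imp_continuous_on)
  have cr: "continuous_on UNIV r" using DERIV_isCont[OF dr] by (simp add: continuous_at_imp_continuous_on)
  obtain P where P: "\<And>x. (P has_real_derivative q x) (at x)" using primitive_exists[OF cq] by blast
  define k where "k = 2 * pi * real N"
  have k: "k > 0" using N by (simp add: k_def)
  \<comment> \<open>Writing \<open>w\<close> through a primitive \<open>P\<close> of \<open>q\<close> in the variable \<open>cos (k * z)\<close> makes it periodic and
    nonnegative.\<close>
  define w where "w z = (P 1 - P (cos (k * z))) / k" for z
  define w1 where "w1 z = q (cos (k * z)) * sin (k * z)" for z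
  define w2 where "w2 z = k * (q (cos (k * z)) * cos (k * z) - q' (cos (k * z)) * (sin (k * z))\<^sup>2)" for z
  define Z where "Z z = (1 - lam) * z + lam * sin (2 * (k * z)) / (2 * k)" for z
  define Z1 where "Z1 z = 1 - lam + lam * cos (2 * (k * z))" for z
  define Z2 where "Z2 z = - (2 * k * lam * sin (2 * (k * z)))" for z
  have Z1': "Z1 z = 1 - 2 * lam * (sin (k * z))\<^sup>2" for z unfolding Z1_def cos_double_sin by (simp add: algebra_simps)
  have r2: "(r (cos (k * z)))\<^sup>2 = 1 - lam * (sin (k * z))\<^sup>2" for z
    using r(2)[of "cos (k * z)"] by (simp add: cos_squared_eq algebra_simps)
  have w1sq: "(w1 z)\<^sup>2 = 4 * lam * (1 - lam * (sin (k * z))\<^sup>2) * (sin (k * z))\<^sup>2" for z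
    using lam by (simp add: w1_def q_def power_mult_distrib r2)
  have arc: "(w1 z)\<^sup>2 + (Z1 z)\<^sup>2 = 1" for z
    unfolding w1sq Z1' by (simp add: power2_eq_square algebra_simps)
  have Z1b: "0 \<le> Z1 z" "Z1 z \<le> 1" for z
  proof -
    have "(sin (k * z))\<^sup>2 \<le> 1" by (simp add: abs_square_le_1)
    then have "2 * lam * (sin (k * z))\<^sup>2 \<le> 1 * 1" using lam by (intro mult_mono) auto
    then show "0 \<le> Z1 z" "Z1 z \<le> 1" unfolding Z1' using lam by auto
  qed
  have w1b: "\<bar>w1 z\<bar> \<le> 1" for z using arc[of z] by (metis abs_square_le_1 le_add_same_cancel1 zero_le_power2)
  have w1l: "(w1 z)\<^sup>2 \<le> 4 * lam" for z
  proof -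
    have s: "(sin (k * z))\<^sup>2 \<le> 1" by (simp add: abs_square_le_1)
    have "(1 - lam * (sin (k * z))\<^sup>2) * (sin (k * z))\<^sup>2 \<le> 1 * 1" using s lam by (intro mult_mono) auto
    then have "4 * lam * ((1 - lam * (sin (k * z))\<^sup>2) * (sin (k * z))\<^sup>2) \<le> 4 * lam * 1" using lam by (intro mult_left_mono) auto
    then show ?thesis unfolding w1sq by (simp add: mult.assoc)
  qed
  have rb: "r c \<le> 1" "lam * \<bar>c\<bar> \<le> r c" if "\<bar>c\<bar> \<le> 1" for c
  proof -
    have c2: "c\<^sup>2 \<le> 1" using that by (simp add: abs_square_le_1)
    have "(r c)\<^sup>2 \<le> 1\<^sup>2" unfolding r(2) using mult_left_mono[OF c2, of lam] lam by simp
    then show "r c \<le> 1" by (rule power2_le_imp_le) simp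
    have "(lam * \<bar>c\<bar>)\<^sup>2 \<le> (1/2)\<^sup>2" using lam that mult_mono[of lam "1/2" "\<bar>c\<bar>" 1] by (intro power_mono) auto
    also have "\<dots> \<le> (r c)\<^sup>2" unfolding r(2) using lam by (simp add: power2_eq_square add_increasing2)
    finally show "lam * \<bar>c\<bar> \<le> r c" by (rule power2_le_imp_le) (use r(1)[of c] in simp)
  qed
  have qb: "0 \<le> q c" "q c \<le> 2 * sqrt lam" "\<bar>q' c\<bar> \<le> 2 * sqrt lam" if "\<bar>c\<bar> \<le> 1" for c
  proof -
    show "0 \<le> q c" using r(1)[of c] lam by (simp add: q_def)
    show "q c \<le> 2 * sqrt lam" using rb(1)[OF that] lam by (simp add: q_def mult_left_le)
    have "\<bar>lam * c / r c\<bar> \<le> 1" using rb(2)[OF that] r(1)[of c] lam by (simp add: abs_mult)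
    from mult_left_mono[OF this, of "2 * sqrt lam"] show "\<bar>q' c\<bar> \<le> 2 * sqrt lam"
      unfolding q'_def abs_mult[of "2 * sqrt lam"] using lam by simp
  qed
  have w0: "0 \<le> w z" for z
  proof -
    have "P (cos (k * z)) \<le> P 1"
    proof (rule DERIV_nonneg_imp_nondecreasing[where f=P and a="cos (k * z)" and b=1])
      fix x assume "cos (k * z) \<le> x" "x \<le> 1"
      show "\<exists>y. (P has_real_derivative y) (at x) \<and> 0 \<le> y" using P[of x] r(1)[of x] lam by (intro exI[of _ "q x"]) (simp add: q_def)
    qed simp
    then show ?thesis using k by (simp add: w_def)
  qed
  have wl: "w z \<le> sqrt lam / real N" for z
  proof -
    have "P 1 - 2 * sqrt lam * 1 \<le> P (cos (k * z)) - 2 * sqrt lam * cos (k * z)"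
    proof (rule DERIV_nonpos_imp_nonincreasing[where f="\<lambda>x. P x - 2 * sqrt lam * x"])
      fix x assume x: "cos (k * z) \<le> x" "x \<le> 1"
      then have "\<bar>x\<bar> \<le> 1" using order_trans[OF cos_ge_minus_one[of "k * z"] x(1)] by (simp add: abs_le_iff)
      then show "\<exists>y. ((\<lambda>x. P x - 2 * sqrt lam * x) has_real_derivative y) (at x) \<and> y \<le> 0"
        using qb(2)[of x] by (intro exI[of _ "q x - 2 * sqrt lam"]) (auto intro!: derivative_eq_intros P)
    qed simp
    then have "P 1 - P (cos (k * z)) \<le> 2 * sqrt lam * (1 - cos (k * z))" by (simp add: right_diff_distrib)
    also have "\<dots> \<le> 2 * sqrt lam * 2" using cos_ge_minus_one[of "k * z"] lam by (intro mult_left_mono) auto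
    finally have "w z \<le> 4 * sqrt lam / k" unfolding w_def using k by (intro divide_right_mono) auto
    also have "\<dots> \<le> 4 * sqrt lam / (4 * real N)"
      using k N lam pi_gt3 by (intro divide_left_mono) (auto simp: k_def)
    finally show ?thesis by simp
  qed
  have k2: "k\<^sup>2 \<le> 40 * (real N)\<^sup>2"
  proof -
    have "pi\<^sup>2 \<le> (3.15)\<^sup>2" using pi_approx(2) by (intro power_mono) auto
    then have "4 * pi\<^sup>2 \<le> 40" by (simp add: power2_eq_square)
    then have "(4 * pi\<^sup>2) * (real N)\<^sup>2 \<le> 40 * (real N)\<^sup>2" by (intro mult_right_mono) auto
    then show ?thesis by (simp add: k_def power_mult_distrib)
  qed
  have w2b: "(w2 z)\<^sup>2 \<le> 640 * (real N)\<^sup>2 * lam" for z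
  proof -
    define c s where "c = cos (k * z)" and "s = sin (k * z)"
    have c: "\<bar>c\<bar> \<le> 1" "s\<^sup>2 \<le> 1" by (simp_all add: c_def s_def abs_square_le_1)
    have "\<bar>q c * c\<bar> \<le> 2 * sqrt lam * 1" unfolding abs_mult using qb[OF c(1)] c lam by (intro mult_mono) auto
    moreover have "\<bar>q' c * s\<^sup>2\<bar> \<le> 2 * sqrt lam * 1" unfolding abs_mult using qb[OF c(1)] c lam by (intro mult_mono) auto
    ultimately have "\<bar>q c * c - q' c * s\<^sup>2\<bar> \<le> 4 * sqrt lam" by linarith
    then have "\<bar>q c * c - q' c * s\<^sup>2\<bar>\<^sup>2 \<le> (4 * sqrt lam)\<^sup>2" by (intro power_mono) auto
    then have "(q c * c - q' c * s\<^sup>2)\<^sup>2 \<le> 16 * lam" using lam by (simp add: power_mult_distrib)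
    then have "k\<^sup>2 * (q c * c - q' c * s\<^sup>2)\<^sup>2 \<le> (40 * (real N)\<^sup>2) * (16 * lam)" using k2 by (intro mult_mono) auto
    then show ?thesis by (simp add: w2_def c_def s_def power_mult_distrib)
  qed
  have Z2b: "(Z2 z)\<^sup>2 \<le> 320 * (real N)\<^sup>2 * lam" for z
  proof -
    have "(sin (2 * (k * z)))\<^sup>2 \<le> 1" by (simp add: abs_square_le_1)
    then have "(4 * k\<^sup>2 * lam\<^sup>2) * (sin (2 * (k * z)))\<^sup>2 \<le> 4 * k\<^sup>2 * lam\<^sup>2" by (intro mult_left_le) auto
    also have "\<dots> \<le> 4 * (40 * (real N)\<^sup>2) * lam"
      using k2 lam by (intro mult_mono) (auto simp: power2_eq_square mult_left_le)
    also have "\<dots> \<le> 320 * (real N)\<^sup>2 * lam" using lam by (simp add: mult_right_mono)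
    finally show ?thesis by (simp add: Z2_def power_mult_distrib mult_ac)
  qed
  have sinz: "sin (k * (1/2)) = 0" by (simp add: k_def mult.commute[of pi])
  show ?thesis
  proof (rule axisymmetric_competitor[where w=w and ?w1.0=w1 and ?w2.0=w2 and Z=Z and ?Z1.0=Z1 and ?Z2.0=Z2])
    show "(w has_real_derivative w1 t) (at t)" for t
      unfolding w_def[abs_def] w1_def using k by (auto intro!: derivative_eq_intros DERIV_chain2[OF P])
    show "(w1 has_real_derivative w2 t) (at t)" for t
      unfolding w1_def[abs_def] w2_def
      by (auto intro!: derivative_eq_intros DERIV_chain2[OF dq] simp: power2_eq_square algebra_simps)
    show "(Z has_real_derivative Z1 t) (at t)" for t
      unfolding Z_def[abs_def] Z1_def using k by (auto intro!: derivative_eq_intros)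
    show "(Z1 has_real_derivative Z2 t) (at t)" for t
      unfolding Z1_def[abs_def] Z2_def by (auto intro!: derivative_eq_intros)
    show "continuous_on UNIV w2"
    proof -
      have r0: "r x \<noteq> 0" for x using r(1)[of x] by simp
      have q1: "continuous_on UNIV q'" unfolding q'_def[abs_def]
        by (intro continuous_on_mult continuous_on_divide continuous_on_const continuous_on_id cr ballI r0)
      have cc: "continuous_on UNIV (\<lambda>z. cos (k * z))" "continuous_on UNIV (\<lambda>z. sin (k * z))" by (intro continuous_intros)+
      have "continuous_on UNIV (\<lambda>z. q (cos (k * z)))" "continuous_on UNIV (\<lambda>z. q' (cos (k * z)))"
        by (rule continuous_on_compose2[OF cq cc(1)], simp, rule continuous_on_compose2[OF q1 cc(1)], simp)
      then show ?thesis unfolding w2_def[abs_def] by (intro continuous_on_mult continuous_on_diff continuous_on_power continuous_on_const cc)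
    qed
    show "continuous_on UNIV Z2" unfolding Z2_def[abs_def] by (intro continuous_intros)
    show "w (1/2) = w (-1/2)" by (simp add: w_def)
    show "w1 (1/2) = w1 (-1/2)" using sinz by (simp add: w1_def)
    show "Z (1/2) - Z (-1/2) = 1 - lam"
    proof -
      have "sin (2 * (k * (1/2))) = 0" unfolding sin_double sinz by simp
      then show ?thesis by (simp add: Z_def)
    qed
    show "Z1 (1/2) = Z1 (-1/2)" by (simp add: Z1_def)
    show "0 \<le> 9 * lam / (real N)\<^sup>2 + h\<^sup>2 * (3 * sqrt lam / real N + 8 * lam + 960 * (real N)\<^sup>2 * lam)"
      using lam by simp
    fix t
    have sl: "sqrt lam \<le> 1" using lam real_sqrt_le_mono[of lam 1] by simp
    have wN: "w t \<le> 1"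
    proof -
      have "sqrt lam \<le> real N" using sl N by (rule_tac order_trans[of _ 1]) simp_all
      then have "sqrt lam / real N \<le> 1" using N by simp
      then show ?thesis using wl[of t] by simp
    qed
    have g1: "(1 + w t)\<^sup>2 - 1 \<le> 3 * sqrt lam / real N"
    proof -
      have "(1 + w t)\<^sup>2 - 1 = w t * (2 + w t)" by (simp add: power2_eq_square algebra_simps)
      also have "\<dots> \<le> (sqrt lam / real N) * 3" using wl[of t] w0[of t] wN lam by (intro mult_mono) auto
      finally show ?thesis by (simp add: mult.commute)
    qed
    have g0: "(1 + w t)\<^sup>2 - 1 \<ge> 0" using w0[of t] by (simp add: power2_eq_square algebra_simps)
    have "((1 + w t)\<^sup>2 - 1)\<^sup>2 \<le> (3 * sqrt lam / real N)\<^sup>2" using g0 g1 by (intro power_mono) auto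
    also have "\<dots> = 9 * lam / (real N)\<^sup>2" using lam by (simp add: power_divide power_mult_distrib)
    finally have a1: "((1 + w t)\<^sup>2 - 1)\<^sup>2 \<le> 9 * lam / (real N)\<^sup>2" .
    have "(1 + w t)\<^sup>2 + 2 * (w1 t)\<^sup>2 + (w2 t)\<^sup>2 + (Z2 t)\<^sup>2 \<le> 1 + (3 * sqrt lam / real N + 8 * lam + 960 * (real N)\<^sup>2 * lam)"
      using g1 w1l[of t] w2b[of t] Z2b[of t] by linarith
    then have "h\<^sup>2 * ((1 + w t)\<^sup>2 + 2 * (w1 t)\<^sup>2 + (w2 t)\<^sup>2 + (Z2 t)\<^sup>2) \<le> h\<^sup>2 * (1 + (3 * sqrt lam / real N + 8 * lam + 960 * (real N)\<^sup>2 * lam))"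
      by (intro mult_left_mono) auto
    then show "((1 + w t)\<^sup>2 - 1)\<^sup>2 + ((w1 t)\<^sup>2 + (Z1 t)\<^sup>2 - 1)\<^sup>2 + h\<^sup>2 * ((1 + w t)\<^sup>2 + 2 * (w1 t)\<^sup>2 + (w2 t)\<^sup>2 + (Z2 t)\<^sup>2)
      \<le> h\<^sup>2 + (9 * lam / (real N)\<^sup>2 + h\<^sup>2 * (3 * sqrt lam / real N + 8 * lam + 960 * (real N)\<^sup>2 * lam))"
      using a1 unfolding arc by (simp add: distrib_left)
  qed (use m w0 w1b Z1b in auto)
qed

text \<open>For \<open>lam < h\<close> the compressed cylinder is better. Otherwise \<open>N\<close> is \<open>h powr (-1/2)\<close> rounded up, and the constant is
  \<open>8 * (9 + 3 + 4 + 960 * 4)\<close>, where \<open>8\<close> bounds \<open>2 * pi\<close>.\<close>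

lemma energy_upper_bound:
  assumes m: "m \<ge> 1" and h: "0 < h" "h \<le> 1/2" and lam: "0 < lam" "lam \<le> 1/2"
  shows "min_energy_NL lam 1 m h - ereal (bulk_energy_NL 1 h) \<le> ereal (30848 * min (lam * h) (lam\<^sup>2))"
proof -
  have red: "min_energy_NL lam 1 m h - ereal (bulk_energy_NL 1 h) \<le> ereal (8 * b)"
    if "min_energy_NL lam 1 m h \<le> ereal (2 * pi * (h\<^sup>2 + b))" "b \<ge> 0" for b
  proof -
    have "min_energy_NL lam 1 m h - ereal (bulk_energy_NL 1 h) \<le> ereal (2 * pi * (h\<^sup>2 + b)) - ereal (2 * pi * h\<^sup>2)"
      unfolding bulk_one by (intro ereal_minus_mono that order_refl)
    also have "\<dots> = ereal (2 * pi * b)" by (simp add: algebra_simps)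
    also have "\<dots> \<le> ereal (8 * b)" using that(2) pi_less_4 by (simp add: mult_right_mono)
    finally show ?thesis .
  qed
  show ?thesis
  proof (cases "lam < h")
    case True
    then have mn: "min (lam * h) (lam\<^sup>2) = lam\<^sup>2" using lam by (simp add: min_def power2_eq_square)
    have "min_energy_NL lam 1 m h - ereal (bulk_energy_NL 1 h) \<le> ereal (8 * (4 * lam\<^sup>2))"
      by (rule red[OF flat_competitor[OF m]]) (use lam in auto)
    also have "\<dots> \<le> ereal (30848 * lam\<^sup>2)" by simp
    finally show ?thesis unfolding mn .
  next
    case False
    then have mn: "min (lam * h) (lam\<^sup>2) = lam * h" using lam by (simp add: min_def power2_eq_square)
    define s where "s = 1 / sqrt h"
    have sh: "sqrt h > 0" "sqrt h \<le> 1" using h real_sqrt_le_mono[of h 1] by simp_all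
    have s: "s \<ge> 1" "s\<^sup>2 = 1 / h" using sh h by (simp_all add: s_def power_divide)
    define N where "N = nat \<lceil>s\<rceil>"
    have Ns: "s \<le> real N" "real N \<le> 2 * s"
    proof -
      have "real N = of_int \<lceil>s\<rceil>" using s(1) by (simp add: N_def)
      then show "s \<le> real N" "real N \<le> 2 * s" using s(1) ceiling_correct[of s] by linarith+
    qed
    have N: "N \<ge> 1" using Ns(1) s(1) by linarith
    have N2: "1 / (real N)\<^sup>2 \<le> h" "(real N)\<^sup>2 \<le> 4 / h"
    proof -
      have "1 / h \<le> (real N)\<^sup>2" using power_mono[OF Ns(1), of 2] s by simp
      then show "1 / (real N)\<^sup>2 \<le> h" using h N by (simp add: field_simps)
      have "(real N)\<^sup>2 \<le> (2 * s)\<^sup>2" using Ns(2) by (intro power_mono) auto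
      then show "(real N)\<^sup>2 \<le> 4 / h" using s(2) by (simp add: power_mult_distrib)
    qed
    define b where "b = 9 * lam / (real N)\<^sup>2 + h\<^sup>2 * (3 * sqrt lam / real N + 8 * lam + 960 * (real N)\<^sup>2 * lam)"
    have b0: "b \<ge> 0" using lam by (simp add: b_def)
    have "b = 9 * lam * (1 / (real N)\<^sup>2) + 3 * h * (h * (sqrt lam / real N)) + 8 * h * (h * lam) + 960 * h\<^sup>2 * lam * (real N)\<^sup>2"
      by (simp add: b_def power2_eq_square algebra_simps)
    also have "\<dots> \<le> 9 * lam * h + 3 * h * lam + 8 * h * (1/2 * lam) + 960 * h\<^sup>2 * lam * (4 / h)"
    proof (intro add_mono mult_left_mono N2)
      have "sqrt lam / real N \<le> sqrt lam / 1" using N lam by (intro divide_left_mono) auto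
      also have "\<dots> \<le> 1" using lam real_sqrt_le_mono[of lam 1] by simp
      finally have "h * (sqrt lam / real N) \<le> h * 1" using h by (intro mult_left_mono) auto
      then show "h * (sqrt lam / real N) \<le> lam" using False by simp
    qed (use h lam in auto)
    also have "\<dots> = 3856 * (lam * h)" using h by (simp add: power2_eq_square)
    finally have bl: "b \<le> 3856 * (lam * h)" .
    have "min_energy_NL lam 1 m h - ereal (bulk_energy_NL 1 h) \<le> ereal (8 * b)"
      by (rule red[OF _ b0], unfold b_def, rule wrinkled_competitor[OF m lam N])
    also have "\<dots> \<le> ereal (30848 * (lam * h))"
    proof -
      have "8 * b \<le> 30848 * (lam * h)" using bl by linarith
      then show ?thesis by (simp only: ereal_less_eq)
    qed
    finally show ?thesis unfolding mn .
  qed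
qed

theorem theorem1p9:
  shows "(\<forall>m\<ge>1. \<exists>C>0. \<forall>h\<in>{0<..1/2}. \<forall>lam\<in>{0<..1/2}.
            ereal (min (max (h * lam powr (3/2)) ((h * lam) powr (12/11))) (lam\<^sup>2))
              \<le> ereal C * (min_energy_NL lam 1 m h - ereal (bulk_energy_NL 1 h)))
       \<and> (\<exists>C>0. \<forall>m\<ge>1. \<forall>h\<in>{0<..1/2}. \<forall>lam\<in>{0<..1/2}.
            min_energy_NL lam 1 m h - ereal (bulk_energy_NL 1 h)
              \<le> ereal (C * min (lam * h) (lam\<^sup>2)))"
proof (intro conjI)
  show "\<forall>m\<ge>1. \<exists>C>0. \<forall>h\<in>{0<..1/2}. \<forall>lam\<in>{0<..1/2}.
      ereal (min (max (h * lam powr (3/2)) ((h * lam) powr (12/11))) (lam\<^sup>2))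
        \<le> ereal C * (min_energy_NL lam 1 m h - ereal (bulk_energy_NL 1 h))"
    using energy_lower_bound by blast
  show "\<exists>C>0. \<forall>m\<ge>1. \<forall>h\<in>{0<..1/2}. \<forall>lam\<in>{0<..1/2}.
      min_energy_NL lam 1 m h - ereal (bulk_energy_NL 1 h) \<le> ereal (C * min (lam * h) (lam\<^sup>2))"
    by (intro exI[of _ 30848] conjI allI impI ballI energy_upper_bound) auto
qed

end
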